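(* Almost everywhere, $\limsup_{n\to\infty}\frac{\mathsf a'_n}{\sum_{k=1}^{n-1}\mathsf a'_k}=\infty$. More generally, let $g:[0,\infty)\to(3,\infty)$ be measurable with the property that $g(\eta(t))\asymp g(t)$ whenever $\eta(t)\sim t$ as $t\to\infty$. Then for some (any sufficiently large) $c>1$, \[ \limsup_{n\to\infty}\frac{g(\mathsf a'_n)}{\sum_{k=1}^{n-1}\mathsf a'_k}=\infty\ \text{a.e.}\quad\Longleftrightarrow\quad\int_c^\infty\frac{g(y)}{\log\log g(y)}\frac{dy}{y^2\log y}=\infty, \] while if the integral is finite, $\lim_{n\to\infty}\frac{g(\mathsf a'_n)}{\sum_{k=1}^{n-1}\mathsf a'_k}=0$ a.e.
   Context: $I=(0,1]$, "a.e." refers to Lebesgue measure on $I$, $\mathsf a_n(x)$ denotes the $n$-th continued fraction digit of $x\in I$. $\mathbb P$ is the set of primes. The prime digits are $\mathsf a'_n(x):=\mathsf a_n(x)$ if $\mathsf a_n(x)\in\mathbb P$ and $\mathsf a'_n(x):=0$ otherwise (ratios with zero denominator are interpreted as $+\infty$ or ignored; eventually the denominators are positive a.e.). $g(t)\sim h(t)$ means $g(t)/h(t)\to1$; $g(t)\asymp h(t)$ means $0<\liminf_{t\to\infty}g(t)/h(t)\le\limsup_{t\to\infty}g(t)/h(t)<\infty$. *)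

theory Defs
  imports "HOL-Analysis.Analysis" "HOL-Library.Landau_Symbols"
          "HOL-Computational_Algebra.Primes"
begin

text \<open>Gauss map on (0,1]; with the convention 1/0 = 0 it maps 0 to 0.\<close>
definition gauss_map :: "real \<Rightarrow> real" where
  "gauss_map x = frac (1 / x)"

definition cf_digit :: "nat \<Rightarrow> real \<Rightarrow> nat" where
  "cf_digit n x = nat \<lfloor>1 / ((gauss_map ^^ (n - 1)) x)\<rfloor>"

definition prime_digit :: "nat \<Rightarrow> real \<Rightarrow> nat" where
  "prime_digit n x = (if prime (cf_digit n x) then cf_digit n x else 0)"

definition pd_ratio :: "real \<Rightarrow> nat \<Rightarrow> real \<Rightarrow> ereal" where
  "pd_ratio num n x =
     (let S = (\<Sum>k=1..<n. real (prime_digit k x))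
      in if S = 0 then \<infinity> else ereal (num / S))"

definition asymp_order :: "(real \<Rightarrow> real) \<Rightarrow> (real \<Rightarrow> real) \<Rightarrow> bool" where
  "asymp_order f h \<longleftrightarrow>
     0 < Liminf at_top (\<lambda>t. ereal (f t / h t)) \<and>
     Liminf at_top (\<lambda>t. ereal (f t / h t)) \<le> Limsup at_top (\<lambda>t. ereal (f t / h t)) \<and>
     Limsup at_top (\<lambda>t. ereal (f t / h t)) < \<infinity>"

end

theory Submission
  imports Defs "HOL-Real_Asymp.Real_Asymp"
begin

text \<open>Started from the density \<open>(1 + r) / (1 + r x)\<^sup>2\<close>, the Gauss map turns the law of the orbit after one step
  into a mixture of densities of the same form. Hence, given any past, the next digit equals \<open>a\<close> with probability
  between \<open>1 / (3 a\<^sup>2)\<close> and \<open>2 / a\<^sup>2\<close>; this replaces independence in both Borel--Cantelli lemmas. By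
  Chebyshev's estimates on the blocks \<open>(16\<^sup>j, 16\<^sup>j\<^sup>+\<^sup>1]\<close> the sum of \<open>1 / p\<close> over primes up to \<open>x\<close> has order
  \<open>ln (ln x)\<close>, so the sum of the first \<open>n\<close> prime digits has order at least \<open>n ln (ln n)\<close> almost everywhere (via its Laplace
  transform) and at most this order in probability (via truncation). The number of \<open>n\<close> with \<open>n ln (ln n) < g p\<close> has
  order \<open>g p / ln (ln (g p))\<close>, and the regularity of \<open>g\<close> makes it comparable on each block,
  so the expected number of \<open>n\<close> with \<open>g (a'\<^sub>n) > \<kappa> n ln (ln n)\<close> is infinite exactly when the integral is.\<close>

section \<open>The law of the digits\<close>

text \<open>The density is the classical one: if the first \<open>n\<close> digits of a Lebesgue
  random point are known, its \<open>n\<close>-th image under the Gauss map has density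
  \<open>(1 + r) / (1 + r x)\<^sup>2\<close>, where \<open>r\<close> is the ratio of the
  denominators of the last two convergents. Lebesgue measure is \<open>r = 0\<close>, and a new
  digit \<open>a\<close> replaces \<open>r\<close> by \<open>1 / (a + r)\<close>. So
  \<open>r\<close> never leaves \<open>[0, 1]\<close>, and every estimate is made uniformly in
  \<open>r\<close> there. The two halves need different information on the preceding digits. For
  convergence an a.e. lower bound of their sum is enough. For divergence an upper bound is needed,
  and none of order \<open>n ln (ln n)\<close> holds a.e.: single prime digits exceed every multiple
  of it infinitely often, by the very count behind the first claim. This is why the upper bound is
  only in probability and has to be combined with the next digit by conditioning on the
  past.\<close>

definition gauss_density :: "real \<Rightarrow> real measure" where
  "gauss_density r =
     density lborel (\<lambda>x. ennreal ((1 + r) / (1 + r * x)\<^sup>2) * indicator {0<..<1} x)"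

text \<open>The probability under \<open>gauss_density r\<close> that the first digit is
  \<open>a\<close>: the increment of the primitive \<open>(1 + r) x / (1 + r x)\<close> from
  \<open>1 / (a + 1)\<close> to \<open>1 / a\<close>.\<close>

definition digit_weight :: "real \<Rightarrow> nat \<Rightarrow> real" where
  "digit_weight r a = (1 + r) / ((real a + r) * (real a + r + 1))"

lemma sets_gauss_density [simp, measurable_cong]: "sets (gauss_density r) = sets borel"
  by (simp add: gauss_density_def)

lemma space_gauss_density [simp]: "space (gauss_density r) = UNIV"
  by (simp add: gauss_density_def)

lemma measurable_gauss_map [measurable]: "gauss_map \<in> borel_measurable borel"
  unfolding gauss_map_def frac_def by measurable

lemma measurable_gauss_map_iter [measurable]: "(gauss_map ^^ n) \<in> borel_measurable borel"
  by (induction n) (auto intro: measurable_gauss_map)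

lemma measurable_cf_digit [measurable]: "cf_digit n \<in> borel \<rightarrow>\<^sub>M count_space UNIV"
  unfolding cf_digit_def by measurable

lemma cf_digit_Suc_Suc: "cf_digit (Suc (Suc n)) x = cf_digit (Suc n) (gauss_map x)"
  by (simp add: cf_digit_def funpow_swap1)

lemma cf_digit_1: "cf_digit (Suc 0) x = nat \<lfloor>1 / x\<rfloor>"
  by (simp add: cf_digit_def)

text \<open>Change of variables along the inverse branch of the Gauss map with digit
  \<open>a + 1\<close>. This branch is decreasing, but the substitution rule wants a nonnegative
  derivative; hence the detour through \<open>u = 1 - t\<close>.\<close>

lemma branch_substitution:
  fixes f :: "real \<Rightarrow> ennreal" and a :: nat
  assumes [measurable]: "f \<in> borel_measurable borel"
  shows "(\<integral>\<^sup>+x. f x * indicator {1 / (real a + 2)..1 / (real a + 1)} x \<partial>lborel) =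
         (\<integral>\<^sup>+t. f (1 / (real a + 1 + t)) * ennreal (1 / (real a + 1 + t)\<^sup>2) * indicator {0..1} t \<partial>lborel)"
proof -
  have "(\<integral>\<^sup>+x. f x * indicator {1 / (real a + 2 - 0)..1 / (real a + 2 - 1)} x \<partial>lborel) =
     (\<integral>\<^sup>+u. f (1 / (real a + 2 - u)) * ennreal (1 / (real a + 2 - u)\<^sup>2) * indicator {0..1} u \<partial>lborel)"
  proof (rule nn_integral_substitution_aux)
    show "((\<lambda>u. 1 / (real a + 2 - u)) has_real_derivative 1 / (real a + 2 - u)\<^sup>2) (at u)"
      if "u \<in> {0..1}" for u
      using that by (auto intro!: derivative_eq_intros simp: power2_eq_square)
    show "continuous_on {0..1} (\<lambda>u. 1 / (real a + 2 - u)\<^sup>2)"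
      by (auto intro!: continuous_intros)
  qed auto
  also have "\<dots> = (\<integral>\<^sup>+t. f (1 / (real a + 2 - (1 + (-1) * t))) * ennreal (1 / (real a + 2 - (1 + (-1) * t))\<^sup>2)
                   * indicator {0..1} (1 + (-1) * t) \<partial>lborel)"
    by (subst nn_integral_real_affine[where c = "-1" and t = 1]) auto
  also have "\<dots> = (\<integral>\<^sup>+t. f (1 / (real a + 1 + t)) * ennreal (1 / (real a + 1 + t)\<^sup>2) * indicator {0..1} t \<partial>lborel)"
    by (intro nn_integral_cong) (auto split: split_indicator simp: algebra_simps)
  finally show ?thesis by (simp add: algebra_simps)
qed

text \<open>This makes the family of densities closed under the Gauss map. With
  \<open>A = a + 1 + r\<close> both sides equal \<open>(1 + r) / (A + t)\<^sup>2\<close>.\<close>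

lemma gauss_density_branch:
  assumes "0 \<le> r" "0 \<le> t"
  shows "(1 + r) / (1 + r * (1 / (real a + 1 + t)))\<^sup>2 * (1 / (real a + 1 + t)\<^sup>2) =
         digit_weight r (Suc a) * ((1 + 1 / (real (Suc a) + r)) / (1 + 1 / (real (Suc a) + r) * t)\<^sup>2)"
proof -
  define A where "A = real a + 1 + r"
  define B where "B = real a + 1 + t"
  have pos: "A > 0" "B > 0" "A + t > 0" using assms by (auto simp: A_def B_def)
  have 1: "1 + r * (1 / B) = (A + t) / B"
    using pos by (simp add: field_simps A_def B_def)
  have 2: "1 + 1 / A * t = (A + t) / A" "1 + 1 / A = (A + 1) / A"
    using pos by (simp_all add: field_simps)
  have "(1 + r) / (P / B)\<^sup>2 * (1 / B\<^sup>2) = (1 + r) / (A * (A + 1)) * (((A + 1) / A) / (P / A)\<^sup>2)"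
    if "P > 0" for P
  proof -
    have "(1 + r) / (P / B)\<^sup>2 * (1 / B\<^sup>2) = (1 + r) / P\<^sup>2"
      using pos that by (simp add: power_divide)
    moreover have "(1 + r) / (A * (A + 1)) * (((A + 1) / A) / (P / A)\<^sup>2) = (1 + r) / P\<^sup>2"
    proof -
      have "A + 1 \<noteq> 0" "A \<noteq> 0" using pos by auto
      then show ?thesis
        by (simp add: power_divide power2_eq_square)
    qed
    ultimately show ?thesis by simp
  qed
  from this[OF pos(3)] have "(1 + r) / (1 + r * (1 / B))\<^sup>2 * (1 / B\<^sup>2) =
      (1 + r) / (A * (A + 1)) * ((1 + 1 / A) / (1 + 1 / A * t)\<^sup>2)"
    unfolding 1 2 .
  then show ?thesis
    by (simp add: digit_weight_def A_def B_def add_ac)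
qed

text \<open>Adjacent closed intervals share an endpoint of the form \<open>1 / n\<close>, where the
  sum would count twice; these points form a countable set and are discarded as a null set.\<close>

lemma unit_interval_branches:
  fixes x :: real
  assumes "\<And>n::nat. x \<noteq> 1 / real n" "x \<noteq> 0"
  shows "indicator {0<..<1} x = (\<Sum>a. indicator {1 / (real a + 2)..1 / (real a + 1)} x :: ennreal)"
proof (cases "x \<in> {0<..<1}")
  case True
  define m where "m = nat \<lfloor>1 / x\<rfloor>"
  have m: "real m \<le> 1 / x" "1 / x < real m + 1" and m1: "m \<ge> 1"
    using True by (auto simp: m_def le_nat_iff le_floor_iff)
  have iff: "x \<in> {1 / (real a + 2)..1 / (real a + 1)} \<longleftrightarrow> a = m - 1" for a
  proof
    assume "x \<in> {1 / (real a + 2)..1 / (real a + 1)}"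
    then have "1 / x \<ge> real a + 1" "1 / x \<le> real a + 2" 
      using True by (auto simp: field_simps)
    moreover have "1 / x \<noteq> real a + 2" using assms(1)[of "a + 2"] True by (auto simp: field_simps)
    ultimately show "a = m - 1" using m by linarith
  next
    assume "a = m - 1"
    then show "x \<in> {1 / (real a + 2)..1 / (real a + 1)}"
      using m m1 True by (auto simp: field_simps of_nat_diff)
  qed
  have "(\<Sum>a. indicator {1 / (real a + 2)..1 / (real a + 1)} x :: ennreal) =
        (\<Sum>a. if a = m - 1 then 1 else 0)"
    by (intro suminf_cong) (use iff in \<open>auto split: split_indicator\<close>)
  also have "\<dots> = (\<Sum>a\<in>{m - 1}. if a = m - 1 then 1 else 0)"
    by (intro suminf_finite) auto
  finally show ?thesis using True by simp
next
  case False
  have "x \<notin> {1 / (real a + 2)..1 / (real a + 1)}" for a :: nat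
  proof
    assume *: "x \<in> {1 / (real a + 2)..1 / (real a + 1)}"
    moreover have "0 < 1 / (real a + 2)" "1 / (real a + 1) \<le> 1" by auto
    ultimately have "x > 0" "x \<le> 1" unfolding atLeastAtMost_iff by linarith+
    with False assms(1)[of 1] show False by auto
  qed
  then show ?thesis using False by simp
qed

text \<open>Conditioning on the first digit \<open>a\<close>: the image point then has law
  \<open>gauss_density (1 / (a + r))\<close>. Every estimate along the orbit is an induction that
  applies this formula at its front end, with \<open>r\<close> generalised.\<close>

lemma gauss_step:
  fixes f :: "nat \<Rightarrow> real \<Rightarrow> ennreal"
  assumes [measurable]: "\<And>a. f a \<in> borel_measurable borel" and r: "0 \<le> r"
  shows "(\<integral>\<^sup>+x. f (cf_digit (Suc 0) x) (gauss_map x) \<partial>gauss_density r) =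
         (\<Sum>a. ennreal (digit_weight r (Suc a)) *
            (\<integral>\<^sup>+t. f (Suc a) t \<partial>gauss_density (1 / (real (Suc a) + r))))"
proof -
  define h where "h = (\<lambda>r x::real. ennreal ((1 + r) / (1 + r * x)\<^sup>2))"
  have h_meas [measurable]: "h r \<in> borel_measurable borel" for r
    unfolding h_def by measurable
  define F where "F = (\<lambda>x. f (cf_digit (Suc 0) x) (gauss_map x))"
  have F_meas [measurable]: "F \<in> borel_measurable borel"
    unfolding F_def
    by (rule measurable_compose_countable[where g = "cf_digit (Suc 0)" and f = "\<lambda>a x. f a (gauss_map x)"]) auto
  let ?J = "\<lambda>a::nat. {1 / (real a + 2)..1 / (real a + 1)}"
  have "(\<integral>\<^sup>+x. F x \<partial>gauss_density r) = (\<integral>\<^sup>+x. h r x * F x * indicator {0<..<1} x \<partial>lborel)"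
    unfolding gauss_density_def h_def
    by (subst nn_integral_density) (auto simp: mult_ac)
  also have "\<dots> = (\<integral>\<^sup>+x. (\<Sum>a. h r x * F x * indicator (?J a) x) \<partial>lborel)"
  proof (rule nn_integral_cong_AE)
    have "AE x in lborel. \<forall>n. x \<noteq> 1 / real n"
      by (subst AE_all_countable) (auto intro: AE_lborel_singleton)
    with AE_lborel_singleton[of 0]
    show "AE x in lborel. h r x * F x * indicator {0<..<1} x = (\<Sum>a. h r x * F x * indicator (?J a) x)"
    proof eventually_elim
      case (elim x)
      have "indicator {0<..<1} x = (\<Sum>a. indicator (?J a) x :: ennreal)"
        using elim by (intro unit_interval_branches) auto
      then show ?case by (simp only: ennreal_suminf_cmult)
    qed
  qed
  also have "\<dots> = (\<Sum>a. \<integral>\<^sup>+x. h r x * F x * indicator (?J a) x \<partial>lborel)"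
    by (rule nn_integral_suminf) measurable
  also have "\<dots> = (\<Sum>a. ennreal (digit_weight r (Suc a)) *
            (\<integral>\<^sup>+t. f (Suc a) t \<partial>gauss_density (1 / (real (Suc a) + r))))"
  proof (rule suminf_cong)
    fix a :: nat
    let ?s = "1 / (real (Suc a) + r)"
    have w0: "digit_weight r (Suc a) \<ge> 0" using r by (auto simp: digit_weight_def)
    have "(\<integral>\<^sup>+x. h r x * F x * indicator (?J a) x \<partial>lborel) =
       (\<integral>\<^sup>+t. h r (1 / (real a + 1 + t)) * F (1 / (real a + 1 + t)) * ennreal (1 / (real a + 1 + t)\<^sup>2) * indicator {0..1} t \<partial>lborel)"
      by (rule branch_substitution) measurable
    also have "\<dots> = (\<integral>\<^sup>+t. ennreal (digit_weight r (Suc a)) * (h ?s t * indicator {0<..<1} t * f (Suc a) t) \<partial>lborel)"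
    proof (rule nn_integral_cong_AE)
      show "AE t in lborel. h r (1 / (real a + 1 + t)) * F (1 / (real a + 1 + t)) * ennreal (1 / (real a + 1 + t)\<^sup>2) * indicator {0..1} t
        = ennreal (digit_weight r (Suc a)) * (h ?s t * indicator {0<..<1} t * f (Suc a) t)"
        using AE_lborel_singleton[of 0] AE_lborel_singleton[of 1]
      proof eventually_elim
        case (elim t)
        show ?case
        proof (cases "t \<in> {0<..<1}")
          case True
          have fl: "\<lfloor>real a + 1 + t\<rfloor> = int a + 1"
            using True by (intro floor_unique) auto
          have "F (1 / (real a + 1 + t)) = f (Suc a) t"
            unfolding F_def cf_digit_1 gauss_map_def frac_def using fl
            by (simp add: nat_add_distrib)
          moreover have "h r (1 / (real a + 1 + t)) * ennreal (1 / (real a + 1 + t)\<^sup>2) =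
             ennreal (digit_weight r (Suc a)) * h ?s t"
            unfolding h_def using gauss_density_branch[of r t a] r True w0
            by (simp add: ennreal_mult' [symmetric] ennreal_mult'' [symmetric] del: of_nat_Suc)
          ultimately show ?thesis using True by (simp add: mult_ac)
        next
          case False
          then have "t \<notin> {0..1}" using elim by auto
          with False show ?thesis by simp
        qed
      qed
    qed
    also have "\<dots> = ennreal (digit_weight r (Suc a)) * (\<integral>\<^sup>+t. f (Suc a) t \<partial>gauss_density ?s)"
      unfolding gauss_density_def
      by (subst nn_integral_cmult) (auto simp: nn_integral_density h_def)
    finally show "(\<integral>\<^sup>+x. h r x * F x * indicator (?J a) x \<partial>lborel) =
      ennreal (digit_weight r (Suc a)) * (\<integral>\<^sup>+t. f (Suc a) t \<partial>gauss_density ?s)" .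
  qed
  finally show ?thesis by (simp add: F_def)
qed

lemma emeasure_gauss_density_UNIV:
  assumes r: "0 \<le> r"
  shows "emeasure (gauss_density r) UNIV = 1"
proof -
  have "emeasure (gauss_density r) UNIV = 
      (\<integral>\<^sup>+x. ennreal ((1 + r) / (1 + r * x)\<^sup>2) * indicator {0<..<1} x \<partial>lborel)"
    unfolding gauss_density_def by (subst emeasure_density) auto
  also have "\<dots> = (\<integral>\<^sup>+x. ennreal ((1 + r) / (1 + r * x)\<^sup>2) * indicator {0..1} x \<partial>lborel)"
  proof (rule nn_integral_cong_AE)
    show "AE x in lborel. ennreal ((1 + r) / (1 + r * x)\<^sup>2) * indicator {0<..<1} x =
        ennreal ((1 + r) / (1 + r * x)\<^sup>2) * indicator {0..1} x"
      using AE_lborel_singleton[of 0] AE_lborel_singleton[of 1]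
      by eventually_elim (auto split: split_indicator)
  qed
  also have "\<dots> = ennreal ((1 + r) * 1 / (1 + r * 1) - (1 + r) * 0 / (1 + r * 0))"
  proof (rule nn_integral_FTC_Icc)
    fix x :: real assume "x \<in> {0..1}"
    then have "1 + r * x > 0" using r by (simp add: add_pos_nonneg)
    then show "((\<lambda>x. (1 + r) * x / (1 + r * x)) has_real_derivative (1 + r) / (1 + r * x)\<^sup>2) (at x)"
      by (auto intro!: derivative_eq_intros simp: power2_eq_square field_simps)
    show "0 \<le> (1 + r) / (1 + r * x)\<^sup>2" using r by auto
  qed auto
  also have "\<dots> = 1" using r by simp
  finally show ?thesis .
qed

text \<open>The bridge to the half-open interval of the theorem; the two sides differ only in the
  point 1.\<close>

lemma AE_gauss_density_0:
  "(AE x in gauss_density 0. P x) \<longleftrightarrow> (AE x in lborel. x \<in> {0<..1} \<longrightarrow> P x)"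
proof -
  have "(AE x in gauss_density 0. P x) \<longleftrightarrow> (AE x in lborel. x \<in> {0<..<1} \<longrightarrow> P x)"
    unfolding gauss_density_def by (subst AE_density) (auto simp: indicator_def)
  also have "\<dots> \<longleftrightarrow> (AE x in lborel. x \<in> {0<..1} \<longrightarrow> P x)"
  proof
    assume "AE x in lborel. x \<in> {0<..<1} \<longrightarrow> P x"
    with AE_lborel_singleton[of 1] show "AE x in lborel. x \<in> {0<..1} \<longrightarrow> P x"
      by eventually_elim auto
  next
    assume "AE x in lborel. x \<in> {0<..1} \<longrightarrow> P x"
    then show "AE x in lborel. x \<in> {0<..<1} \<longrightarrow> P x"
      by eventually_elim auto
  qed
  finally show ?thesis .
qed

lemma digit_weight_nonneg: "0 \<le> r \<Longrightarrow> 0 \<le> digit_weight r a"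
  by (simp add: digit_weight_def)

lemma digit_weight_sums:
  assumes r: "0 \<le> r"
  shows "(\<lambda>a. digit_weight r (Suc a)) sums 1"
proof -
  have "(\<lambda>a. (1 + r) / (real a + 1 + r)) \<longlonglongrightarrow> 0"
    by real_asymp
  then have "(\<lambda>a. (1 + r) / (real a + 1 + r) - (1 + r) / (real (Suc a) + 1 + r)) sums
        ((1 + r) / (real 0 + 1 + r) - 0)"
    by (rule telescope_sums')
  moreover have "(1 + r) / (real a + 1 + r) - (1 + r) / (real (Suc a) + 1 + r) = digit_weight r (Suc a)" for a
  proof -
    have "real a + 1 + r > 0" using r by simp
    then show ?thesis
      by (simp add: digit_weight_def divide_simps) (simp add: algebra_simps)
  qed
  ultimately show ?thesis using r by simp
qed

lemma digit_weight_bounds: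
  assumes "0 \<le> r" "r \<le> 1" "a \<ge> 1"
  shows "1 / (3 * (real a)\<^sup>2) \<le> digit_weight r a" "digit_weight r a \<le> 2 / (real a)\<^sup>2"
proof -
  have a: "real a \<ge> 1" using assms by simp
  \<comment> \<open>The factor \<open>1 + r\<close> is kept apart so that it cancels against the
    numerator of \<open>digit_weight\<close>.\<close>
  have "(real a + r) * (real a + r + 1) \<le> (real a * (1 + r)) * (3 * real a)"
  proof (rule mult_mono)
    show "real a + r \<le> real a * (1 + r)"
      using mult_right_mono[OF a assms(1)] by (simp add: algebra_simps)
  qed (use a assms in auto)
  then have "(real a + r) * (real a + r + 1) \<le> (1 + r) * (3 * (real a)\<^sup>2)"
    by (simp add: power2_eq_square mult_ac)
  then show "1 / (3 * (real a)\<^sup>2) \<le> digit_weight r a"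
    using a assms by (simp add: digit_weight_def divide_simps)
  have "(real a)\<^sup>2 \<le> (real a + r) * (real a + r + 1)"
    unfolding power2_eq_square using a assms by (intro mult_mono) auto
  then have "(1 + r) * (real a)\<^sup>2 \<le> 2 * ((real a + r) * (real a + r + 1))"
    using assms by (intro mult_mono) auto
  moreover have "real a + r > 0" using a assms by simp
  ultimately show "digit_weight r a \<le> 2 / (real a)\<^sup>2"
    using a assms by (simp add: digit_weight_def divide_simps)
qed

text \<open>Keeps the parameter in the range where the digit bounds are uniform, which is what the
  induction hypotheses below require.\<close>

lemma next_parameter:
  assumes "0 \<le> r"
  shows "0 \<le> 1 / (real (Suc a) + r)" "1 / (real (Suc a) + r) \<le> 1"
proof -
  have "1 \<le> real (Suc a) + r" using assms by simp
  then show "0 \<le> 1 / (real (Suc a) + r)" "1 / (real (Suc a) + r) \<le> 1"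
    by (auto simp del: of_nat_Suc)
qed

section \<open>Estimates conditional on the past digits\<close>

text \<open>The oldest digit comes first, so that conditioning on the first digit is a
  \<open>Cons\<close>. Lists of naturals are countable, so every function of the past is
  measurable.\<close>

definition digits :: "nat \<Rightarrow> real \<Rightarrow> nat list" where
  "digits n x = map (\<lambda>k. cf_digit (Suc k) x) [0..<n]"

lemma digits_Suc: "digits (Suc n) x = cf_digit (Suc 0) x # digits n (gauss_map x)"
  unfolding digits_def by (subst map_upt_Suc) (simp add: cf_digit_Suc_Suc)

lemma measurable_digits [measurable]: "digits n \<in> borel \<rightarrow>\<^sub>M count_space UNIV"
proof -
  have "digits n -` {l} \<in> sets borel" for l
  proof (cases "length l = n")
    case True
    then have "digits n -` {l} = (\<Inter>k\<in>{..<n}. cf_digit (Suc k) -` {l ! k} \<inter> space borel)"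
      unfolding digits_def by (intro set_eqI) (simp add: list_eq_iff_nth_eq, blast)
    also have "\<dots> \<in> sets borel"
    proof (cases "n = 0")
      case False
      then show ?thesis
        by (intro sets.finite_INT measurable_sets[OF measurable_cf_digit]) auto
    qed simp
    finally show ?thesis .
  next
    case False
    then have "digits n -` {l} = {}" by (auto simp: digits_def)
    then show ?thesis by simp
  qed
  then show ?thesis by (simp add: measurable_count_space_eq2_countable)
qed

lemma measurable_of_digits [measurable]: "(\<lambda>x. \<phi> (digits n x)) \<in> borel_measurable borel"
  by (rule measurable_compose[OF measurable_digits]) simp

lemma measurable_of_digit [measurable]: "(\<lambda>x. \<psi> (cf_digit n x)) \<in> borel_measurable borel"
  by (rule measurable_compose[OF measurable_cf_digit]) simp

text \<open>Replaces the product rule for independent variables. After the first digit is split off,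
  the rest starts from another parameter in \<open>[0, 1]\<close>; this is why \<open>q k\<close>
  must bound the one-step expectation for all parameters at once.\<close>

lemma nn_integral_prod_digits_le:
  fixes f :: "nat \<Rightarrow> nat \<Rightarrow> ennreal"
  assumes "0 \<le> r" "r \<le> 1"
    and "\<And>k r. 0 \<le> r \<Longrightarrow> r \<le> 1 \<Longrightarrow> (\<Sum>a. ennreal (digit_weight r (Suc a)) * f k (Suc a)) \<le> q k"
  shows "(\<integral>\<^sup>+x. (\<Prod>k<n. f k (cf_digit (Suc k) x)) \<partial>gauss_density r) \<le> (\<Prod>k<n. q k)"
  using assms
proof (induction n arbitrary: f q r)
  case 0
  then show ?case by (simp add: emeasure_gauss_density_UNIV)
next
  case (Suc n)
  have "(\<integral>\<^sup>+x. (\<Prod>k<Suc n. f k (cf_digit (Suc k) x)) \<partial>gauss_density r) =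
     (\<integral>\<^sup>+x. f 0 (cf_digit (Suc 0) x) * (\<Prod>k<n. f (Suc k) (cf_digit (Suc k) (gauss_map x))) \<partial>gauss_density r)"
    by (simp only: prod.lessThan_Suc_shift cf_digit_Suc_Suc o_def)
  also have "\<dots> = (\<Sum>a. ennreal (digit_weight r (Suc a)) *
     (\<integral>\<^sup>+t. f 0 (Suc a) * (\<Prod>k<n. f (Suc k) (cf_digit (Suc k) t)) \<partial>gauss_density (1 / (real (Suc a) + r))))"
    by (rule gauss_step[where f = "\<lambda>a t. f 0 a * (\<Prod>k<n. f (Suc k) (cf_digit (Suc k) t))"])
       (use Suc.prems in auto)
  also have "\<dots> \<le> (\<Sum>a. ennreal (digit_weight r (Suc a)) * f 0 (Suc a) * (\<Prod>k<n. q (Suc k)))"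
  proof (intro suminf_le summableI)
    fix a
    have "(\<integral>\<^sup>+t. (\<Prod>k<n. f (Suc k) (cf_digit (Suc k) t)) \<partial>gauss_density (1 / (real (Suc a) + r)))
        \<le> (\<Prod>k<n. q (Suc k))"
      using Suc.prems next_parameter[of r a] by (intro Suc.IH) auto
    then show "ennreal (digit_weight r (Suc a)) *
        (\<integral>\<^sup>+t. f 0 (Suc a) * (\<Prod>k<n. f (Suc k) (cf_digit (Suc k) t)) \<partial>gauss_density (1 / (real (Suc a) + r)))
      \<le> ennreal (digit_weight r (Suc a)) * f 0 (Suc a) * (\<Prod>k<n. q (Suc k))"
      by (subst nn_integral_cmult) (auto simp: mult.assoc intro!: mult_left_mono)
  qed
  also have "\<dots> = (\<Sum>a. ennreal (digit_weight r (Suc a)) * f 0 (Suc a)) * (\<Prod>k<n. q (Suc k))"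
    by simp
  also have "\<dots> \<le> q 0 * (\<Prod>k<n. q (Suc k))"
    using Suc.prems by (intro mult_right_mono) auto
  finally show ?case by (simp only: prod.lessThan_Suc_shift o_def)
qed

text \<open>The induction runs over the length of the past and conditions on the oldest digit, which
  is absorbed into \<open>\<phi>\<close>; hence \<open>\<phi>\<close> is arbitrary. The bound on
  \<open>\<psi>\<close> enters only when no past is left.\<close>

lemma nn_integral_past_next_le:
  fixes \<phi> :: "nat list \<Rightarrow> ennreal" and \<psi> :: "nat \<Rightarrow> ennreal"
  assumes "0 \<le> r" "r \<le> 1"
    and "\<And>r. 0 \<le> r \<Longrightarrow> r \<le> 1 \<Longrightarrow> (\<Sum>a. ennreal (digit_weight r (Suc a)) * \<psi> (Suc a)) \<le> C"
  shows "(\<integral>\<^sup>+x. \<phi> (digits n x) * \<psi> (cf_digit (Suc n) x) \<partial>gauss_density r) \<le>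
         C * (\<integral>\<^sup>+x. \<phi> (digits n x) \<partial>gauss_density r)"
  using assms(1,2)
proof (induction n arbitrary: \<phi> r)
  case 0
  have "(\<integral>\<^sup>+x. \<phi> [] * \<psi> (cf_digit (Suc 0) x) \<partial>gauss_density r) =
     (\<Sum>a. ennreal (digit_weight r (Suc a)) * (\<integral>\<^sup>+t. \<phi> [] * \<psi> (Suc a) \<partial>gauss_density (1 / (real (Suc a) + r))))"
    by (rule gauss_step[where f = "\<lambda>a t. \<phi> [] * \<psi> a"]) (use 0 in auto)
  also have "\<dots> = (\<Sum>a. (ennreal (digit_weight r (Suc a)) * \<psi> (Suc a)) * \<phi> [])"
    using 0 next_parameter[of r] by (simp add: emeasure_gauss_density_UNIV mult_ac)
  also have "\<dots> = (\<Sum>a. (ennreal (digit_weight r (Suc a)) * \<psi> (Suc a))) * \<phi> []"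
    by simp
  also have "\<dots> \<le> C * \<phi> []"
    using 0 assms(3) by (intro mult_right_mono) auto
  finally show ?case using 0 by (simp add: digits_def emeasure_gauss_density_UNIV)
next
  case (Suc n)
  have "(\<integral>\<^sup>+x. \<phi> (digits (Suc n) x) * \<psi> (cf_digit (Suc (Suc n)) x) \<partial>gauss_density r) =
     (\<Sum>a. ennreal (digit_weight r (Suc a)) *
       (\<integral>\<^sup>+t. \<phi> (Suc a # digits n t) * \<psi> (cf_digit (Suc n) t) \<partial>gauss_density (1 / (real (Suc a) + r))))"
    unfolding digits_Suc cf_digit_Suc_Suc
    by (rule gauss_step[where f = "\<lambda>a t. \<phi> (a # digits n t) * \<psi> (cf_digit (Suc n) t)"])
       (use Suc.prems measurable_of_digits[where \<phi> = "\<lambda>l. \<phi> (_ # l)"] in auto)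
  also have "\<dots> \<le> (\<Sum>a. C * (ennreal (digit_weight r (Suc a)) *
       (\<integral>\<^sup>+t. \<phi> (Suc a # digits n t) \<partial>gauss_density (1 / (real (Suc a) + r)))))"
  proof (intro suminf_le summableI)
    fix a
    have "(\<integral>\<^sup>+t. \<phi> (Suc a # digits n t) * \<psi> (cf_digit (Suc n) t) \<partial>gauss_density (1 / (real (Suc a) + r)))
       \<le> C * (\<integral>\<^sup>+t. \<phi> (Suc a # digits n t) \<partial>gauss_density (1 / (real (Suc a) + r)))"
      using Suc.prems next_parameter[of r a] by (intro Suc.IH[where \<phi> = "\<lambda>l. \<phi> (Suc a # l)"]) auto
    from mult_left_mono[OF this, of "ennreal (digit_weight r (Suc a))"]
    show "ennreal (digit_weight r (Suc a)) *
       (\<integral>\<^sup>+t. \<phi> (Suc a # digits n t) * \<psi> (cf_digit (Suc n) t) \<partial>gauss_density (1 / (real (Suc a) + r)))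
      \<le> C * (ennreal (digit_weight r (Suc a)) *
       (\<integral>\<^sup>+t. \<phi> (Suc a # digits n t) \<partial>gauss_density (1 / (real (Suc a) + r))))"
      by (simp add: mult_ac)
  qed
  also have "\<dots> = C * (\<Sum>a. ennreal (digit_weight r (Suc a)) *
       (\<integral>\<^sup>+t. \<phi> (Suc a # digits n t) \<partial>gauss_density (1 / (real (Suc a) + r))))"
    by simp
  also have "(\<Sum>a. ennreal (digit_weight r (Suc a)) *
       (\<integral>\<^sup>+t. \<phi> (Suc a # digits n t) \<partial>gauss_density (1 / (real (Suc a) + r)))) =
     (\<integral>\<^sup>+x. \<phi> (digits (Suc n) x) \<partial>gauss_density r)"
    unfolding digits_Suc
    by (rule gauss_step[where f = "\<lambda>a t. \<phi> (a # digits n t)", symmetric])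
       (use Suc.prems measurable_of_digits[where \<phi> = "\<lambda>l. \<phi> (_ # l)"] in auto)
  finally show ?case .
qed

section \<open>Chebyshev's estimates\<close>

definition prime_block :: "nat \<Rightarrow> nat \<Rightarrow> nat set" where
  "prime_block m n = {p. prime p \<and> m < p \<and> p \<le> n}"

lemma finite_prime_block [simp]: "finite (prime_block m n)"
  by (rule finite_subset[of _ "{..n}"]) (auto simp: prime_block_def)

lemma prod_primes_dvd:
  fixes m :: nat
  assumes "finite P" "\<And>p. p \<in> P \<Longrightarrow> prime p \<and> p dvd m"
  shows "\<Prod>P dvd m"
  using assms
proof (induction P rule: finite_induct)
  case (insert p P)
  have "coprime p (\<Prod>P)"
  proof (rule prod_coprime_right)
    fix q assume "q \<in> P"
    then show "coprime p q" using insert by (metis insert_iff primes_coprime)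
  qed
  then show ?case using insert by (simp add: divides_mult)
qed auto

text \<open>Chebyshev's argument: with \<open>n = 2 ^ k\<close>, a prime in \<open>(n, 2 n]\<close>
  divides \<open>fact (2 n)\<close> but not \<open>fact n\<close>, hence the central binomial
  coefficient, which is at most \<open>2 ^ (2 n)\<close>. Each such prime exceeds
  \<open>2 ^ k\<close>, and comparing exponents bounds their number.\<close>

lemma card_prime_block_upper: "card (prime_block (2 ^ k) (2 ^ Suc k)) * k \<le> 2 ^ Suc k"
proof -
  let ?n = "2 ^ k :: nat"
  let ?P = "prime_block ?n (2 ^ Suc k)"
  have "\<Prod>?P dvd ((2 * ?n) choose ?n)"
  proof (rule prod_primes_dvd)
    fix p assume "p \<in> ?P"
    then have p: "prime p" "?n < p" "p \<le> 2 * ?n" by (auto simp: prime_block_def)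
    have "fact (2 * ?n) = fact ?n * fact ?n * ((2 * ?n) choose ?n)"
      using binomial_fact_lemma[of ?n "2 * ?n"] by simp
    moreover have "p dvd fact (2 * ?n)" using p by (simp add: prime_dvd_fact_iff)
    moreover have "\<not> p dvd fact ?n" using p by (simp add: prime_dvd_fact_iff)
    ultimately show "prime p \<and> p dvd ((2 * ?n) choose ?n)"
      using p by (metis prime_dvd_mult_iff)
  qed simp
  moreover have "((2 * ?n) choose ?n) > 0" by (simp add: zero_less_binomial_iff)
  ultimately have "\<Prod>?P \<le> ((2 * ?n) choose ?n)" by (rule dvd_imp_le)
  also have "\<dots> \<le> 2 ^ (2 * ?n)" by (rule binomial_le_pow2)
  finally have "\<Prod>?P \<le> 2 ^ (2 * ?n)" .
  moreover have "(\<Prod>p\<in>?P. ?n) \<le> \<Prod>?P"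
    by (rule prod_mono) (auto simp: prime_block_def)
  ultimately have "?n ^ card ?P \<le> 2 ^ (2 * ?n)" by simp
  then have "2 ^ (k * card ?P) \<le> (2::nat) ^ (2 * ?n)" by (simp add: power_mult)
  then have "k * card ?P \<le> 2 * ?n" by simp
  then show ?thesis by (simp add: mult.commute)
qed

section \<open>Lower Chebyshev bound through the least common multiple of 1, ..., N\<close>

text \<open>The numbers \<open>1 / ((n + 1) * (n choose m))\<close> form Leibniz's harmonic triangle, in which each
  entry is the sum of the two entries below it; so they are integer combinations of \<open>1 / 1, \<dots>, 1 / (n + 1)\<close>.\<close>

lemma leibniz_triangle:
  assumes "m \<le> n"
  shows "1 / (real (Suc (Suc n)) * real (Suc n choose m)) +
         1 / (real (Suc (Suc n)) * real (Suc n choose Suc m)) = 1 / (real (Suc n) * real (n choose m))"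
proof -
  define c where "c = real (n choose m)"
  have c: "c > 0" using assms by (simp add: c_def zero_less_binomial_iff)
  have 1: "real (Suc n - m) * real (Suc n choose m) = real (Suc n) * c"
    using binomial_absorb_comp[of "Suc n" m] unfolding c_def by (metis diff_Suc_1 of_nat_mult)
  have 2: "real (Suc m) * real (Suc n choose Suc m) = real (Suc n) * c"
    using binomial_absorption[of m "Suc n"] unfolding c_def by (metis diff_Suc_1 of_nat_mult)
  have d: "real (Suc n - m) > 0" using assms by simp
  have e: "real (Suc n choose m) = real (Suc n) * c / real (Suc n - m)"
     "real (Suc n choose Suc m) = real (Suc n) * c / real (Suc m)"
    using 1 2 d by (simp_all add: field_simps del: of_nat_Suc)
  have "1 / (real (Suc (Suc n)) * real (Suc n choose m)) +
         1 / (real (Suc (Suc n)) * real (Suc n choose Suc m)) =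
        (real (Suc n - m) + real (Suc m)) / (real (Suc (Suc n)) * (real (Suc n) * c))"
    unfolding e by (simp add: add_divide_distrib del: of_nat_Suc)
  also have "real (Suc n - m) + real (Suc m) = real (Suc (Suc n))" using assms by simp
  finally show ?thesis unfolding c_def by (simp del: of_nat_Suc)
qed

text \<open>A common multiple \<open>D\<close> of \<open>1, ..., N\<close> clears the denominators
  of the first \<open>N\<close> rows of the triangle. The induction is on the column: an entry is a
  difference of two entries of the previous column, and column 0 consists of the numbers
  \<open>1 / (n + 1)\<close>.\<close>

lemma Suc_times_binomial_dvd:
  fixes D :: nat
  assumes "\<And>j. 1 \<le> j \<Longrightarrow> j \<le> N \<Longrightarrow> j dvd D" "m \<le> n" "n < N"
  shows "Suc n * (n choose m) dvd D"
proof -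
  have "real D / (real (Suc n) * real (n choose m)) \<in> \<int>" using assms(2,3)
  proof (induction m arbitrary: n)
    case 0
    then have "Suc n dvd D" using assms(1) by auto
    then obtain k where "D = Suc n * k" by auto
    then have "real D / (real (Suc n) * real (n choose 0)) = real k"
      unfolding of_nat_mult by (simp add: field_simps)
    then show ?case by (simp only: Ints_of_nat)
  next
    case (Suc m n')
    then obtain n where n: "n' = Suc n" by (cases n') auto
    have "real D / (real (Suc n) * real (n choose m)) \<in> \<int>"
      "real D / (real (Suc (Suc n)) * real (Suc n choose m)) \<in> \<int>"
      using Suc.IH[of n] Suc.IH[of "Suc n"] Suc.prems n by (simp_all del: of_nat_Suc)
    moreover have "real D / (real (Suc n') * real (n' choose Suc m)) =
      real D / (real (Suc n) * real (n choose m)) - real D / (real (Suc (Suc n)) * real (Suc n choose m))"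
      using leibniz_triangle[of m n] Suc.prems n
      by (simp add: right_diff_distrib [symmetric] divide_inverse del: of_nat_Suc)
    ultimately show ?case by (metis Ints_diff)
  qed
  then obtain z where "real D / (real (Suc n) * real (n choose m)) = of_int z" by (auto elim: Ints_cases)
  moreover have "(n choose m) > 0" using assms by (simp add: zero_less_binomial_iff)
  ultimately have "real_of_int (int D) = real_of_int (z * int (Suc n * (n choose m)))"
    by (simp add: field_simps del: of_nat_Suc, simp add: algebra_simps)
  then have "int D = z * int (Suc n * (n choose m))" by (simp only: of_int_eq_iff)
  then have "int (Suc n * (n choose m)) dvd int D" by simp
  then show ?thesis by (simp only: int_dvd_int_iff)
qed

text \<open>The multiplicity of a prime in an lcm is the maximum of the multiplicities, so some
  element attains it.\<close>

lemma prime_power_dvd_Lcm: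
  fixes p :: nat
  assumes "finite A" "prime p" "0 \<notin> A" "p ^ k dvd Lcm A" "k > 0"
  shows "\<exists>a\<in>A. p ^ k dvd a"
  using assms
proof (induction A rule: finite_induct)
  case (insert a A)
  have "Lcm A \<noteq> 0" using insert by (simp add: Lcm_0_iff)
  then have "multiplicity p (lcm a (Lcm A)) = max (multiplicity p a) (multiplicity p (Lcm A))"
    using insert by (intro multiplicity_lcm) auto
  moreover have "k \<le> multiplicity p (lcm a (Lcm A))"
    using insert by (subst power_dvd_iff_le_multiplicity [symmetric]) (auto simp: Lcm_0_iff)
  ultimately have "p ^ k dvd a \<or> p ^ k dvd Lcm A"
    by (metis max_def multiplicity_dvd')
  then show ?case using insert by auto
qed auto

text \<open>Each full prime power in the factorisation of the lcm divides one of the numbers up to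
  \<open>N\<close> and is therefore at most \<open>N\<close>; the number of factors is at most the
  number of primes up to \<open>N\<close>.\<close>

lemma Lcm_le_power_card_primes:
  assumes "N \<ge> 1"
  shows "Lcm {1..N} \<le> N ^ card (prime_block 0 N)"
proof -
  let ?L = "Lcm {1..N}"
  have L0: "?L > 0" by (metis Lcm_0_iff atLeastAtMost_iff finite_atLeastAtMost gr0I not_one_le_zero)
  have bound: "p ^ multiplicity p ?L \<le> N \<and> p \<le> N" if p: "p \<in> prime_factors ?L" for p
  proof -
    from p have pr: "prime p" by auto
    have "multiplicity p ?L > 0" using p by (simp add: prime_factors_multiplicity)
    with prime_power_dvd_Lcm[of "{1..N}" p "multiplicity p ?L"] pr
    obtain j where j: "j \<in> {1..N}" "p ^ multiplicity p ?L dvd j" by (auto simp: multiplicity_dvd)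
    then have "p ^ multiplicity p ?L \<le> N" by (auto dest!: dvd_imp_le)
    moreover have "p ^ 1 \<le> p ^ multiplicity p ?L"
      using \<open>multiplicity p ?L > 0\<close> pr by (intro power_increasing) (auto simp: prime_gt_0_nat Suc_leI)
    ultimately show ?thesis by simp
  qed
  have "?L = (\<Prod>p\<in>prime_factors ?L. p ^ multiplicity p ?L)"
    using L0 by (rule prime_factorization_nat)
  also have "\<dots> \<le> (\<Prod>p\<in>prime_factors ?L. N)"
    by (intro prod_mono conjI bound[THEN conjunct1] le0)
  also have "\<dots> = N ^ card (prime_factors ?L)" by simp
  also have "\<dots> \<le> N ^ card (prime_block 0 N)"
  proof (intro power_increasing card_mono subsetI)
    fix p assume "p \<in> prime_factors ?L"
    with bound[of p] show "p \<in> prime_block 0 N"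
      by (auto simp: prime_block_def in_prime_factors_iff prime_gt_0_nat)
  qed (use assms in auto)
  finally show ?thesis .
qed

text \<open>With \<open>N = n + 1\<close>, the \<open>n + 1\<close> numbers
  \<open>(n + 1) * (n choose m)\<close> all divide the lcm and have average \<open>2 ^ n\<close>, so
  the lcm is at least this average.\<close>

lemma Lcm_lower:
  assumes "N \<ge> 1"
  shows "2 ^ (N - 1) \<le> Lcm {1..N}"
proof -
  obtain n where n: "N = Suc n" using assms by (cases N) auto
  let ?L = "Lcm {1..N}"
  have L: "?L > 0" by (metis Lcm_0_iff atLeastAtMost_iff finite_atLeastAtMost gr0I not_one_le_zero)
  have "Suc n * 2 ^ n = (\<Sum>m\<le>n. Suc n * (n choose m))"
    by (simp add: choose_row_sum [symmetric] sum_distrib_left)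
  also have "\<dots> \<le> (\<Sum>m\<le>n. ?L)"
  proof (rule sum_mono)
    fix m assume "m \<in> {..n}"
    then have "Suc n * (n choose m) dvd ?L"
      by (intro Suc_times_binomial_dvd[of N]) (auto simp: n dvd_Lcm)
    then show "Suc n * (n choose m) \<le> ?L" using L by (rule dvd_imp_le)
  qed
  also have "\<dots> = Suc n * ?L" by simp
  finally show ?thesis using n by (metis Suc_mult_le_cancel1 diff_Suc_1)
qed

lemma card_primes_lower: "2 ^ m - 1 \<le> m * card (prime_block 0 (2 ^ m))"
proof -
  have "2 ^ (2 ^ m - 1) \<le> Lcm {1..2 ^ m :: nat}" by (rule Lcm_lower) simp
  also have "\<dots> \<le> (2 ^ m) ^ card (prime_block 0 (2 ^ m))" by (rule Lcm_le_power_card_primes) simp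
  finally have "2 ^ (2 ^ m - 1) \<le> (2::nat) ^ (m * card (prime_block 0 (2 ^ m)))" by (simp add: power_mult)
  then show ?thesis by simp
qed

lemma card_prime_block_split:
  assumes "a \<le> b" "b \<le> c"
  shows "card (prime_block a c) = card (prime_block a b) + card (prime_block b c)"
proof -
  have "prime_block a c = prime_block a b \<union> prime_block b c"
    using assms by (auto simp: prime_block_def)
  then show ?thesis by (simp only:) (rule card_Un_disjoint; auto simp: prime_block_def)
qed

lemma card_prime_block_dyadic:
  assumes "k \<ge> 1"
  shows "real (card (prime_block (2 ^ k) (2 ^ Suc k))) \<le> 2 * 2 ^ k / real k"
proof -
  have "real (card (prime_block (2 ^ k) (2 ^ Suc k)) * k) \<le> real (2 ^ Suc k)"
    using card_prime_block_upper by (simp only: of_nat_le_iff)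
  then show ?thesis using assms by (simp add: field_simps)
qed

lemma card_primes_upper:
  assumes "m \<ge> 2"
  shows "real (card (prime_block 0 (2 ^ m))) \<le> 6 * 2 ^ m / real m"
  using assms
proof (induction m rule: dec_induct)
  case base
  have "card (prime_block 0 (2 ^ 2)) \<le> card {1..4::nat}"
    by (rule card_mono) (auto simp: prime_block_def)
  then show ?case by simp
next
  case (step m)
  have "real (card (prime_block 0 (2 ^ Suc m))) \<le> 6 * 2 ^ m / real m + 2 * 2 ^ m / real m"
    using step card_prime_block_dyadic[of m] card_prime_block_split[of 0 "2 ^ m" "2 ^ Suc m"] by simp
  also have "\<dots> = 8 * 2 ^ m / real m" by (simp add: add_divide_distrib [symmetric])
  \<comment> \<open>\<open>8 / m \<le> 12 / (m + 1)\<close> holds exactly from \<open>m = 2\<close>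
    on; hence the starting point of the induction.\<close>
  also have "\<dots> \<le> 6 * 2 ^ Suc m / real (Suc m)"
    using step by (simp add: field_simps)
  finally show ?case .
qed

text \<open>The base 16 is large enough for the lower bound on the number of primes up to the right
  end to beat the upper bound at the left end already for \<open>j = 1\<close>.\<close>

definition pblock :: "nat \<Rightarrow> nat set" where "pblock j = prime_block (16 ^ j) (16 ^ Suc j)"

lemma card_pblock_lower:
  assumes "j \<ge> 1"
  shows "16 ^ j / (4 * real j) \<le> real (card (pblock j))"
proof -
  define m where "m = 4 * j"
  have m: "m \<ge> 4" using assms by (simp add: m_def)
  have p: "16 ^ j = (2 ^ m :: nat)" "16 ^ Suc j = (2 ^ (m + 4) :: nat)"
    by (simp_all add: m_def power_mult power_add)
  have "real (2 ^ (m + 4) - 1) \<le> real ((m + 4) * card (prime_block 0 (2 ^ (m + 4))))"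
    using card_primes_lower by (simp only: of_nat_le_iff)
  then have "16 * 2 ^ m - 1 \<le> real (m + 4) * real (card (prime_block 0 (2 ^ (m + 4))))"
    by (simp add: power_add of_nat_diff algebra_simps)
  also have "real (card (prime_block 0 (2 ^ (m + 4)))) = real (card (prime_block 0 (2 ^ m))) + real (card (pblock j))"
    unfolding pblock_def p by (subst card_prime_block_split[of 0 "2 ^ m"]) auto
  also have "\<dots> \<le> 6 * 2 ^ m / real m + real (card (pblock j))"
    using card_primes_upper[of m] m by simp
  finally have "16 * 2 ^ m - 1 \<le> real (m + 4) * (6 * 2 ^ m / real m + real (card (pblock j)))"
    by (simp add: mult_left_mono)
  \<comment> \<open>Here \<open>m \<ge> 4\<close> gives \<open>m + 4 \<le> 2 m\<close>. The upper
    bound at the left end then costs \<open>12 * 2 ^ m\<close> out of \<open>16 * 2 ^ m\<close>, so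
    a positive share is left.\<close>
  also have "\<dots> \<le> (2 * real m) * (6 * 2 ^ m / real m + real (card (pblock j)))"
    using m by (intro mult_right_mono) auto
  also have "\<dots> = 12 * 2 ^ m + 2 * real m * real (card (pblock j))"
    using m by (simp add: field_simps)
  finally have "4 * 2 ^ m - 1 \<le> 2 * real m * real (card (pblock j))" by simp
  moreover have "(1::real) \<le> 2 ^ m" by simp
  ultimately have "2 ^ m \<le> real m * real (card (pblock j))" by linarith
  then have "2 ^ m / real m \<le> real (card (pblock j))" using m by (simp add: field_simps)
  moreover have "(2::real) ^ m = 16 ^ j" "real m = 4 * real j" by (simp_all add: m_def power_mult)
  ultimately show ?thesis by simp
qed

lemma card_pblock_upper:
  assumes "j \<ge> 1"
  shows "real (card (pblock j)) \<le> 8 * 16 ^ j / real j"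
proof -
  define m where "m = 4 * j"
  have m: "m \<ge> 4" using assms by (simp add: m_def)
  have p: "16 ^ j = (2 ^ m :: nat)" "16 ^ Suc j = (2 ^ (Suc (Suc (Suc (Suc m)))) :: nat)"
    by (simp_all add: m_def power_mult)
  let ?b = "\<lambda>k. real (card (prime_block (2 ^ k) (2 ^ Suc k)))"
  have "real (card (pblock j)) = ?b m + ?b (Suc m) + ?b (Suc (Suc m)) + ?b (Suc (Suc (Suc m)))"
    unfolding pblock_def p
    by (subst card_prime_block_split[of "2 ^ m" "2 ^ Suc m"], simp, simp,
        subst card_prime_block_split[of "2 ^ Suc m" "2 ^ Suc (Suc m)"], simp, simp,
        subst card_prime_block_split[of "2 ^ Suc (Suc m)" "2 ^ Suc (Suc (Suc m))"], simp, simp, simp)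
  also have "\<dots> \<le> 2 * 2 ^ m / real m + 2 * 2 ^ Suc m / real m + 2 * 2 ^ Suc (Suc m) / real m + 2 * 2 ^ Suc (Suc (Suc m)) / real m"
  proof -
    have "?b k \<le> 2 * 2 ^ k / real m" if "k \<ge> m" for k
    proof -
      have "?b k \<le> 2 * 2 ^ k / real k" using card_prime_block_dyadic[of k] that m by simp
      also have "\<dots> \<le> 2 * 2 ^ k / real m" using that m by (intro divide_left_mono) auto
      finally show ?thesis .
    qed
    from this[of m] this[of "Suc m"] this[of "Suc (Suc m)"] this[of "Suc (Suc (Suc m))"]
    show ?thesis by (intro add_mono) auto
  qed
  \<comment> \<open>The block consists of four dyadic pieces and \<open>2 + 4 + 8 + 16 = 30\<close>;
    with \<open>m = 4 j\<close> this is rounded up from \<open>30 / 4\<close> to 8.\<close>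
  also have "\<dots> = 30 * 2 ^ m / real m" using m by (simp add: field_simps)
  also have "\<dots> = 30 * 16 ^ j / (4 * real j)" by (simp add: m_def power_mult)
  also have "\<dots> \<le> 8 * 16 ^ j / real j" using assms by (simp add: field_simps)
  finally show ?thesis .
qed

section \<open>Regularly growing functions\<close>

text \<open>If the bound failed at points \<open>t\<^sub>k \<rightarrow> \<infinity>\<close> with partners \<open>s\<^sub>k\<close> satisfying
  \<open>s\<^sub>k / t\<^sub>k \<rightarrow> 1\<close>, the function \<open>\<eta>\<close> moving each \<open>t\<^sub>k\<close> to \<open>s\<^sub>k\<close> would violate the hypothesis.\<close>

lemma regular_imp_local_bound:
  fixes g :: "real \<Rightarrow> real"
  assumes pos: "\<And>t. t \<ge> 0 \<Longrightarrow> g t > 0"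
    and reg: "\<forall>\<eta> :: real \<Rightarrow> real. \<eta> \<sim>[at_top] (\<lambda>t. t) \<longrightarrow> asymp_order (\<lambda>t. g (\<eta> t)) g"
  shows "\<exists>N::nat. \<forall>t\<ge>real N. \<forall>s. \<bar>s / t - 1\<bar> \<le> 1 / (real N + 1) \<longrightarrow> g s \<le> (real N + 1) * g t"
proof (rule ccontr)
  assume "\<not> ?thesis"
  then have "\<forall>n::nat. \<exists>t s. t \<ge> real n \<and> \<bar>s / t - 1\<bar> \<le> 1 / (real n + 1) \<and> g s > (real n + 1) * g t"
    by (auto simp: not_le)
  then obtain t s :: "nat \<Rightarrow> real" where t: "\<And>n. t n \<ge> real n"
    and close: "\<And>n. \<bar>s n / t n - 1\<bar> \<le> 1 / (real n + 1)"
    and big: "\<And>n. g (s n) > (real n + 1) * g (t n)"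
    by metis
  \<comment> \<open>The points \<open>t k\<close> may coincide, so each value is assigned its last
    index. This index exists because \<open>t k \<ge> k\<close>, and it is at least
    \<open>k\<close>, so the violation at that index is at least as strong.\<close>
  define m where "m = (\<lambda>x. Max {k. t k = x})"
  define \<eta> where "\<eta> = (\<lambda>x. if \<exists>k. t k = x then s (m x) else x)"
  have fin: "finite {k. t k = x}" for x
  proof (rule finite_subset)
    show "{k. t k = x} \<subseteq> {..nat \<lfloor>x\<rfloor>}"
      using t by (auto simp: le_nat_floor)
  qed simp
  have m: "t (m (t k)) = t k" "k \<le> m (t k)" for k
  proof -
    have "m (t k) \<in> {j. t j = t k}" unfolding m_def using fin by (intro Max_in) auto
    then show "t (m (t k)) = t k" by simp
    show "k \<le> m (t k)" unfolding m_def using fin by (intro Max_ge) auto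
  qed
  have "((\<lambda>x. \<eta> x / x) \<longlongrightarrow> 1) at_top"
  proof (rule tendstoI)
    fix e :: real assume "e > 0"
    then obtain K :: nat where K: "1 / (real K + 1) < e"
      by (metis reals_Archimedean inverse_eq_divide of_nat_Suc add.commute)
    show "\<forall>\<^sub>F x in at_top. dist (\<eta> x / x) 1 < e"
      using eventually_gt_at_top[of "Max (t ` {..K})"] eventually_gt_at_top[of 0]
    proof eventually_elim
      case (elim x)
      show ?case
      proof (cases "\<exists>k. t k = x")
        case True
        then obtain k where k: "t k = x" by auto
        have "m x > K"
        proof (rule ccontr)
          assume "\<not> m x > K"
          then have "t (m x) \<le> Max (t ` {..K})" by (intro Max_ge) auto
          with m(1)[of k] k elim show False by simp
        qed
        then have "1 / (real (m x) + 1) \<le> 1 / (real K + 1)" by (intro divide_left_mono) auto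
        moreover have "t (m x) = x" using m(1)[of k] k by simp
        ultimately show ?thesis
          using close[of "m x"] True K by (auto simp: \<eta>_def dist_real_def)
      next
        case False
        then show ?thesis using elim \<open>e > 0\<close> by (simp add: \<eta>_def)
      qed
    qed
  qed
  then have "\<eta> \<sim>[at_top] (\<lambda>t. t)"
    by (intro asymp_equivI') auto
  then have "Limsup at_top (\<lambda>t. ereal (g (\<eta> t) / g t)) < \<infinity>"
    using reg unfolding asymp_order_def by blast
  then obtain C :: real where "Limsup at_top (\<lambda>t. ereal (g (\<eta> t) / g t)) < ereal C"
    using less_PInf_Ex_of_nat by auto
  then have "\<forall>\<^sub>F t in at_top. ereal (g (\<eta> t) / g t) < ereal C" by (rule Limsup_lessD)
  then obtain X where X: "\<And>x. x \<ge> X \<Longrightarrow> g (\<eta> x) / g x < C"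
    by (auto simp: eventually_at_top_linorder)
  define k where "k = nat \<lceil>max X C\<rceil>"
  have k: "real k \<ge> X" "real k \<ge> C" unfolding k_def by linarith+
  have tk: "t k \<ge> X" "t k \<ge> 0" using t[of k] k by linarith+
  have "g (\<eta> (t k)) < C * g (t k)"
    using X[OF tk(1)] pos[OF tk(2)] by (simp add: divide_less_eq)
  also have "\<dots> \<le> (real (m (t k)) + 1) * g (t (m (t k)))"
    using k m[of k] pos[OF tk(2)] by (intro mult_mono) auto
  also have "\<dots> < g (s (m (t k)))" by (rule big)
  also have "s (m (t k)) = \<eta> (t k)" by (auto simp: \<eta>_def)
  finally show False by simp
qed

text \<open>A fixed ratio \<open>A\<close> is reached in finitely many steps of ratio
  \<open>\<rho>\<close>, each costing a factor \<open>D\<close>. The local bound works in both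
  directions because \<open>1 - t / s \<le> s / t - 1\<close> for \<open>t \<le> s\<close>.\<close>

lemma regular_imp_scale_bound:
  fixes g :: "real \<Rightarrow> real"
  assumes pos: "\<And>t. t \<ge> 0 \<Longrightarrow> g t > 0"
    and reg: "\<forall>\<eta> :: real \<Rightarrow> real. \<eta> \<sim>[at_top] (\<lambda>t. t) \<longrightarrow> asymp_order (\<lambda>t. g (\<eta> t)) g"
  shows "\<exists>C\<ge>1. \<exists>T>0. \<forall>t\<ge>T. \<forall>s. t \<le> s \<and> s \<le> A * t \<longrightarrow> g s \<le> C * g t \<and> g t \<le> C * g s"
proof -
  obtain N :: nat where N: "\<And>t s. t \<ge> real N \<Longrightarrow> \<bar>s / t - 1\<bar> \<le> 1 / (real N + 1) \<Longrightarrow> g s \<le> (real N + 1) * g t"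
    using regular_imp_local_bound[OF pos reg] by auto
  define \<rho> where "\<rho> = 1 + 1 / (real N + 1)"
  define T where "T = real N + 1"
  define D where "D = real N + 1"
  have \<rho>: "\<rho> > 1" and D: "D \<ge> 1" by (auto simp: \<rho>_def D_def)
  have step: "g s \<le> D * g t \<and> g t \<le> D * g s" if "t \<ge> T" "t \<le> s" "s \<le> \<rho> * t" for s t
  proof -
    have t0: "t > 0" using that by (simp add: T_def)
    have "s / t \<ge> 1" "s / t \<le> \<rho>" using that t0 by (auto simp: field_simps)
    then have "\<bar>s / t - 1\<bar> \<le> 1 / (real N + 1)" by (simp add: \<rho>_def)
    moreover have "\<bar>t / s - 1\<bar> \<le> 1 / (real N + 1)"
    proof -
      have "1 - t / s = (s - t) / s" using that t0 by (simp add: field_simps)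
      also have "\<dots> \<le> (s - t) / t" using that t0 by (intro divide_left_mono) auto
      also have "\<dots> = s / t - 1" using t0 by (simp add: field_simps)
      also have "\<dots> \<le> 1 / (real N + 1)" using \<open>s / t \<le> \<rho>\<close> by (simp add: \<rho>_def)
      finally have "1 - t / s \<le> 1 / (real N + 1)" .
      moreover have "t / s \<le> 1" using that t0 by simp
      ultimately show ?thesis by linarith
    qed
    ultimately show ?thesis using N[of t s] N[of s t] that by (auto simp: D_def T_def)
  qed
  have iter: "g s \<le> D ^ m * g t \<and> g t \<le> D ^ m * g s" if "t \<ge> T" "t \<le> s" "s \<le> \<rho> ^ m * t" for s t m
    using that(2,3)
  proof (induction m arbitrary: s)
    case 0
    then show ?case by (metis order_antisym power_0 mult_1 order_refl)
  next
    case (Suc m)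
    have t0: "t > 0" using that by (simp add: T_def add_pos_nonneg less_le_trans[of 0 "real N + 1"])
    show ?case
    proof (cases "s \<le> \<rho> * t")
      case True
      have "D \<le> D ^ Suc m" using D by (metis power_increasing power_one_right Suc_le_mono le0 One_nat_def)
      moreover have "g s > 0" "g t > 0" using pos Suc.prems t0 by auto
      ultimately have "D * g t \<le> D ^ Suc m * g t" "D * g s \<le> D ^ Suc m * g s"
        by (auto intro!: mult_right_mono simp del: power_Suc)
      with step[of t s] True Suc.prems that show ?thesis by linarith
    next
      case False
      \<comment> \<open>The upper point is pulled down and \<open>t\<close> stays fixed, so no point
        ever falls below the threshold \<open>T\<close>.\<close>
      define s' where "s' = s / \<rho>"
      have s: "s = \<rho> * s'" using \<rho> by (simp add: s'_def)
      have s': "t \<le> s'" "s' \<le> \<rho> ^ m * t" using False Suc.prems \<rho> unfolding s by (auto simp: mult.assoc)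
      have "s' \<le> s" using \<rho> s' t0 unfolding s by (simp add: mult_le_cancel_right1)
      then have 1: "g s \<le> D * g s' \<and> g s' \<le> D * g s"
        using that s' by (intro step) (auto simp: s)
      from Suc.IH[OF s'] have 2: "g s' \<le> D ^ m * g t \<and> g t \<le> D ^ m * g s'" .
      have "g s \<le> D * (D ^ m * g t)" using 1 2 D by (meson order_trans mult_left_mono zero_le_one)
      moreover have "g t \<le> D ^ m * (D * g s)" using 1 2 D by (meson order_trans mult_left_mono zero_le_one zero_le_power)
      ultimately show ?thesis by (simp add: mult_ac)
    qed
  qed
  obtain m where m: "A < \<rho> ^ m" using real_arch_pow[OF \<rho>] by auto
  have "T > 0" by (simp add: T_def)
  moreover have "D ^ m \<ge> 1" using D by simp
  moreover have "\<forall>t\<ge>T. \<forall>s. t \<le> s \<and> s \<le> A * t \<longrightarrow> g s \<le> D ^ m * g t \<and> g t \<le> D ^ m * g s"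
  proof (intro allI impI)
    fix t s assume "t \<ge> T" "t \<le> s \<and> s \<le> A * t"
    moreover have "A * t \<le> \<rho> ^ m * t" using m \<open>t \<ge> T\<close> \<open>T > 0\<close> by (intro mult_right_mono) auto
    ultimately show "g s \<le> D ^ m * g t \<and> g t \<le> D ^ m * g s" by (intro iter) auto
  qed
  ultimately show ?thesis by blast
qed

section \<open>The norming sequence and its counting function\<close>

definition lnln_quot :: "real \<Rightarrow> real" where "lnln_quot v = v / ln (ln v)"

lemma ln_3_gt_1: "ln (3::real) > 1"
proof -
  have "exp 1 < (3::real)" using e_less_272 by simp
  then have "ln (exp 1) < ln (3::real)" by (subst ln_less_cancel_iff) auto
  then show ?thesis by simp
qed

lemma ln_16_ge_1: "ln (16::real) \<ge> 1"
proof -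
  have "ln 3 \<le> ln (16::real)" by (subst ln_le_cancel_iff) auto
  with ln_3_gt_1 show ?thesis by linarith
qed

lemma lnln_pos: "v > 3 \<Longrightarrow> ln (ln v) > (0::real)"
proof -
  assume "v > (3::real)"
  then have "ln v > ln 3" by simp
  with ln_3_gt_1 have "ln v > 1" by linarith
  then show ?thesis by simp
qed

lemma lnln_quot_ge_1: "v > 3 \<Longrightarrow> lnln_quot v \<ge> 1"
proof -
  assume v: "v > (3::real)"
  then have "ln v > ln 3" by simp
  with ln_3_gt_1 have l: "ln v > 1" by linarith
  have "ln (ln v) \<le> ln v" using l by (intro ln_bound) auto
  also have "\<dots> \<le> v" using v by (intro ln_bound) auto
  finally show ?thesis using lnln_pos[OF v] by (simp add: lnln_quot_def)
qed

text \<open>Multiplying \<open>v\<close> by \<open>C\<close> raises \<open>ln (ln v)\<close> by at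
  most \<open>ln (1 + ln C)\<close>. Since \<open>ln (ln v)\<close> is bounded below by the positive
  constant \<open>L\<close> for \<open>v > 3\<close>, this additive error becomes a factor.\<close>

lemma lnln_quot_scale:
  assumes "C \<ge> 1"
  shows "\<exists>K\<ge>1. \<forall>v w. v > 3 \<and> w > 3 \<and> v \<le> C * w \<and> w \<le> C * v \<longrightarrow> lnln_quot v \<le> K * lnln_quot w"
proof -
  define L where "L = ln (ln (3::real))"
  have L: "L > 0" using ln_3_gt_1 by (simp add: L_def)
  define K where "K = C * (1 + ln (1 + ln C) / L)"
  have lC: "ln C \<ge> 0" using assms by simp
  have "K \<ge> 1 * (1 + 0)" unfolding K_def
    using assms L lC by (intro mult_mono) auto
  moreover have "lnln_quot v \<le> K * lnln_quot w" if vw: "v > 3" "w > 3" "v \<le> C * w" "w \<le> C * v" for v w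
  proof -
    have "ln v > ln 3" "ln w > ln 3" using vw by auto
    with ln_3_gt_1 have lv: "ln v > 1" "ln v > ln 3" "ln w > 1" by linarith+
    have llv: "ln (ln v) \<ge> L" "ln (ln v) > 0" "ln (ln w) > 0"
      using lv ln_3_gt_1 lnln_pos vw by (auto simp: L_def)
    have "ln (ln w) \<le> ln (ln (C * v))"
      using vw lv assms by (subst ln_le_cancel_iff) (auto intro: less_trans)
    also have "ln (C * v) = ln C + ln v" using assms vw by (simp add: ln_mult)
    also have "ln (ln C + ln v) \<le> ln ((1 + ln C) * ln v)"
    proof (subst ln_le_cancel_iff)
      have "ln C * 1 \<le> ln C * ln v" using lC lv by (intro mult_left_mono) auto
      then show "ln C + ln v \<le> (1 + ln C) * ln v" by (simp add: algebra_simps)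
    qed (use lC lv in auto)
    also have "\<dots> = ln (1 + ln C) + ln (ln v)" using lC lv by (simp add: ln_mult)
    also have "\<dots> \<le> ln (1 + ln C) * (ln (ln v) / L) + ln (ln v)"
    proof -
      have "ln (1 + ln C) * 1 \<le> ln (1 + ln C) * (ln (ln v) / L)"
        using lC L llv by (intro mult_left_mono) auto
      then show ?thesis by simp
    qed
    also have "\<dots> = (1 + ln (1 + ln C) / L) * ln (ln v)" by (simp add: algebra_simps)
    finally have *: "ln (ln w) \<le> (1 + ln (1 + ln C) / L) * ln (ln v)" .
    have "v * ln (ln w) \<le> (C * w) * ((1 + ln (1 + ln C) / L) * ln (ln v))"
      using vw * llv assms by (intro mult_mono) auto
    also have "\<dots> = K * w * ln (ln v)" by (simp add: K_def mult_ac)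
    finally show ?thesis using llv by (simp add: lnln_quot_def field_simps)
  qed
  ultimately show ?thesis by (intro exI[of _ K]) auto
qed

text \<open>The order of the sum of the first \<open>n\<close> prime digits. As
  \<open>exp 3 \<le> 27\<close>, the shift makes the inner logarithm at least 3 and the iterated one
  at least 1 for every \<open>n\<close>, so that \<open>bnorm n \<ge> n\<close> without
  exception.\<close>

definition bnorm :: "nat \<Rightarrow> real" where "bnorm n = real n * ln (ln (real n + 27))"

lemma lnln_shift_ge_1:
  fixes x :: real
  assumes "x \<ge> 0"
  shows "ln (x + 27) \<ge> 1" "ln (ln (x + 27)) \<ge> 1"
proof -
  have e: "exp 1 < (3::real)" using e_less_272 by simp
  have "exp (3 :: real) = exp 1 ^ 3" by (simp flip: exp_of_nat_mult)
  also have "\<dots> \<le> 3 ^ 3" using e by (intro power_mono) auto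
  finally have 3: "3 \<le> ln (x + 27)" using assms by (subst ln_ge_iff) auto
  then show "ln (x + 27) \<ge> 1" by simp
  show "ln (ln (x + 27)) \<ge> 1" using 3 e by (subst ln_ge_iff) auto
qed

lemma bnorm_ge: "bnorm n \<ge> real n"
  using lnln_shift_ge_1[of "real n"] by (simp add: bnorm_def mult_le_cancel_left1)

lemma finite_bnorm_less:
  assumes "\<kappa> > 0"
  shows "finite {n. \<kappa> * bnorm n < v}"
proof (rule finite_subset)
  show "{n. \<kappa> * bnorm n < v} \<subseteq> {..nat \<lceil>v / \<kappa>\<rceil>}"
  proof
    fix n assume "n \<in> {n. \<kappa> * bnorm n < v}"
    then have "bnorm n < v / \<kappa>" using assms by (simp add: field_simps)
    with bnorm_ge[of n] have "real n < v / \<kappa>" by linarith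
    then show "n \<in> {..nat \<lceil>v / \<kappa>\<rceil>}" by simp linarith
  qed
qed simp

lemma card_bnorm_less_upper:
  assumes \<kappa>: "\<kappa> > 0"
  shows "\<exists>C>0. \<forall>v>3. real (card {n. \<kappa> * bnorm n < v}) \<le> C * lnln_quot v"
proof -
  \<comment> \<open>Twice the asymptotic size of the count: the spare factor absorbs the difference
    between \<open>ln (ln (\<phi> v + 27))\<close> and \<open>ln (ln v)\<close>. The lower bound
    uses half the size for the same reason.\<close>
  define \<phi> where "\<phi> = (\<lambda>v. 2 / \<kappa> * lnln_quot v)"
  have "\<forall>\<^sub>F v in at_top. \<kappa> * (\<phi> v * ln (ln (\<phi> v + 27))) \<ge> v"
    unfolding \<phi>_def lnln_quot_def using \<kappa> by real_asymp
  then obtain V where V: "\<And>v. v \<ge> V \<Longrightarrow> \<kappa> * (\<phi> v * ln (ln (\<phi> v + 27))) \<ge> v"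
    by (auto simp: eventually_at_top_linorder)
  define W where "W = max V 4"
  \<comment> \<open>The last summand covers all \<open>v\<close> below the threshold at once, by
    monotonicity of the count.\<close>
  define C where "C = 2 / \<kappa> + 1 + real (card {n. \<kappa> * bnorm n < W})"
  have "real (card {n. \<kappa> * bnorm n < v}) \<le> C * lnln_quot v" if v: "v > 3" for v
  proof (cases "v \<ge> V")
    case True
    have \<phi>0: "\<phi> v \<ge> 0" using lnln_quot_ge_1[OF v] \<kappa> by (auto simp: \<phi>_def)
    have "{n. \<kappa> * bnorm n < v} \<subseteq> {..nat \<lfloor>\<phi> v\<rfloor>}"
    proof
      fix n assume n: "n \<in> {n. \<kappa> * bnorm n < v}"
      have "real n < \<phi> v"
      proof (rule ccontr)
        assume "\<not> real n < \<phi> v"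
        then have le: "\<phi> v \<le> real n" by simp
        then have "ln (ln (\<phi> v + 27)) \<le> ln (ln (real n + 27))"
          using \<phi>0 by simp
        then have "\<phi> v * ln (ln (\<phi> v + 27)) \<le> bnorm n"
          unfolding bnorm_def using le \<phi>0 lnln_shift_ge_1[of "\<phi> v"] by (intro mult_mono) auto
        then have "\<kappa> * (\<phi> v * ln (ln (\<phi> v + 27))) \<le> \<kappa> * bnorm n" using \<kappa> by simp
        with V[OF True] n show False by simp
      qed
      then show "n \<in> {..nat \<lfloor>\<phi> v\<rfloor>}" by (simp add: le_nat_floor)
    qed
    then have "card {n. \<kappa> * bnorm n < v} \<le> card {..nat \<lfloor>\<phi> v\<rfloor>}" by (intro card_mono) auto
    then have "real (card {n. \<kappa> * bnorm n < v}) \<le> \<phi> v + 1"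
      using \<phi>0 by simp linarith
    also have "\<dots> \<le> (2 / \<kappa> + 1) * lnln_quot v"
      using lnln_quot_ge_1[OF v] by (simp add: \<phi>_def algebra_simps)
    also have "\<dots> \<le> C * lnln_quot v"
      using lnln_quot_ge_1[OF v] by (intro mult_right_mono) (auto simp: C_def)
    finally show ?thesis .
  next
    case False
    then have "card {n. \<kappa> * bnorm n < v} \<le> card {n. \<kappa> * bnorm n < W}"
      using \<kappa> by (intro card_mono finite_bnorm_less) (auto simp: W_def)
    then have "real (card {n. \<kappa> * bnorm n < v}) \<le> real (card {n. \<kappa> * bnorm n < W})" by simp
    moreover have "2 / \<kappa> > 0" using \<kappa> by simp
    ultimately have "real (card {n. \<kappa> * bnorm n < v}) \<le> C" unfolding C_def by linarith
    then have "real (card {n. \<kappa> * bnorm n < v}) * 1 \<le> C * lnln_quot v"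
      using lnln_quot_ge_1[OF v] by (intro mult_mono) auto
    then show ?thesis by simp
  qed
  moreover have "2 / \<kappa> > 0" using \<kappa> by simp
  then have "C > 0" unfolding C_def by linarith
  ultimately show ?thesis by blast
qed

lemma card_bnorm_less_lower:
  assumes \<kappa>: "\<kappa> > 0"
  shows "\<exists>C>0. \<forall>v>3. lnln_quot v \<le> C * real (card {n. \<kappa> * bnorm n < v})"
proof -
  define \<phi> where "\<phi> = (\<lambda>v. 1 / (2 * \<kappa>) * lnln_quot v)"
  have "\<forall>\<^sub>F v in at_top. \<kappa> * (\<phi> v * ln (ln (\<phi> v + 27))) < v"
    unfolding \<phi>_def lnln_quot_def using \<kappa> by real_asymp
  then obtain V where V: "\<And>v. v \<ge> V \<Longrightarrow> \<kappa> * (\<phi> v * ln (ln (\<phi> v + 27))) < v"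
    by (auto simp: eventually_at_top_linorder)
  define L where "L = ln (ln (3::real))"
  have L: "L > 0" using ln_3_gt_1 by (simp add: L_def)
  define C where "C = 2 * \<kappa> + max V 0 / L"
  have "lnln_quot v \<le> C * real (card {n. \<kappa> * bnorm n < v})" if v: "v > 3" for v
  proof (cases "v \<ge> V")
    case True
    have \<phi>0: "\<phi> v \<ge> 0" using lnln_quot_ge_1[OF v] \<kappa> by (auto simp: \<phi>_def)
    have "{..nat \<lfloor>\<phi> v\<rfloor>} \<subseteq> {n. \<kappa> * bnorm n < v}"
    proof
      fix n assume "n \<in> {..nat \<lfloor>\<phi> v\<rfloor>}"
      then have n: "real n \<le> \<phi> v" using \<phi>0 by simp linarith
      then have "ln (ln (real n + 27)) \<le> ln (ln (\<phi> v + 27))" by simp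
      then have "bnorm n \<le> \<phi> v * ln (ln (\<phi> v + 27))"
        unfolding bnorm_def using n \<phi>0 lnln_shift_ge_1[of "real n"] by (intro mult_mono) auto
      then have "\<kappa> * bnorm n \<le> \<kappa> * (\<phi> v * ln (ln (\<phi> v + 27)))" using \<kappa> by simp
      with V[OF True] show "n \<in> {n. \<kappa> * bnorm n < v}" by simp
    qed
    then have "card {..nat \<lfloor>\<phi> v\<rfloor>} \<le> card {n. \<kappa> * bnorm n < v}"
      using finite_bnorm_less[OF \<kappa>] by (intro card_mono)
    then have "\<phi> v \<le> real (card {n. \<kappa> * bnorm n < v})" using \<phi>0 by simp linarith
    then have "lnln_quot v \<le> (2 * \<kappa>) * real (card {n. \<kappa> * bnorm n < v})"
      using \<kappa> by (simp add: \<phi>_def field_simps)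
    also have "\<dots> \<le> C * real (card {n. \<kappa> * bnorm n < v})"
      using L by (intro mult_right_mono) (auto simp: C_def)
    finally show ?thesis .
  next
    case False
    \<comment> \<open>Since \<open>bnorm 0 = 0\<close>, the index 0 is always counted; so for small
      \<open>v\<close> the count is at least 1 and a constant suffices.\<close>
    have "0 \<in> {n. \<kappa> * bnorm n < v}" using v by (simp add: bnorm_def)
    then have "card {n. \<kappa> * bnorm n < v} > 0" using finite_bnorm_less[OF \<kappa>] by (auto simp: card_gt_0_iff)
    then have c: "real (card {n. \<kappa> * bnorm n < v}) \<ge> 1" by linarith
    have "ln (ln v) \<ge> L" unfolding L_def using v ln_3_gt_1 by (subst ln_le_cancel_iff) auto
    then have "lnln_quot v \<le> V / L" unfolding lnln_quot_def using v L False by (intro frac_le) auto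
    also have "\<dots> \<le> C * 1" using \<kappa> L by (simp add: C_def divide_right_mono add_increasing)
    also have "\<dots> \<le> C * real (card {n. \<kappa> * bnorm n < v})"
      using c L \<kappa> by (intro mult_left_mono) (auto simp: C_def intro!: add_nonneg_nonneg)
    finally show ?thesis .
  qed
  moreover have "C > 0" using \<kappa> L by (auto simp: C_def intro!: add_pos_nonneg)
  ultimately show ?thesis by blast
qed

section \<open>Sums over primes\<close>

lemma pblockD:
  assumes "p \<in> pblock j"
  shows "prime p" "16 ^ j < real p" "real p \<le> 16 ^ Suc j"
proof -
  have "16 ^ j < p" "p \<le> 16 ^ Suc j" and p: "prime p" using assms by (auto simp: pblock_def prime_block_def)
  then have "real (16 ^ j) < real p" "real p \<le> real (16 ^ Suc j)" by (simp_all only: of_nat_less_iff of_nat_le_iff)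
  then show "16 ^ j < real p" "real p \<le> 16 ^ Suc j" by simp_all
  show "prime p" by (rule p)
qed

lemma finite_pblock [simp]: "finite (pblock j)"
  by (simp add: pblock_def)

text \<open>Here \<open>v\<close> is a reference value of \<open>u\<close> on the block. The factor
  8 is that of \<open>card_pblock_upper\<close>, and 1024 is \<open>4 * 16\<^sup>2\<close>: 4 from
  the lower prime count, \<open>16\<^sup>2\<close> from replacing \<open>p\<close> by the right
  end.\<close>

lemma sum_pblock_bounds:
  fixes u :: "real \<Rightarrow> real"
  assumes j: "j \<ge> 1" and C: "C \<ge> 1"
    and u: "\<And>s. 16 ^ j < s \<Longrightarrow> s \<le> 16 ^ Suc j \<Longrightarrow> 0 \<le> u s \<and> u s \<le> C * v \<and> v \<le> C * u s"
  shows "(\<Sum>p\<in>pblock j. u (real p) / (real p)\<^sup>2) \<le> 8 * C * (v / (real j * 16 ^ j))"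
    "v / (real j * 16 ^ j) \<le> 1024 * C * (\<Sum>p\<in>pblock j. u (real p) / (real p)\<^sup>2)"
proof -
  let ?X = "16 ^ j :: real"
  have v: "v \<ge> 0"
    using u[of "16 ^ Suc j"] C by (auto simp: zero_le_mult_iff dest: order_trans)
  have "(\<Sum>p\<in>pblock j. u (real p) / (real p)\<^sup>2) \<le> (\<Sum>p\<in>pblock j. C * v / ?X\<^sup>2)"
  proof (rule sum_mono)
    fix p assume "p \<in> pblock j"
    from pblockD[OF this] show "u (real p) / (real p)\<^sup>2 \<le> C * v / ?X\<^sup>2"
      using u[of "real p"] by (intro frac_le power_mono) auto
  qed
  also have "\<dots> = real (card (pblock j)) * (C * v / ?X\<^sup>2)" by simp
  also have "\<dots> \<le> (8 * ?X / real j) * (C * v / ?X\<^sup>2)"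
    using card_pblock_upper[OF j] C v by (intro mult_right_mono) auto
  also have "\<dots> = 8 * C * (v / (real j * ?X))"
    using j by (simp add: field_simps power2_eq_square)
  finally show "(\<Sum>p\<in>pblock j. u (real p) / (real p)\<^sup>2) \<le> 8 * C * (v / (real j * ?X))" .
  have "v / (real j * ?X) = 1024 * C * ((?X / (4 * real j)) * ((v / C) / (16 * ?X)\<^sup>2))"
    using j C by (simp add: field_simps power2_eq_square)
  also have "\<dots> \<le> 1024 * C * (real (card (pblock j)) * ((v / C) / (16 * ?X)\<^sup>2))"
    using card_pblock_lower[OF j] C v by (intro mult_left_mono mult_right_mono) auto
  also have "real (card (pblock j)) * ((v / C) / (16 * ?X)\<^sup>2) = (\<Sum>p\<in>pblock j. (v / C) / (16 * ?X)\<^sup>2)"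
    by simp
  also have "1024 * C * \<dots> \<le> 1024 * C * (\<Sum>p\<in>pblock j. u (real p) / (real p)\<^sup>2)"
  proof (intro mult_left_mono sum_mono)
    fix p assume p: "p \<in> pblock j"
    have "real p > 0" using pblockD[OF p] by (metis less_trans zero_less_numeral zero_less_power)
    then show "(v / C) / (16 * ?X)\<^sup>2 \<le> u (real p) / (real p)\<^sup>2"
      using u[of "real p"] pblockD[OF p] C v
      by (intro frac_le power_mono) (auto simp: divide_le_eq mult.commute)
  qed (use C in auto)
  finally show "v / (real j * ?X) \<le> 1024 * C * (\<Sum>p\<in>pblock j. u (real p) / (real p)\<^sup>2)" .
qed

text \<open>The companion of \<open>sum_pblock_bounds\<close> with the same middle term. The block
  has length \<open>15 * 16 ^ j\<close> and \<open>ln y\<close> lies between \<open>j\<close> and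
  \<open>30 j\<close>, whence 15 and \<open>512 = 16\<^sup>2 * 30 / 15\<close>.\<close>

lemma nn_integral_block_bounds:
  fixes u :: "real \<Rightarrow> real"
  assumes j: "j \<ge> 1" and C: "C \<ge> 1"
    and u: "\<And>s. 16 ^ j < s \<Longrightarrow> s \<le> 16 ^ Suc j \<Longrightarrow> 0 \<le> u s \<and> u s \<le> C * v \<and> v \<le> C * u s"
  shows "(\<integral>\<^sup>+y\<in>{16 ^ j<..16 ^ Suc j}. ennreal (u y / (y\<^sup>2 * ln y)) \<partial>lborel) \<le>
      ennreal (15 * C * (v / (real j * 16 ^ j)))"
    "ennreal (v / (real j * 16 ^ j)) \<le>
      ennreal (512 * C) * (\<integral>\<^sup>+y\<in>{16 ^ j<..16 ^ Suc j}. ennreal (u y / (y\<^sup>2 * ln y)) \<partial>lborel)"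
proof -
  let ?X = "16 ^ j :: real"
  let ?B = "{16 ^ j<..16 ^ Suc j} :: real set"
  have v: "v \<ge> 0"
    using u[of "16 ^ Suc j"] C by (auto simp: zero_le_mult_iff dest: order_trans)
  have X: "?X > 0" by simp
  have em: "emeasure lborel ?B = ennreal (15 * ?X)" by simp
  have ln16: "ln (16::real) \<ge> 1" "ln (16::real) \<le> 15"
    using ln_16_ge_1 ln_le_minus_one[of 16] by auto
  have ln_bounds: "real j \<le> ln y" "ln y \<le> 2 * real j * 15" if "y \<in> ?B" for y
  proof -
    have y: "?X \<le> y" "y \<le> 16 ^ Suc j" using that by auto
    with X have y0: "y > 0" by linarith
    have "real j \<le> real j * ln 16" using ln16 by (simp add: mult_le_cancel_left1)
    also have "\<dots> = ln ?X" by (simp add: ln_realpow)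
    also have "\<dots> \<le> ln y" using y(1) by (rule iffD2[OF ln_le_cancel_iff[OF X y0]])
    finally show "real j \<le> ln y" .
    have "ln y \<le> ln (16 ^ Suc j)" using y(2) by (subst ln_le_cancel_iff[OF y0]) simp_all
    also have "\<dots> = real (Suc j) * ln 16" by (subst ln_realpow) auto
    also have "\<dots> \<le> 2 * real j * 15" using ln16 j by (intro mult_mono) auto
    finally show "ln y \<le> 2 * real j * 15" .
  qed
  have "(\<integral>\<^sup>+y\<in>?B. ennreal (u y / (y\<^sup>2 * ln y)) \<partial>lborel) \<le>
    (\<integral>\<^sup>+y\<in>?B. ennreal (C * v / (?X\<^sup>2 * real j)) \<partial>lborel)"
  proof (rule nn_integral_mono)
    fix y :: real
    show "ennreal (u y / (y\<^sup>2 * ln y)) * indicator ?B y \<le> ennreal (C * v / (?X\<^sup>2 * real j)) * indicator ?B y"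
    proof (cases "y \<in> ?B")
      case True
      have "u y / (y\<^sup>2 * ln y) \<le> C * v / (?X\<^sup>2 * real j)"
        using u[of y] True ln_bounds[OF True] j X
        by (intro frac_le mult_mono power_mono) (auto intro!: mult_pos_pos)
      then show ?thesis using True by (simp add: ennreal_leI)
    qed simp
  qed
  also have "\<dots> = ennreal (C * v / (?X\<^sup>2 * real j)) * ennreal (15 * ?X)"
    by (subst nn_integral_cmult_indicator) (simp_all only: em, simp)
  also have "\<dots> = ennreal (C * v / (?X\<^sup>2 * real j) * (15 * ?X))"
    using C v by (intro ennreal_mult [symmetric]) auto
  also have "C * v / (?X\<^sup>2 * real j) * (15 * ?X) = 15 * C * (v / (real j * ?X))"
    using j by (simp add: field_simps power2_eq_square)
  finally show "(\<integral>\<^sup>+y\<in>?B. ennreal (u y / (y\<^sup>2 * ln y)) \<partial>lborel) \<le> ennreal (15 * C * (v / (real j * ?X)))" .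
  have "ennreal (v / (real j * ?X)) = ennreal (512 * C) * (ennreal ((v / C) / ((16 * ?X)\<^sup>2 * (2 * real j * 15))) * ennreal (15 * ?X))"
  proof -
    have "v / (real j * ?X) = 512 * C * ((v / C) / ((16 * ?X)\<^sup>2 * (2 * real j * 15)) * (15 * ?X))"
      using j C by (simp add: field_simps power2_eq_square)
    moreover have "0 \<le> (v / C) / ((16 * ?X)\<^sup>2 * (2 * real j * 15))" "0 \<le> 15 * ?X" "0 \<le> 512 * C"
      using C v by auto
    ultimately show ?thesis by (simp only: ennreal_mult [symmetric] mult_nonneg_nonneg)
  qed
  moreover have "ennreal ((v / C) / ((16 * ?X)\<^sup>2 * (2 * real j * 15))) * ennreal (15 * ?X) =
     (\<integral>\<^sup>+y\<in>?B. ennreal ((v / C) / ((16 * ?X)\<^sup>2 * (2 * real j * 15))) \<partial>lborel)"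
    by (subst nn_integral_cmult_indicator) (simp_all only: em, simp)
  moreover have "(\<integral>\<^sup>+y\<in>?B. ennreal ((v / C) / ((16 * ?X)\<^sup>2 * (2 * real j * 15))) \<partial>lborel) \<le>
     (\<integral>\<^sup>+y\<in>?B. ennreal (u y / (y\<^sup>2 * ln y)) \<partial>lborel)"
  proof (rule nn_integral_mono)
    fix y :: real
    show "ennreal ((v / C) / ((16 * ?X)\<^sup>2 * (2 * real j * 15))) * indicator ?B y \<le> ennreal (u y / (y\<^sup>2 * ln y)) * indicator ?B y"
    proof (cases "y \<in> ?B")
      case True
      have "?X < y" using True by simp
      with X have y0: "y > 0" by linarith
      moreover have "ln y > 0" using ln_bounds(1)[OF True] j by linarith
      ultimately have y: "y > 0" "ln y > 0" "0 < y\<^sup>2 * ln y" by (blast | simp only: mult_pos_pos zero_less_power)+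
      have "(v / C) / ((16 * ?X)\<^sup>2 * (2 * real j * 15)) \<le> u y / (y\<^sup>2 * ln y)"
      proof (intro frac_le mult_mono power_mono)
        show "v / C \<le> u y" using u[of y] True C by (auto simp: divide_le_eq mult.commute)
        show "0 \<le> u y" using u[of y] True by auto
        show "0 < y\<^sup>2 * ln y" by (rule y)
        show "0 \<le> ln y" using y by linarith
      qed (use True y0 ln_bounds[OF True] in auto)
      then show ?thesis using True by (simp add: ennreal_leI)
    qed simp
  qed
  ultimately show "ennreal (v / (real j * ?X)) \<le>
      ennreal (512 * C) * (\<integral>\<^sup>+y\<in>?B. ennreal (u y / (y\<^sup>2 * ln y)) \<partial>lborel)"
    by (simp only: mult_left_mono zero_le)
qed

lemma disjoint_power_blocks: "disjoint_family (\<lambda>i. {16 ^ (J + i)<..16 ^ Suc (J + i)} :: real set)"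
proof -
  have "{16 ^ (J + i)<..16 ^ Suc (J + i)} \<inter> {16 ^ (J + k)<..16 ^ Suc (J + k)} = ({} :: real set)"
    if "i < k" for i k
  proof -
    have "(16::real) ^ Suc (J + i) \<le> 16 ^ (J + k)" using that by (intro power_increasing) auto
    then show ?thesis by auto
  qed
  then show ?thesis unfolding disjoint_family_on_def
    by (metis inf_commute linorder_neqE_nat)
qed

lemma Union_power_blocks: "(\<Union>i. {16 ^ (J + i)<..16 ^ Suc (J + i)}) = ({16 ^ J<..} :: real set)"
proof (intro equalityI subsetI)
  fix x :: real assume "x \<in> (\<Union>i. {16 ^ (J + i)<..16 ^ Suc (J + i)})"
  then obtain i where "16 ^ (J + i) < x" by auto
  moreover have "(16::real) ^ J \<le> 16 ^ (J + i)" by (intro power_increasing) auto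
  ultimately have "16 ^ J < x" by linarith
  then show "x \<in> {16 ^ J<..}" by simp
next
  fix x :: real assume x: "x \<in> {16 ^ J<..}"
  obtain n where n: "x < 16 ^ n" using real_arch_pow[of 16 x] by auto
  define k where "k = (LEAST k. x \<le> 16 ^ k)"
  have k: "x \<le> 16 ^ k" unfolding k_def by (rule LeastI[of _ n]) (use n in auto)
  have nk: "\<not> x \<le> 16 ^ i" if "i < k" for i using not_less_Least that unfolding k_def by blast
  have "k > J"
  proof (rule ccontr)
    assume "\<not> k > J"
    then have "(16::real) ^ k \<le> 16 ^ J" by (intro power_increasing) auto
    with k x show False by simp
  qed
  then obtain i where i: "k = Suc (J + i)" using less_imp_Suc_add by auto
  have "\<not> x \<le> 16 ^ (J + i)" using nk[of "J + i"] i by simp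
  with k i have "x \<in> {16 ^ (J + i)<..16 ^ Suc (J + i)}" by simp
  then show "x \<in> (\<Union>i. {16 ^ (J + i)<..16 ^ Suc (J + i)})" by blast
qed

section \<open>Series over primes against integrals\<close>

definition prime_series :: "(real \<Rightarrow> real) \<Rightarrow> nat \<Rightarrow> ennreal" where
  "prime_series u J = (\<integral>\<^sup>+p\<in>{p. prime p \<and> 16 ^ J < p}. ennreal (u (real p) / (real p)\<^sup>2) \<partial>count_space UNIV)"

lemma prime_series_blocks:
  "prime_series u J = (\<Sum>i. \<Sum>p\<in>pblock (J + i). ennreal (u (real p) / (real p)\<^sup>2))"
proof -
  have eq: "{p. prime p \<and> 16 ^ J < p} = (\<Union>i. pblock (J + i))"
  proof -
    have "real p \<in> {16 ^ J<..} \<longleftrightarrow> (\<exists>i. real p \<in> {16 ^ (J + i)<..16 ^ Suc (J + i)})" for p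
      unfolding Union_power_blocks [symmetric] by simp
    moreover have *: "real p \<in> {16 ^ k<..} \<longleftrightarrow> 16 ^ k < p" "real p \<in> {16 ^ k<..16 ^ l} \<longleftrightarrow> 16 ^ k < p \<and> p \<le> 16 ^ l" for p k l
      by (simp_all flip: of_nat_power_less_of_nat_cancel_iff of_nat_le_of_nat_power_cancel_iff)
    ultimately have iff: "16 ^ J < p \<longleftrightarrow> (\<exists>i. 16 ^ (J + i) < p \<and> p \<le> 16 ^ Suc (J + i))" for p :: nat
      unfolding * by blast
    have "p \<in> {p. prime p \<and> 16 ^ J < p} \<longleftrightarrow> p \<in> (\<Union>i. pblock (J + i))" for p
      unfolding pblock_def prime_block_def mem_Collect_eq UN_iff
      by (subst iff) blast
    then show ?thesis by (rule set_eqI)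
  qed
  have disj: "disjoint_family (\<lambda>i. pblock (J + i))"
  proof -
    have "pblock (J + i) \<subseteq> real -` {16 ^ (J + i)<..16 ^ Suc (J + i)}" for i
      using pblockD by auto
    then show ?thesis
      using disjoint_power_blocks[of J] unfolding disjoint_family_on_def by blast
  qed
  have "prime_series u J = (\<Sum>i. \<integral>\<^sup>+p\<in>pblock (J + i). ennreal (u (real p) / (real p)\<^sup>2) \<partial>count_space UNIV)"
    unfolding prime_series_def eq by (rule nn_integral_disjoint_family) (use disj in auto)
  then show ?thesis by (simp add: nn_integral_indicator_finite)
qed

text \<open>Split over blocks, the series and the integral are both within constant factors of the
  same sequence \<open>a\<close>, so each diverges exactly when \<open>suminf a\<close>
  does.\<close>

lemma prime_series_vs_integral:
  fixes u :: "real \<Rightarrow> real"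
  assumes J: "J \<ge> 1" and C: "C \<ge> 1" and u_meas [measurable]: "u \<in> borel_measurable borel"
    and u: "\<And>j s. j \<ge> J \<Longrightarrow> 16 ^ j < s \<Longrightarrow> s \<le> 16 ^ Suc j \<Longrightarrow>
              0 \<le> u s \<and> u s \<le> C * u (16 ^ Suc j) \<and> u (16 ^ Suc j) \<le> C * u s"
  shows "prime_series u J = \<infinity> \<longleftrightarrow> (\<integral>\<^sup>+y\<in>{16 ^ J<..}. ennreal (u y / (y\<^sup>2 * ln y)) \<partial>lborel) = \<infinity>"
proof -
  let ?B = "\<lambda>i. {16 ^ (J + i)<..16 ^ Suc (J + i)} :: real set"
  define a where "a = (\<lambda>i. ennreal (u (16 ^ Suc (J + i)) / (real (J + i) * 16 ^ (J + i))))"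
  define P where "P = (\<lambda>i. \<Sum>p\<in>pblock (J + i). ennreal (u (real p) / (real p)\<^sup>2))"
  define I where "I = (\<lambda>i. \<integral>\<^sup>+y\<in>?B i. ennreal (u y / (y\<^sup>2 * ln y)) \<partial>lborel)"
  have P_real: "P i = ennreal (\<Sum>p\<in>pblock (J + i). u (real p) / (real p)\<^sup>2)" for i
    unfolding P_def using u[of "J + i"] pblockD by (intro sum_ennreal) auto
  have P: "P i \<le> ennreal (8 * C) * a i" "a i \<le> ennreal (1024 * C) * P i" for i
  proof -
    note b = sum_pblock_bounds[of "J + i" C u "u (16 ^ Suc (J + i))"]
    show "P i \<le> ennreal (8 * C) * a i"
      unfolding P_real a_def using b(1) u[of "J + i"] J C
      by (subst ennreal_mult' [symmetric]) (auto intro!: ennreal_leI)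
    show "a i \<le> ennreal (1024 * C) * P i"
      unfolding P_real a_def using b(2) u[of "J + i"] J C
      by (subst ennreal_mult' [symmetric]) (auto intro!: ennreal_leI)
  qed
  have I: "I i \<le> ennreal (15 * C) * a i" "a i \<le> ennreal (512 * C) * I i" for i
  proof -
    note b = nn_integral_block_bounds[of "J + i" C u "u (16 ^ Suc (J + i))"]
    have "I i \<le> ennreal (15 * C * (u (16 ^ Suc (J + i)) / (real (J + i) * 16 ^ (J + i))))"
      unfolding I_def using u[of "J + i"] J C by (intro b(1)) auto
    then show "I i \<le> ennreal (15 * C) * a i"
      unfolding a_def using C by (subst ennreal_mult' [symmetric]) auto
    show "a i \<le> ennreal (512 * C) * I i"
      unfolding I_def a_def using u[of "J + i"] J C by (intro b(2)) auto
  qed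
  have "prime_series u J = suminf P" by (simp add: prime_series_blocks P_def)
  moreover have "(\<integral>\<^sup>+y\<in>{16 ^ J<..}. ennreal (u y / (y\<^sup>2 * ln y)) \<partial>lborel) = suminf I"
    unfolding I_def Union_power_blocks [symmetric]
    by (rule nn_integral_disjoint_family) (use disjoint_power_blocks in auto)
  moreover have "suminf P \<le> ennreal (8 * C) * suminf a" "suminf a \<le> ennreal (1024 * C) * suminf P"
     "suminf I \<le> ennreal (15 * C) * suminf a" "suminf a \<le> ennreal (512 * C) * suminf I"
    using P I by (auto simp flip: ennreal_suminf_cmult intro!: suminf_le)
  ultimately show ?thesis
    by (smt (verit, best) ennreal_mult_eq_top_iff ennreal_neq_top infinity_ennreal_def neq_top_trans)
qed

lemma prime_series_0_eq_top_iff: "prime_series u J = \<infinity> \<longleftrightarrow>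
   (\<integral>\<^sup>+p\<in>{p. prime p}. ennreal (u (real p) / (real p)\<^sup>2) \<partial>count_space (UNIV :: nat set)) = \<infinity>"
proof -
  let ?F = "\<lambda>p::nat. ennreal (u (real p) / (real p)\<^sup>2)"
  have "(\<integral>\<^sup>+p\<in>{p. prime p}. ?F p \<partial>count_space UNIV) =
     (\<integral>\<^sup>+p. ?F p * indicator (prime_block 0 (16 ^ J)) p + ?F p * indicator {p. prime p \<and> 16 ^ J < p} p \<partial>count_space UNIV)"
    by (intro nn_integral_cong) (auto split: split_indicator simp: prime_block_def prime_gt_0_nat)
  also have "\<dots> = (\<Sum>p\<in>prime_block 0 (16 ^ J). ?F p) + prime_series u J"
    unfolding prime_series_def
    by (subst nn_integral_add) (auto simp: nn_integral_indicator_finite)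
  finally show ?thesis by auto
qed

section \<open>Sums of reciprocals of primes\<close>

definition prime_recip_sum :: "real \<Rightarrow> real" where
  "prime_recip_sum x = (\<Sum>p | prime p \<and> real p \<le> x. 1 / real p)"

lemma finite_primes_le [simp]: "finite {p::nat. prime p \<and> real p \<le> x}"
  by (rule finite_subset[of _ "{..nat \<lfloor>x\<rfloor>}"]) (auto simp: le_nat_floor)

lemma prime_recip_sum_mono: "x \<le> y \<Longrightarrow> prime_recip_sum x \<le> prime_recip_sum y"
  unfolding prime_recip_sum_def by (intro sum_mono2) auto

text \<open>The block \<open>pblock j\<close> contributes a quantity of order \<open>1 / j\<close>:
  its number of primes has order \<open>16 ^ j / j\<close> and each prime has order
  \<open>16 ^ j\<close>. The 16 is the trivial bound for the primes up to 16.\<close>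

lemma prime_recip_sum_power:
  assumes "m \<ge> 1"
  shows "harm (m - 1) / 64 \<le> prime_recip_sum (16 ^ m)" "prime_recip_sum (16 ^ m) \<le> 16 + 8 * harm (m - 1)"
proof -
  have "harm (m - 1) / 64 \<le> prime_recip_sum (16 ^ m) \<and> prime_recip_sum (16 ^ m) \<le> 16 + 8 * harm (m - 1)"
    using assms
  proof (induction m rule: dec_induct)
    case base
    have "prime_recip_sum (16 ^ 1) \<le> (\<Sum>p\<in>{1..16::nat}. 1)"
      unfolding prime_recip_sum_def
      by (rule order_trans[OF sum_mono2[of "{1..16}"] sum_mono])
         (auto simp: prime_gt_0_nat Suc_leI)
    moreover have "prime_recip_sum (16 ^ 1) \<ge> 0" unfolding prime_recip_sum_def by (intro sum_nonneg) auto
    ultimately show ?case by (simp add: harm_def)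
  next
    case (step m)
    have "{p. prime p \<and> real p \<le> 16 ^ Suc m} = {p. prime p \<and> real p \<le> 16 ^ m} \<union> pblock m"
    proof -
      have "real p \<le> 16 ^ k \<longleftrightarrow> p \<le> 16 ^ k" for p k
        by (simp flip: of_nat_le_of_nat_power_cancel_iff)
      moreover have "p \<le> 16 ^ Suc m" if "p \<le> 16 ^ m" for p :: nat using that by simp
      ultimately show ?thesis unfolding pblock_def prime_block_def by (auto simp del: power_Suc)
    qed
    then have split: "prime_recip_sum (16 ^ Suc m) = prime_recip_sum (16 ^ m) + (\<Sum>p\<in>pblock m. 1 / real p)"
      unfolding prime_recip_sum_def by (simp only:) (intro sum.union_disjoint; auto dest: pblockD)
    have h: "harm (Suc m - 1) = harm (m - 1) + 1 / real m"
      using step by (cases m) (auto simp: harm_Suc inverse_eq_divide)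
    have p: "1 / 16 ^ Suc m \<le> 1 / real p" "1 / real p \<le> 1 / 16 ^ m" if "p \<in> pblock m" for p
      using pblockD[OF that] prime_gt_0_nat[of p] by (intro divide_left_mono; simp)+
    have "(\<Sum>p\<in>pblock m. 1 / real p) \<le> real (card (pblock m)) * (1 / 16 ^ m)"
      using p(2) by (rule sum_bounded_above)
    also have "\<dots> \<le> (8 * 16 ^ m / real m) * (1 / 16 ^ m)"
      using card_pblock_upper[of m] step by (intro mult_right_mono) auto
    finally have 1: "(\<Sum>p\<in>pblock m. 1 / real p) \<le> 8 * (1 / real m)" by simp
    have "(1 / real m) / 64 = (16 ^ m / (4 * real m)) * (1 / 16 ^ Suc m)" by simp
    also have "\<dots> \<le> real (card (pblock m)) * (1 / 16 ^ Suc m)"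
      using card_pblock_lower[of m] step by (intro mult_right_mono) auto
    also have "\<dots> \<le> (\<Sum>p\<in>pblock m. 1 / real p)"
      using p(1) by (rule sum_bounded_below)
    finally have 2: "(1 / real m) / 64 \<le> (\<Sum>p\<in>pblock m. 1 / real p)" .
    show ?case using step.IH 1 2 unfolding split h by (simp add: add_divide_distrib)
  qed
  then show "harm (m - 1) / 64 \<le> prime_recip_sum (16 ^ m)" "prime_recip_sum (16 ^ m) \<le> 16 + 8 * harm (m - 1)"
    by auto
qed

lemma harm_le_1_plus_ln: "n \<ge> 1 \<Longrightarrow> harm n \<le> 1 + ln (real n)"
proof (induction n rule: dec_induct)
  case (step n)
  have "1 / real (Suc n) \<le> ln (real (Suc n)) - ln (real n)"
  proof -
    have "ln (real n / real (Suc n)) \<le> real n / real (Suc n) - 1"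
      using step by (intro ln_le_minus_one) auto
    then show ?thesis using step by (simp add: ln_div field_simps)
  qed
  then show ?case using step by (simp add: harm_Suc inverse_eq_divide)
qed (simp add: harm_def)

lemma prime_recip_sum_upper:
  assumes x: "x \<ge> 16"
  shows "prime_recip_sum x \<le> 24 + 8 * ln (ln x)"
proof -
  define m where "m = nat \<lfloor>ln x\<rfloor>"
  note l16 = ln_16_ge_1
  have "ln 16 \<le> ln x" using x by simp
  then have lx: "ln x \<ge> 1" using l16 by linarith
  have m: "real m \<le> ln x" "ln x < real m + 1" "m \<ge> 1" using lx unfolding m_def by linarith+
  have "ln x \<le> real (Suc m) * 1" using m by simp
  also have "\<dots> \<le> real (Suc m) * ln 16" using l16 by (intro mult_left_mono) auto
  also have "\<dots> = ln (16 ^ Suc m)" by (subst ln_realpow) auto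
  finally have "x \<le> 16 ^ Suc m" using x by (subst (asm) ln_le_cancel_iff) auto
  then have "prime_recip_sum x \<le> prime_recip_sum (16 ^ Suc m)" by (rule prime_recip_sum_mono)
  also have "\<dots> \<le> 16 + 8 * harm m" using prime_recip_sum_power(2)[of "Suc m"] by simp
  also have "harm m \<le> 1 + ln (real m)" using m by (intro harm_le_1_plus_ln)
  also have "ln (real m) \<le> ln (ln x)" using m lx by (subst ln_le_cancel_iff) auto
  finally show ?thesis by simp
qed

lemma prime_recip_sum_lower:
  "\<exists>c>0. \<forall>\<^sub>F x in at_top. prime_recip_sum x \<ge> c * ln (ln x)"
proof (intro exI conjI)
  \<comment> \<open>64 is the loss of the block estimate; it is doubled because
    \<open>ln (ln x / ln 16 - 1)\<close> only approaches \<open>ln (ln x)\<close>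
    asymptotically.\<close>
  show "1 / 128 > (0::real)" by simp
  have "\<forall>\<^sub>F x in at_top. ln (ln x / ln 16 - 1) \<ge> 1 / 2 * ln (ln (x::real))" by real_asymp
  moreover have "\<forall>\<^sub>F x in at_top. ln x / ln 16 - 1 > (0::real)" by real_asymp
  ultimately show "\<forall>\<^sub>F x in at_top. prime_recip_sum x \<ge> 1 / 128 * ln (ln x)"
    using eventually_gt_at_top[of 0]
  proof eventually_elim
    case (elim x)
    define m where "m = nat \<lfloor>ln x / ln 16\<rfloor>"
    have m: "real m \<le> ln x / ln 16" "ln x / ln 16 - 1 \<le> real m" "m \<ge> 1"
      using elim unfolding m_def by linarith+
    have "ln (16 ^ m) \<le> ln x" using m by (simp add: ln_realpow field_simps)
    then have "16 ^ m \<le> x" using elim by (subst (asm) ln_le_cancel_iff) auto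
    have "ln (ln x / ln 16 - 1) \<le> ln (real m)" using elim m by (subst ln_le_cancel_iff) auto
    also have "\<dots> \<le> harm (m - 1)" using harm_ge_ln[of "m - 1"] m by (simp add: of_nat_diff)
    also have "\<dots> \<le> 64 * prime_recip_sum (16 ^ m)" using prime_recip_sum_power(1)[OF m(3)] by simp
    also have "prime_recip_sum (16 ^ m) \<le> prime_recip_sum x"
      using \<open>16 ^ m \<le> x\<close> by (rule prime_recip_sum_mono)
    finally show ?case using elim by simp
  qed
qed

section \<open>Borel--Cantelli lemmas for the digits\<close>

text \<open>The reference mass for digit events: given any past, the next digit lies in a set with
  probability between a third and twice its mass. As \<open>1 / 0 = 0\<close>, the value
  \<open>a = 0\<close>, which is no digit, has mass 0.\<close>

definition nu :: "(nat \<Rightarrow> ennreal) \<Rightarrow> ennreal" where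
  "nu \<psi> = (\<integral>\<^sup>+a. ennreal (1 / (real a)\<^sup>2) * \<psi> a \<partial>count_space UNIV)"

lemma nu_Suc: "(\<Sum>a. ennreal (1 / (real (Suc a))\<^sup>2) * \<psi> (Suc a)) = nu \<psi>"
proof -
  let ?F = "\<lambda>a. ennreal (1 / (real a)\<^sup>2) * \<psi> a"
  have "(\<lambda>a. ?F (Suc a)) sums (\<Sum>a. ?F (Suc a))" by (intro summable_sums summableI)
  then have "?F sums ((\<Sum>a. ?F (Suc a)) + ?F 0)" by (rule sums_Suc)
  then have "(\<Sum>a. ?F a) = (\<Sum>a. ?F (Suc a))" by (simp add: sums_iff del: of_nat_Suc)
  then show ?thesis unfolding nu_def by (subst nn_integral_count_space_nat) simp
qed

lemma nu_mono: "(\<And>a. \<psi> a \<le> \<psi>' a) \<Longrightarrow> nu \<psi> \<le> nu \<psi>'"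
  unfolding nu_def by (intro nn_integral_mono mult_left_mono) auto

lemma nu_finite_ge:
  assumes "finite F"
  shows "(\<Sum>a\<in>F. ennreal (1 / (real a)\<^sup>2) * \<psi> a) \<le> nu \<psi>"
proof -
  have "(\<Sum>a\<in>F. ennreal (1 / (real a)\<^sup>2) * \<psi> a) =
      (\<integral>\<^sup>+a\<in>F. ennreal (1 / (real a)\<^sup>2) * \<psi> a \<partial>count_space UNIV)"
    using assms by (subst nn_integral_indicator_finite) auto
  also have "\<dots> \<le> nu \<psi>" unfolding nu_def
    by (intro nn_integral_mono) (auto split: split_indicator)
  finally show ?thesis .
qed

lemma nu_tail:
  assumes "m \<ge> 1"
  shows "nu (indicator {a. m < a}) \<le> ennreal (1 / real m)"
proof -
  have "(\<lambda>a. 1 / (real a + real m)) \<longlonglongrightarrow> 0" by real_asymp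
  then have "(\<lambda>a. 1 / (real a + real m) - 1 / (real (Suc a) + real m)) sums (1 / (real 0 + real m) - 0)"
    by (rule telescope_sums')
  then have s: "(\<lambda>a. 1 / (real a + real m) - 1 / (real (Suc a) + real m)) sums (1 / real m)" by simp
  have le: "1 / (real a + real m + 1)\<^sup>2 \<le> 1 / (real a + real m) - 1 / (real (Suc a) + real m)" for a
  proof -
    define y where "y = real a + real m"
    have y: "y > 0" using assms by (simp add: y_def)
    have "1 / (y + 1)\<^sup>2 \<le> 1 / (y * (y + 1))"
      using y by (intro divide_left_mono) (auto simp: power2_eq_square)
    also have "\<dots> = 1 / y - 1 / (y + 1)" using y by (simp add: field_simps)
    finally show ?thesis by (simp add: y_def add_ac)
  qed
  have sm: "summable (\<lambda>a. 1 / (real a + real m + 1)\<^sup>2)"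
    by (rule summable_comparison_test'[OF sums_summable[OF s], of 0]) (use le in auto)
  have "nu (indicator {a. m < a}) = (\<integral>\<^sup>+a\<in>{a. m < a}. ennreal (1 / (real a)\<^sup>2) \<partial>count_space UNIV)"
    by (simp add: nu_def)
  also have "\<dots> = (\<integral>\<^sup>+a. ennreal (1 / (real a)\<^sup>2) \<partial>count_space {a. m < a})"
    by (simp add: nn_integral_count_space_indicator)
  also have "\<dots> = (\<integral>\<^sup>+a. ennreal (1 / (real (a + Suc m))\<^sup>2) \<partial>count_space UNIV)"
    by (rule nn_integral_bij_count_space [symmetric])
       (auto simp: bij_betw_def inj_on_def image_iff intro: exI[of _ "_ - Suc m"] dest: le_Suc_ex less_imp_Suc_add)
  also have "\<dots> = (\<Sum>a. ennreal (1 / (real a + real m + 1)\<^sup>2))"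
    by (simp add: nn_integral_count_space_nat add_ac)
  also have "\<dots> = ennreal (\<Sum>a. 1 / (real a + real m + 1)\<^sup>2)"
    using sm by (intro suminf_ennreal2) auto
  also have "\<dots> \<le> ennreal (1 / real m)"
    using suminf_le[OF le sm sums_summable[OF s]] sums_unique[OF s] by (intro ennreal_leI) simp
  finally show ?thesis .
qed

lemma nu_1_le: "nu (\<lambda>_. 1) \<le> 2"
proof -
  have "nu (\<lambda>_. 1) = nu (\<lambda>a. indicator {0, 1} a + indicator {a. 1 < a} a)"
    by (intro arg_cong[of _ _ nu] ext) (auto split: split_indicator)
  also have "\<dots> = nu (indicator {0, 1}) + nu (indicator {a. 1 < a})"
    by (simp add: nu_def distrib_left nn_integral_add)
  also have "nu (indicator {0, 1}) = 1"
    unfolding nu_def by (subst nn_integral_indicator_finite) auto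
  also have "1 + nu (indicator {a. 1 < a}) \<le> 1 + ennreal (1 / real 1)"
    by (intro add_left_mono nu_tail) auto
  finally show ?thesis by (simp flip: ennreal_1 ennreal_plus ennreal_numeral)
qed

lemma nu_le_2: "(\<And>a. \<psi> a \<le> 1) \<Longrightarrow> nu \<psi> \<le> 2"
  using nu_mono[of \<psi> "\<lambda>_. 1"] nu_1_le by (meson order_trans)

lemma digit_weight_sum_le:
  assumes "0 \<le> r" "r \<le> 1"
  shows "(\<Sum>a. ennreal (digit_weight r (Suc a)) * \<psi> (Suc a)) \<le> 2 * nu \<psi>"
proof -
  have "(\<Sum>a. ennreal (digit_weight r (Suc a)) * \<psi> (Suc a)) \<le>
        (\<Sum>a. 2 * (ennreal (1 / (real (Suc a))\<^sup>2) * \<psi> (Suc a)))"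
  proof (intro suminf_le summableI)
    fix a
    have "ennreal (digit_weight r (Suc a)) \<le> ennreal (2 * (1 / (real (Suc a))\<^sup>2))"
      using digit_weight_bounds(2)[of r "Suc a"] assms by (intro ennreal_leI) simp
    also have "\<dots> = 2 * ennreal (1 / (real (Suc a))\<^sup>2)" by (subst ennreal_mult') auto
    finally show "ennreal (digit_weight r (Suc a)) * \<psi> (Suc a) \<le> 2 * (ennreal (1 / (real (Suc a))\<^sup>2) * \<psi> (Suc a))"
      by (simp only: mult.assoc [symmetric]) (intro mult_right_mono; simp)
  qed
  then show ?thesis by (simp add: nu_Suc del: of_nat_Suc)
qed

text \<open>The weights sum to 1, so the expectation of \<open>f\<close> falls short of 1 by that of
  \<open>1 - f\<close>, which is at least \<open>c\<close>; the 3 is the loss in the lower bound of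
  the weights. The form \<open>exp (- c)\<close> suits products: it serves the second
  Borel--Cantelli lemma and the Laplace transform.\<close>

lemma digit_weight_sum_le_exp:
  assumes r: "0 \<le> r" "r \<le> 1" and f: "\<And>a. f a \<le> 1" and c: "c \<ge> 0" "ennreal (3 * c) \<le> nu (\<lambda>a. 1 - f a)"
  shows "(\<Sum>a. ennreal (digit_weight r (Suc a)) * f (Suc a)) \<le> ennreal (exp (- c))"
proof -
  let ?w = "\<lambda>a. ennreal (digit_weight r (Suc a))"
  let ?s = "\<Sum>a. ?w a * f (Suc a)"
  have "3 * ennreal c \<le> 3 * (\<Sum>a. ?w a * (1 - f (Suc a)))"
  proof -
    have "3 * ennreal c = ennreal (3 * c)" using c by (simp add: ennreal_mult')
    also have "\<dots> \<le> (\<Sum>a. ennreal (1 / (real (Suc a))\<^sup>2) * (1 - f (Suc a)))"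
      using c(2) by (simp only: nu_Suc[where \<psi> = "\<lambda>a. 1 - f a"])
    also have "\<dots> \<le> (\<Sum>a. 3 * (?w a * (1 - f (Suc a))))"
    proof (intro suminf_le summableI)
      fix a
      have "ennreal (1 / (real (Suc a))\<^sup>2) \<le> ennreal (3 * digit_weight r (Suc a))"
        using digit_weight_bounds(1)[of r "Suc a"] r by (intro ennreal_leI) (simp add: field_simps)
      also have "\<dots> = 3 * ?w a" using r by (subst ennreal_mult') (auto simp: digit_weight_nonneg)
      finally show "ennreal (1 / (real (Suc a))\<^sup>2) * (1 - f (Suc a)) \<le> 3 * (?w a * (1 - f (Suc a)))"
        by (simp only: mult.assoc [symmetric]) (intro mult_right_mono; simp)
    qed
    finally show ?thesis by simp
  qed
  then have "ennreal c \<le> (\<Sum>a. ?w a * (1 - f (Suc a)))"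
    by (subst (asm) ennreal_mult_le_mult_iff) auto
  \<comment> \<open>The comparison is made by addition, because \<open>?s\<close> is not yet known
    to be finite in \<open>ennreal\<close>.\<close>
  then have "?s + ennreal c \<le> ?s + (\<Sum>a. ?w a * (1 - f (Suc a)))" by (rule add_left_mono)
  also have "\<dots> = (\<Sum>a. ?w a * f (Suc a) + ?w a * (1 - f (Suc a)))"
    by (intro suminf_add summableI)
  also have "\<dots> = (\<Sum>a. ?w a)"
    using f by (intro suminf_cong) (simp add: distrib_left [symmetric] add_diff_inverse_ennreal)
  also have "\<dots> = ennreal 1"
    using digit_weight_sums[OF r(1)] r
    by (subst suminf_ennreal2) (auto simp: digit_weight_nonneg sums_iff)
  finally have *: "?s + ennreal c \<le> ennreal 1" .
  then have "?s \<noteq> top" by (auto simp: top_unique)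
  then obtain s where s: "?s = ennreal s" "s \<ge> 0" by (cases ?s) auto
  with * c have "ennreal (s + c) \<le> ennreal 1" by simp
  then have "s \<le> 1 + (- c)" by (simp only: ennreal_le_iff zero_le_one)
  also have "\<dots> \<le> exp (- c)" by (rule exp_ge_add_one_self)
  finally show ?thesis using s by (simp add: ennreal_leI)
qed

abbreviation gauss_unif :: "real measure" where "gauss_unif \<equiv> gauss_density 0"

lemma finite_measure_gauss_unif: "finite_measure gauss_unif"
  by (rule finite_measureI) (simp add: emeasure_gauss_density_UNIV)

lemma borel_cantelli_gauss:
  assumes [measurable]: "\<And>n. A n \<in> sets borel"
    and fin: "(\<Sum>n. emeasure gauss_unif (A n)) \<noteq> \<infinity>"
  shows "AE x in gauss_unif. \<forall>\<^sub>F n in sequentially. x \<notin> A n"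
proof -
  interpret finite_measure gauss_unif by (rule finite_measure_gauss_unif)
  have "AE x in gauss_unif. \<forall>\<^sub>F n in sequentially. x \<in> space gauss_unif - A n"
  proof (rule borel_cantelli_AE1)
    show "summable (\<lambda>n. measure gauss_unif (A n))"
      using fin by (intro summable_suminf_not_top) (auto simp: emeasure_eq_measure)
  qed (auto simp: emeasure_eq_measure)
  then show ?thesis by simp
qed

lemma borel_cantelli_gauss_ev:
  assumes [measurable]: "\<And>n. A n \<in> sets borel"
    and le: "\<forall>\<^sub>F n in sequentially. emeasure gauss_unif (A n) \<le> ennreal (h n)"
    and h: "summable h" "\<And>n. h n \<ge> 0"
  shows "AE x in gauss_unif. \<forall>\<^sub>F n in sequentially. x \<notin> A n"
proof -
  interpret finite_measure gauss_unif by (rule finite_measure_gauss_unif)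
  have "AE x in gauss_unif. \<forall>\<^sub>F n in sequentially. x \<in> space gauss_unif - A n"
  proof (rule borel_cantelli_AE1)
    show "summable (\<lambda>n. measure gauss_unif (A n))"
    proof (rule summable_comparison_test_ev[OF _ h(1)])
      show "\<forall>\<^sub>F n in sequentially. norm (measure gauss_unif (A n)) \<le> h n"
        using le by eventually_elim (use h(2) in \<open>simp add: emeasure_eq_measure\<close>)
    qed
  qed (auto simp: emeasure_eq_measure)
  then show ?thesis by simp
qed

lemma emeasure_eq_nn_integral:
  assumes "A \<in> sets M" "\<And>x. f x = indicator A x"
  shows "emeasure M A = (\<integral>\<^sup>+x. f x \<partial>M)"
  using assms by simp

lemma emeasure_digit_le:
  "emeasure gauss_unif {x. cf_digit (Suc n) x \<in> B} \<le> 2 * nu (indicator B)"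
proof -
  have "emeasure gauss_unif {x. cf_digit (Suc n) x \<in> B} =
     (\<integral>\<^sup>+x. 1 * indicator B (cf_digit (Suc n) x) \<partial>gauss_unif)"
    by (rule emeasure_eq_nn_integral) (auto split: split_indicator)
  also have "\<dots> \<le> 2 * nu (indicator B) * (\<integral>\<^sup>+x. 1 \<partial>gauss_unif)"
    using digit_weight_sum_le by (intro nn_integral_past_next_le[where \<phi> = "\<lambda>_. 1"]) auto
  finally show ?thesis by (simp add: emeasure_gauss_density_UNIV)
qed

lemma nn_integral_digit_le:
  "(\<integral>\<^sup>+x. \<psi> (cf_digit (Suc n) x) \<partial>gauss_unif) \<le> 2 * nu \<psi>"
proof -
  have "(\<integral>\<^sup>+x. 1 * \<psi> (cf_digit (Suc n) x) \<partial>gauss_unif) \<le> 2 * nu \<psi> * (\<integral>\<^sup>+x. 1 \<partial>gauss_unif)"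
    using digit_weight_sum_le by (intro nn_integral_past_next_le[where \<phi> = "\<lambda>_. 1"]) auto
  then show ?thesis by (simp add: emeasure_gauss_density_UNIV)
qed

lemma emeasure_past_next_le:
  assumes "Q = (\<lambda>x. R (digits n x))"
  shows "emeasure gauss_unif {x. Q x \<and> cf_digit (Suc n) x \<in> B} \<le>
     2 * nu (indicator B) * emeasure gauss_unif {x. Q x}"
proof -
  have R: "{x. R (digits n x)} \<in> sets borel" by measurable
  have "emeasure gauss_unif {x. Q x \<and> cf_digit (Suc n) x \<in> B} =
     (\<integral>\<^sup>+x. indicator {l. R l} (digits n x) * indicator B (cf_digit (Suc n) x) \<partial>gauss_unif)"
    unfolding assms
    by (rule emeasure_eq_nn_integral) (auto split: split_indicator)
  also have "\<dots> \<le> 2 * nu (indicator B) * (\<integral>\<^sup>+x. indicator {l. R l} (digits n x) \<partial>gauss_unif)"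
    using digit_weight_sum_le by (intro nn_integral_past_next_le) auto
  also have "(\<integral>\<^sup>+x. indicator {l. R l} (digits n x) \<partial>gauss_unif) = emeasure gauss_unif {x. Q x}"
    unfolding assms using R
    by (intro emeasure_eq_nn_integral [symmetric]) (auto split: split_indicator)
  finally show ?thesis .
qed

text \<open>Given any past, the digit avoids \<open>B n\<close> with probability at most
  \<open>exp (- c n)\<close>. These bounds multiply, so avoiding all sets from \<open>N\<close> on
  would force the series of the \<open>c n\<close> to converge.\<close>

lemma borel_cantelli_digits:
  assumes inf: "(\<Sum>n. nu (indicator (B n))) = \<infinity>"
  shows "AE x in gauss_unif. \<exists>\<^sub>F n in sequentially. cf_digit (Suc n) x \<in> B n"
proof -
  define c where "c = (\<lambda>n. enn2real (nu (indicator (B n))) / 3)"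
  have nu_c: "nu (indicator (B n)) = ennreal (3 * c n)" for n
  proof -
    have "nu (indicator (B n)) \<le> 2" by (rule nu_le_2) (auto split: split_indicator)
    then have "nu (indicator (B n)) < top" by (rule le_less_trans) auto
    then show ?thesis by (simp add: c_def)
  qed
  have c0: "c n \<ge> 0" for n by (simp add: c_def)
  define E where "E = (\<lambda>N. {x. \<forall>n\<ge>N. cf_digit (Suc n) x \<notin> B n})"
  have E_meas [measurable]: "E N \<in> sets borel" for N unfolding E_def by measurable
  have bound: "emeasure gauss_unif (E N) \<le> ennreal (exp (- sum c {N..<n}))" if "N \<le> n" for N n
  proof -
    \<comment> \<open>The product estimate starts at position 0, so the first \<open>N\<close>
      positions are padded with the neutral factor 1 and the exponent 0.\<close>
    define f where "f = (\<lambda>k a. if k < N then 1 else indicator (- B k) a :: ennreal)"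
    define d where "d = (\<lambda>k. if k < N then 0 else c k)"
    have "emeasure gauss_unif (E N) = (\<integral>\<^sup>+x. indicator (E N) x \<partial>gauss_unif)" by simp
    also have "\<dots> \<le> (\<integral>\<^sup>+x. (\<Prod>k<n. f k (cf_digit (Suc k) x)) \<partial>gauss_unif)"
    proof (rule nn_integral_mono)
      fix x
      show "indicator (E N) x \<le> (\<Prod>k<n. f k (cf_digit (Suc k) x))"
      proof (cases "x \<in> E N")
        case True
        then have "(\<Prod>k<n. f k (cf_digit (Suc k) x)) = 1"
          by (intro prod.neutral) (auto simp: E_def f_def)
        then show ?thesis using True by simp
      qed simp
    qed
    also have "\<dots> \<le> (\<Prod>k<n. ennreal (exp (- d k)))"
    proof (rule nn_integral_prod_digits_le)
      fix k and r :: real assume r: "0 \<le> r" "r \<le> 1"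
      show "(\<Sum>a. ennreal (digit_weight r (Suc a)) * f k (Suc a)) \<le> ennreal (exp (- d k))"
      proof (rule digit_weight_sum_le_exp[OF r])
        show "f k a \<le> 1" for a by (auto simp: f_def split: split_indicator)
        show "0 \<le> d k" by (simp add: d_def c0)
        show "ennreal (3 * d k) \<le> nu (\<lambda>a. 1 - f k a)"
        proof (cases "k < N")
          case False
          then have "(\<lambda>a. 1 - f k a) = indicator (B k)"
            by (auto simp: f_def fun_eq_iff split: split_indicator)
          then show ?thesis using False by (simp add: d_def nu_c)
        qed (simp add: d_def)
      qed
    qed auto
    also have "\<dots> = ennreal (\<Prod>k<n. exp (- d k))" by (rule prod_ennreal) auto
    also have "(\<Prod>k<n. exp (- d k)) = exp (- sum d {..<n})"
      by (simp add: exp_sum sum_negf [symmetric] flip: sum_negf)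
    also have "sum d {..<n} = sum c {N..<n}"
      using that by (intro sum.mono_neutral_cong_right) (auto simp: d_def)
    finally show ?thesis .
  qed
  have "E N \<in> null_sets gauss_unif" for N
  proof -
    have "emeasure gauss_unif (E N) = 0"
    proof (rule ccontr)
      assume "emeasure gauss_unif (E N) \<noteq> 0"
      moreover have "emeasure gauss_unif (E N) < top"
        using bound[of N N] by (auto simp: le_less_trans)
      ultimately obtain e where e: "e > 0" "emeasure gauss_unif (E N) = ennreal e"
        by (cases "emeasure gauss_unif (E N)") (auto simp: less_le)
      have le: "sum c {N..<n} \<le> - ln e" if "N \<le> n" for n
      proof -
        have "e \<le> exp (- sum c {N..<n})" using bound[OF that] e by (simp add: ennreal_le_iff)
        then have "ln e \<le> - sum c {N..<n}" using e by (metis ln_exp ln_le_cancel_iff exp_gt_zero)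
        then show ?thesis by simp
      qed
      have "summable (\<lambda>n. c (n + N))"
      proof (rule bounded_imp_summable)
        fix n
        have "(\<Sum>k\<le>n. c (k + N)) = sum c {N..<Suc n + N}"
          by (simp only: lessThan_Suc_atMost [symmetric] lessThan_atLeast0 sum.shift_bounds_nat_ivl [symmetric] add_0)
        also have "\<dots> \<le> - ln e" by (rule le) simp
        finally show "(\<Sum>k\<le>n. c (k + N)) \<le> - ln e" .
      qed (rule c0)
      then have "summable (\<lambda>n. 3 * c n)" by (intro summable_mult) (simp add: summable_iff_shift)
      then have "(\<Sum>n. ennreal (3 * c n)) = ennreal (\<Sum>n. 3 * c n)"
        using c0 by (intro suminf_ennreal2) auto
      with inf show False by (simp add: nu_c)
    qed
    then show ?thesis by (auto simp: null_sets_def)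
  qed
  then have "AE x in gauss_unif. \<forall>N. x \<notin> E N"
    by (subst AE_all_countable) (auto intro: AE_not_in)
  then show ?thesis
    by eventually_elim (auto simp: E_def frequently_sequentially)
qed

section \<open>Sums of prime digits\<close>

definition psum :: "nat \<Rightarrow> real \<Rightarrow> real" where
  "psum n x = (\<Sum>k<n. real (prime_digit (Suc k) x))"

text \<open>Fixes the indexing: the ratio at \<open>Suc n\<close> has the first \<open>n\<close>
  digits in its denominator, so its numerator is the next digit after that past.\<close>

lemma pd_ratio_Suc:
  "pd_ratio v (Suc n) x = (if psum n x = 0 then \<infinity> else ereal (v / psum n x))"
proof -
  have "(\<Sum>k=1..<Suc n. real (prime_digit k x)) = psum n x"
    unfolding psum_def lessThan_atLeast0 One_nat_def by (rule sum.shift_bounds_Suc_ivl)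
  then show ?thesis by (simp add: pd_ratio_def Let_def del: sum.op_ivl_Suc)
qed

lemma psum_nonneg: "psum n x \<ge> 0"
  by (simp add: psum_def sum_nonneg)

text \<open>As a function of the list of past digits, the sum is measurable and can take part in
  conditioning.\<close>

lemma psum_digits:
  "psum n x = (\<Sum>a\<leftarrow>digits n x. if prime a then real a else 0)"
proof -
  have "(\<Sum>a\<leftarrow>digits n x. if prime a then real a else 0) =
     (\<Sum>k<n. if prime (cf_digit (Suc k) x) then real (cf_digit (Suc k) x) else 0)"
    unfolding digits_def
    by (simp only: map_map o_def interv_sum_list_conv_sum_set_nat set_upt atLeast0LessThan)
  also have "\<dots> = psum n x" unfolding psum_def by (intro sum.cong) (auto simp: prime_digit_def)
  finally show ?thesis by simp
qed

lemma measurable_psum [measurable]: "psum n \<in> borel_measurable borel"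
  unfolding psum_digits[abs_def] by measurable

lemma prime_recip_sum_nonneg: "prime_recip_sum x \<ge> 0"
  unfolding prime_recip_sum_def by (intro sum_nonneg) auto

text \<open>An exponential Markov bound with the factor \<open>exp (- \<mu> a)\<close> per prime
  digit. Only primes up to \<open>1 / \<mu>\<close> are used, where
  \<open>1 - exp (- z) \<ge> z / 2\<close> holds for \<open>z = \<mu> p \<le> 1\<close>; this 2 and
  the 3 of the digit weights give the 6.\<close>

lemma psum_laplace:
  assumes \<mu>: "\<mu> > 0"
  shows "emeasure gauss_unif {x. psum n x < y} \<le>
     ennreal (exp (\<mu> * y - real n * (\<mu> * prime_recip_sum (1 / \<mu>) / 6)))"
proof -
  define f where "f = (\<lambda>a::nat. ennreal (exp (- \<mu> * (if prime a then real a else 0))))"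
  define c where "c = \<mu> * prime_recip_sum (1 / \<mu>) / 6"
  have c0: "c \<ge> 0" using \<mu> by (simp add: c_def prime_recip_sum_nonneg)
  have nu_f: "ennreal (3 * c) \<le> nu (\<lambda>a. 1 - f a)"
  proof -
    let ?P = "{p::nat. prime p \<and> real p \<le> 1 / \<mu>}"
    have "ennreal (3 * c) = ennreal (\<Sum>p\<in>?P. 1 / (real p)\<^sup>2 * (\<mu> * real p / 2))"
    proof -
      have "3 * c = \<mu> / 2 * (\<Sum>p\<in>?P. 1 / real p)"
        by (simp add: c_def prime_recip_sum_def)
      also have "\<dots> = (\<Sum>p\<in>?P. \<mu> / 2 * (1 / real p))" by (rule sum_distrib_left)
      also have "\<dots> = (\<Sum>p\<in>?P. 1 / (real p)\<^sup>2 * (\<mu> * real p / 2))"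
        by (intro sum.cong) (auto simp: power2_eq_square)
      finally show ?thesis by simp
    qed
    also have "\<dots> = (\<Sum>p\<in>?P. ennreal (1 / (real p)\<^sup>2 * (\<mu> * real p / 2)))"
      using \<mu> by (intro sum_ennreal [symmetric]) auto
    also have "\<dots> \<le> (\<Sum>p\<in>?P. ennreal (1 / (real p)\<^sup>2) * (1 - f p))"
    proof (rule sum_mono)
      fix p assume p: "p \<in> ?P"
      define z where "z = \<mu> * real p"
      have z: "0 \<le> z" "z \<le> 1" using p \<mu> by (auto simp: z_def field_simps)
      have "exp (- z) \<le> 1 - z / 2"
      proof -
        have "exp (- z) * (1 + z) \<le> exp (- z) * exp z"
          by (intro mult_left_mono exp_ge_add_one_self) auto
        then have "exp (- z) * (1 + z) \<le> 1" by (simp flip: exp_add)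
        then have "exp (- z) \<le> 1 / (1 + z)" using z by (simp add: field_simps)
        also have "\<dots> \<le> 1 - z / 2"
        proof -
          have "1 \<le> (1 - z / 2) * (1 + z)"
            using z mult_left_mono[of z 1 z] by (simp add: algebra_simps)
          then show ?thesis using z by (simp add: divide_le_eq)
        qed
        finally show ?thesis .
      qed
      moreover have "f p = ennreal (exp (- z))" using p by (simp add: f_def z_def)
      ultimately have "ennreal (z / 2) \<le> 1 - f p"
        by (auto simp: ennreal_minus intro!: ennreal_leI simp flip: ennreal_1)
      then have "ennreal (1 / (real p)\<^sup>2) * ennreal (z / 2) \<le> ennreal (1 / (real p)\<^sup>2) * (1 - f p)"
        by (rule mult_left_mono) simp
      then show "ennreal (1 / (real p)\<^sup>2 * (\<mu> * real p / 2)) \<le> ennreal (1 / (real p)\<^sup>2) * (1 - f p)"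
        using z by (subst ennreal_mult) (auto simp: z_def)
    qed
    also have "\<dots> \<le> nu (\<lambda>a. 1 - f a)" by (rule nu_finite_ge) simp
    finally show ?thesis .
  qed
  have f1: "f a \<le> 1" for a
    using \<mu> by (auto simp: f_def simp flip: ennreal_1)
  have "emeasure gauss_unif {x. psum n x < y} = (\<integral>\<^sup>+x. indicator {x. psum n x < y} x \<partial>gauss_unif)"
    by (rule emeasure_eq_nn_integral) auto
  also have "\<dots> \<le> (\<integral>\<^sup>+x. ennreal (exp (\<mu> * y)) * (\<Prod>k<n. f (cf_digit (Suc k) x)) \<partial>gauss_unif)"
  proof (rule nn_integral_mono)
    fix x
    have "(\<Prod>k<n. f (cf_digit (Suc k) x)) = ennreal (\<Prod>k<n. exp (- \<mu> * real (prime_digit (Suc k) x)))"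
    proof -
      have "f (cf_digit (Suc k) x) = ennreal (exp (- \<mu> * real (prime_digit (Suc k) x)))" for k
        by (simp add: f_def prime_digit_def)
      then show ?thesis by (simp only: prod_ennreal exp_ge_zero)
    qed
    also have "(\<Prod>k<n. exp (- \<mu> * real (prime_digit (Suc k) x))) = exp (- \<mu> * psum n x)"
      by (simp add: psum_def sum_distrib_left exp_sum)
    finally have "ennreal (exp (\<mu> * y)) * (\<Prod>k<n. f (cf_digit (Suc k) x)) = ennreal (exp (\<mu> * (y - psum n x)))"
      by (simp add: right_diff_distrib exp_diff exp_minus divide_inverse flip: ennreal_mult)
    moreover have "1 \<le> exp (\<mu> * (y - psum n x))" if "psum n x < y"
      using that \<mu> by simp
    ultimately show "indicator {x. psum n x < y} x \<le> ennreal (exp (\<mu> * y)) * (\<Prod>k<n. f (cf_digit (Suc k) x))"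
      by (auto split: split_indicator simp flip: ennreal_1)
  qed
  also have "\<dots> = ennreal (exp (\<mu> * y)) * (\<integral>\<^sup>+x. (\<Prod>k<n. f (cf_digit (Suc k) x)) \<partial>gauss_unif)"
    by (subst nn_integral_cmult) auto
  also have "\<dots> \<le> ennreal (exp (\<mu> * y)) * (\<Prod>k<n. ennreal (exp (- c)))"
    by (intro mult_left_mono nn_integral_prod_digits_le digit_weight_sum_le_exp f1 c0 nu_f) auto
  also have "(\<Prod>k<n. ennreal (exp (- c))) = ennreal (exp (- c) ^ n)"
    by (simp add: ennreal_power)
  also have "exp (- c) ^ n = exp (- (real n * c))"
    by (simp flip: exp_of_nat_mult)
  also have "ennreal (exp (\<mu> * y)) * ennreal (exp (- (real n * c))) = ennreal (exp (\<mu> * y - real n * c))"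
    by (simp add: exp_diff exp_minus divide_inverse flip: ennreal_mult)
  finally show ?thesis by (simp add: c_def)
qed

text \<open>The choice is \<open>\<mu> = 1 / sqrt n\<close>: cutting the primes at
  \<open>sqrt n\<close> does not change the order of the iterated logarithm, while the probability
  becomes at most \<open>exp (- sqrt n)\<close>, which is summable. Taking \<open>c / 24\<close>
  instead of \<open>c / 6\<close> leaves room for the exponent.\<close>

lemma psum_lower:
  "\<exists>\<delta>>0. AE x in gauss_unif. \<forall>\<^sub>F n in sequentially. \<delta> * bnorm n \<le> psum n x"
proof -
  obtain c where c: "c > 0" "\<forall>\<^sub>F x in at_top. prime_recip_sum x \<ge> c * ln (ln x)"
    using prime_recip_sum_lower by auto
  define \<delta> where "\<delta> = c / 24"
  have "filterlim (\<lambda>n::nat. sqrt (real n)) at_top sequentially" by real_asymp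
  with c(2) have ev: "\<forall>\<^sub>F n in sequentially. prime_recip_sum (sqrt (real n)) \<ge> c * ln (ln (sqrt (real n)))"
    unfolding filterlim_iff by blast
  have ev2: "\<forall>\<^sub>F n::nat in sequentially. c / 24 * ln (ln (real n + 27)) - c * ln (ln (sqrt (real n))) / 6 \<le> -1"
    using c(1) by real_asymp
  have ev3: "\<forall>\<^sub>F n::nat in sequentially. exp (- sqrt (real n)) \<le> 1 / (real n)\<^sup>2"
    by real_asymp
  have "AE x in gauss_unif. \<forall>\<^sub>F n in sequentially. x \<notin> {x. psum n x < \<delta> * bnorm n}"
  proof (rule borel_cantelli_gauss_ev)
    show "summable (\<lambda>n. 1 / (real n)\<^sup>2)"
      using inverse_power_summable[of 2, where 'a = real] by (simp add: inverse_eq_divide)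
    show "\<forall>\<^sub>F n in sequentially. emeasure gauss_unif {x. psum n x < \<delta> * bnorm n} \<le> ennreal (1 / (real n)\<^sup>2)"
      using ev ev2 ev3 eventually_gt_at_top[of 0]
    proof eventually_elim
      case (elim n)
      define s where "s = sqrt (real n)"
      have s: "s > 0" "real n = s * s" using elim by (simp_all add: s_def)
      have "emeasure gauss_unif {x. psum n x < \<delta> * bnorm n} \<le>
         ennreal (exp (1 / s * (\<delta> * bnorm n) - real n * (1 / s * prime_recip_sum (1 / (1 / s)) / 6)))"
        using s by (intro psum_laplace) auto
      also have "1 / s * (\<delta> * bnorm n) - real n * (1 / s * prime_recip_sum (1 / (1 / s)) / 6) =
         s * (\<delta> * ln (ln (real n + 27)) - prime_recip_sum s / 6)"
        unfolding bnorm_def using s(1) unfolding s(2) by (simp add: field_simps)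
      also have "\<dots> \<le> s * (-1)"
      proof (rule mult_left_mono)
        have "prime_recip_sum s \<ge> c * ln (ln s)" using elim(1) by (simp add: s_def)
        then show "\<delta> * ln (ln (real n + 27)) - prime_recip_sum s / 6 \<le> -1"
          using elim(2) unfolding s_def [symmetric] \<delta>_def by linarith
      qed (use s in simp)
      finally have "emeasure gauss_unif {x. psum n x < \<delta> * bnorm n} \<le> ennreal (exp (- s))" by simp
      also have "\<dots> \<le> ennreal (1 / (real n)\<^sup>2)" using elim(3) by (simp add: s_def ennreal_leI)
      finally show ?case .
    qed
  qed auto
  then show ?thesis using c by (intro exI[of _ \<delta>]) (simp add: \<delta>_def not_less)
qed

text \<open>Digits are truncated at \<open>Y = bnorm n\<close>. Some digit exceeds \<open>Y\<close>
  with probability at most \<open>4 n / Y\<close>, that is \<open>4 / ln (ln (n + 27))\<close>,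
  which tends to 0 but is not summable; the truncated sum has mean at most \<open>18 Y\<close>, and
  Markov's inequality applies. With \<open>M = 36 / \<epsilon>\<close> each part costs
  \<open>\<epsilon> / 2\<close>.\<close>

lemma psum_upper_in_probability:
  assumes \<epsilon>: "\<epsilon> > 0"
  shows "\<exists>M>0. \<forall>\<^sub>F n in sequentially. emeasure gauss_unif {x. psum n x > M * bnorm n} \<le> ennreal \<epsilon>"
proof (intro exI conjI)
  define M where "M = 36 / \<epsilon>"
  show M: "M > 0" using \<epsilon> by (simp add: M_def)
  have "\<forall>\<^sub>F n::nat in sequentially. 24 + 8 * ln (ln (real n * ln (ln (real n + 27)))) \<le> 9 * ln (ln (real n + 27))"
    by real_asymp
  moreover have "\<forall>\<^sub>F n::nat in sequentially. 4 / ln (ln (real n + 27)) \<le> \<epsilon> / 2"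
    using \<epsilon> by real_asymp
  ultimately show "\<forall>\<^sub>F n in sequentially. emeasure gauss_unif {x. psum n x > M * bnorm n} \<le> ennreal \<epsilon>"
    using eventually_ge_at_top[of 16]
  proof eventually_elim
    case (elim n)
    define Y where "Y = bnorm n"
    define l where "l = ln (ln (real n + 27))"
    define t where "t = (\<lambda>a::nat. ennreal (if prime a \<and> real a \<le> Y then real a else 0))"
    have l: "l \<ge> 1" unfolding l_def by (rule lnln_shift_ge_1) simp
    have Yl: "Y = real n * l" by (simp add: Y_def l_def bnorm_def)
    have Y: "Y \<ge> 16" using bnorm_ge[of n] elim by (simp add: Y_def)
    let ?D = "\<lambda>k. {x. cf_digit (Suc k) x \<in> {a. Y < real a}}"
    let ?T = "{x. ennreal (M * Y) \<le> (\<Sum>k<n. t (cf_digit (Suc k) x))}"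
    have sub: "{x. psum n x > M * bnorm n} \<subseteq> (\<Union>k<n. ?D k) \<union> ?T"
    proof (intro subsetI, rule ccontr)
      fix x assume x: "x \<in> {x. psum n x > M * bnorm n}" "x \<notin> (\<Union>k<n. ?D k) \<union> ?T"
      have "(\<Sum>k<n. t (cf_digit (Suc k) x)) = (\<Sum>k<n. ennreal (real (prime_digit (Suc k) x)))"
        using x by (intro sum.cong) (auto simp: t_def prime_digit_def not_less)
      also have "\<dots> = ennreal (psum n x)" unfolding psum_def by (rule sum_ennreal) simp
      finally have "(\<Sum>k<n. t (cf_digit (Suc k) x)) = ennreal (psum n x)" .
      moreover have "ennreal (M * Y) \<le> ennreal (psum n x)" using x by (intro ennreal_leI) (simp add: Y_def)
      ultimately show False using x by simp
    qed
    have meas [measurable]: "?D k \<in> sets borel" "?T \<in> sets borel" for k by measurable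
    have D: "emeasure gauss_unif (?D k) \<le> ennreal (4 / Y)" for k
    proof -
      define m where "m = nat \<lfloor>Y\<rfloor>"
      have m: "m \<ge> 1" "Y \<le> 2 * real m" using Y unfolding m_def by linarith+
      have "{a::nat. Y < real a} = {a. m < a}" using Y unfolding m_def by (auto; linarith)
      then have "nu (indicator {a. Y < real a}) \<le> ennreal (1 / real m)" using nu_tail[OF m(1)] by simp
      also have "\<dots> \<le> ennreal (2 / Y)" using m Y by (intro ennreal_leI) (simp add: field_simps)
      finally have "2 * nu (indicator {a. Y < real a}) \<le> 2 * ennreal (2 / Y)" by (rule mult_left_mono) simp
      also have "\<dots> = ennreal (4 / Y)" using Y by (simp flip: ennreal_numeral ennreal_mult)
      finally show ?thesis using emeasure_digit_le[of k] by (rule order_trans[rotated])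
    qed
    have "nu t = (\<integral>\<^sup>+a\<in>{p. prime p \<and> real p \<le> Y}. ennreal (1 / real a) \<partial>count_space UNIV)"
      unfolding nu_def t_def
      by (intro nn_integral_cong) (auto split: split_indicator simp: power2_eq_square simp flip: ennreal_mult)
    also have "\<dots> = (\<Sum>p | prime p \<and> real p \<le> Y. ennreal (1 / real p))"
      by (subst nn_integral_indicator_finite) auto
    also have "\<dots> = ennreal (prime_recip_sum Y)"
      unfolding prime_recip_sum_def by (rule sum_ennreal) simp
    also have "\<dots> \<le> ennreal (9 * l)"
      using prime_recip_sum_upper[OF Y] elim(1) by (intro ennreal_leI) (simp add: Yl l_def)
    finally have nut: "nu t \<le> ennreal (9 * l)" .
    have "ennreal (M * Y) * emeasure gauss_unif ?T = (\<integral>\<^sup>+x. ennreal (M * Y) * indicator ?T x \<partial>gauss_unif)"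
      by (subst nn_integral_cmult_indicator) auto
    also have "\<dots> \<le> (\<integral>\<^sup>+x. (\<Sum>k<n. t (cf_digit (Suc k) x)) \<partial>gauss_unif)"
      by (intro nn_integral_mono) (auto split: split_indicator)
    also have "\<dots> = (\<Sum>k<n. \<integral>\<^sup>+x. t (cf_digit (Suc k) x) \<partial>gauss_unif)"
      by (rule nn_integral_sum) auto
    also have "\<dots> \<le> (\<Sum>k<n. 2 * ennreal (9 * l))"
      using nut nn_integral_digit_le by (intro sum_mono) (meson mult_left_mono order_trans zero_le)
    also have "\<dots> = ennreal (real n * (18 * l))"
      using l by (simp add: ennreal_of_nat_eq_real_of_nat flip: ennreal_mult ennreal_numeral)
    also have "real n * (18 * l) = M * Y * (18 / M)" using M by (simp add: Yl)
    also have "ennreal \<dots> = ennreal (M * Y) * ennreal (18 / M)" using M Y by (intro ennreal_mult) auto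
    finally have T: "emeasure gauss_unif ?T \<le> ennreal (18 / M)"
      using M Y by (subst (asm) ennreal_mult_le_mult_iff) auto
    have "emeasure gauss_unif {x. psum n x > M * bnorm n} \<le> emeasure gauss_unif ((\<Union>k<n. ?D k) \<union> ?T)"
      using sub by (rule emeasure_mono) simp
    also have "\<dots> \<le> emeasure gauss_unif (\<Union>k<n. ?D k) + emeasure gauss_unif ?T"
      by (rule emeasure_subadditive) auto
    also have "emeasure gauss_unif (\<Union>k<n. ?D k) \<le> (\<Sum>k<n. emeasure gauss_unif (?D k))"
      by (rule emeasure_subadditive_finite) auto
    also have "\<dots> \<le> (\<Sum>k<n. ennreal (4 / Y))" using D by (intro sum_mono)
    also have "\<dots> = ennreal (real n * (4 / Y))"
      using Y by (simp add: ennreal_of_nat_eq_real_of_nat flip: ennreal_mult)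
    also have "real n * (4 / Y) = 4 / l" using elim(3) l by (simp add: Yl)
    also have "ennreal (4 / l) + emeasure gauss_unif ?T \<le> ennreal (\<epsilon> / 2) + ennreal (18 / M)"
      using T elim(2) by (intro add_mono ennreal_leI) (auto simp: l_def)
    also have "\<dots> = ennreal \<epsilon>" using \<epsilon> by (simp add: M_def flip: ennreal_plus)
    finally show ?case by (simp add: add_right_mono)
  qed
qed

section \<open>The expected number of hits\<close>

definition lnln_prime_series :: "(real \<Rightarrow> real) \<Rightarrow> ennreal" where
  "lnln_prime_series g =
     (\<integral>\<^sup>+p\<in>{p::nat. prime p}. ennreal (lnln_quot (g (real p)) / (real p)\<^sup>2) \<partial>count_space UNIV)"

definition hits :: "(real \<Rightarrow> real) \<Rightarrow> real \<Rightarrow> nat \<Rightarrow> nat set" where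
  "hits g \<kappa> n = {p. prime p \<and> \<kappa> * bnorm n < g (real p)}"

text \<open>Exchange of summations: a prime \<open>p\<close> is counted once for every time
  \<open>n\<close> at which it would be a hit.\<close>

lemma suminf_nu_hits:
  assumes \<kappa>: "\<kappa> > 0"
  shows "(\<Sum>n. nu (indicator (hits g \<kappa> n))) =
    (\<integral>\<^sup>+p\<in>{p::nat. prime p}. ennreal (real (card {n. \<kappa> * bnorm n < g (real p)}) / (real p)\<^sup>2) \<partial>count_space UNIV)"
proof -
  have "(\<Sum>n. nu (indicator (hits g \<kappa> n))) =
     (\<integral>\<^sup>+p. (\<Sum>n. ennreal (1 / (real p)\<^sup>2) * indicator (hits g \<kappa> n) p) \<partial>count_space UNIV)"
    unfolding nu_def by (subst nn_integral_suminf) auto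
  also have "\<dots> = (\<integral>\<^sup>+p\<in>{p::nat. prime p}. ennreal (real (card {n. \<kappa> * bnorm n < g (real p)}) / (real p)\<^sup>2) \<partial>count_space UNIV)"
  proof (intro nn_integral_cong)
    fix p :: nat
    let ?N = "{n. \<kappa> * bnorm n < g (real p)}"
    have fin: "finite ?N" using \<kappa> by (rule finite_bnorm_less)
    have "(\<Sum>n. indicator (hits g \<kappa> n) p :: ennreal) = indicator {p. prime p} p * (\<Sum>n. indicator ?N n)"
      by (auto simp: hits_def split: split_indicator intro!: suminf_cong)
    also have "(\<Sum>n. indicator ?N n :: ennreal) = (\<Sum>n\<in>?N. 1)"
      using fin by (subst suminf_finite[of ?N]) auto
    also have "\<dots> = ennreal (real (card ?N))" by (simp add: ennreal_of_nat_eq_real_of_nat)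
    finally show "(\<Sum>n. ennreal (1 / (real p)\<^sup>2) * indicator (hits g \<kappa> n) p) =
        ennreal (real (card ?N) / (real p)\<^sup>2) * indicator {p. prime p} p"
      by (simp add: mult_ac flip: ennreal_mult)
  qed
  finally show ?thesis .
qed

text \<open>The right side is free of \<open>\<kappa>\<close>. So \<open>\<kappa>\<close> may be
  arbitrarily small in the convergent case and arbitrarily large in the divergent one.\<close>

lemma suminf_nu_hits_eq_top_iff:
  assumes \<kappa>: "\<kappa> > 0" and g: "\<And>t. t \<ge> 0 \<Longrightarrow> g t > 3"
  shows "(\<Sum>n. nu (indicator (hits g \<kappa> n))) = \<infinity> \<longleftrightarrow> lnln_prime_series g = \<infinity>"
proof -
  let ?N = "\<lambda>p::nat. real (card {n. \<kappa> * bnorm n < g (real p)})"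
  have transfer: "(\<integral>\<^sup>+p\<in>{p::nat. prime p}. ennreal (G p / (real p)\<^sup>2) \<partial>count_space UNIV) \<noteq> \<infinity>"
    if C: "C > 0" "\<And>p. G p \<le> C * H p" 
      and fin: "(\<integral>\<^sup>+p\<in>{p::nat. prime p}. ennreal (H p / (real p)\<^sup>2) \<partial>count_space UNIV) \<noteq> \<infinity>" for C G H
  proof -
    have "(\<integral>\<^sup>+p\<in>{p::nat. prime p}. ennreal (G p / (real p)\<^sup>2) \<partial>count_space UNIV) \<le>
       (\<integral>\<^sup>+p. ennreal C * (ennreal (H p / (real p)\<^sup>2) * indicator {p. prime p} p) \<partial>count_space UNIV)"
    proof (intro nn_integral_mono)
      fix p :: nat
      have "ennreal (G p / (real p)\<^sup>2) \<le> ennreal (C * (H p / (real p)\<^sup>2))"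
        using C(2)[of p] by (intro ennreal_leI) (simp add: divide_right_mono)
      also have "\<dots> = ennreal C * ennreal (H p / (real p)\<^sup>2)" using C by (intro ennreal_mult') simp
      finally show "ennreal (G p / (real p)\<^sup>2) * indicator {p. prime p} p \<le>
         ennreal C * (ennreal (H p / (real p)\<^sup>2) * indicator {p. prime p} p)"
        by (simp only: mult.assoc [symmetric]) (intro mult_right_mono; simp)
    qed
    also have "\<dots> = ennreal C * (\<integral>\<^sup>+p\<in>{p::nat. prime p}. ennreal (H p / (real p)\<^sup>2) \<partial>count_space UNIV)"
      by (rule nn_integral_cmult) simp
    also have "\<dots> < top" using fin by (simp add: ennreal_mult_less_top top.not_eq_extremum)
    finally show ?thesis by auto
  qed
  obtain C1 where C1: "C1 > 0" "\<And>v. v > 3 \<Longrightarrow> real (card {n. \<kappa> * bnorm n < v}) \<le> C1 * lnln_quot v"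
    using card_bnorm_less_upper[OF \<kappa>] by auto
  obtain C2 where C2: "C2 > 0" "\<And>v. v > 3 \<Longrightarrow> lnln_quot v \<le> C2 * real (card {n. \<kappa> * bnorm n < v})"
    using card_bnorm_less_lower[OF \<kappa>] by auto
  have a: "?N p \<le> C1 * lnln_quot (g (real p))" for p using C1(2) g by simp
  have b: "lnln_quot (g (real p)) \<le> C2 * ?N p" for p using C2(2) g by simp
  show ?thesis unfolding suminf_nu_hits[OF \<kappa>] lnln_prime_series_def
    using transfer[where G = ?N and H = "\<lambda>p. lnln_quot (g (real p))", OF C1(1) a]
      transfer[where H = ?N and G = "\<lambda>p. lnln_quot (g (real p))", OF C2(1) b] by blast
qed

section \<open>The dichotomy\<close>

text \<open>For each threshold \<open>1 / (i + 1)\<close> there are only finitely many hits a.e.;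
  dividing by the lower bound \<open>\<delta> * bnorm n\<close> of the sum makes the ratio
  eventually smaller than any \<open>e\<close>.\<close>

lemma pd_ratio_tendsto_0:
  assumes g: "\<And>t. t \<ge> 0 \<Longrightarrow> g t > 3" and fin: "lnln_prime_series g \<noteq> \<infinity>"
  shows "AE x in gauss_unif. (\<lambda>n. pd_ratio (g (real (prime_digit n x))) n x) \<longlonglongrightarrow> 0"
proof -
  obtain \<delta> where \<delta>: "\<delta> > 0" "AE x in gauss_unif. \<forall>\<^sub>F n in sequentially. \<delta> * bnorm n \<le> psum n x"
    using psum_lower by auto
  have "AE x in gauss_unif. \<forall>\<^sub>F n in sequentially. x \<notin> {x. cf_digit (Suc n) x \<in> hits g (1 / real (Suc i)) n}" for i
  proof (rule borel_cantelli_gauss)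
    have "(\<Sum>n. emeasure gauss_unif {x. cf_digit (Suc n) x \<in> hits g (1 / real (Suc i)) n}) \<le>
        (\<Sum>n. 2 * nu (indicator (hits g (1 / real (Suc i)) n)))"
      by (intro suminf_le summableI emeasure_digit_le)
    also have "\<dots> = 2 * (\<Sum>n. nu (indicator (hits g (1 / real (Suc i)) n)))" by simp
    finally have le: "(\<Sum>n. emeasure gauss_unif {x. cf_digit (Suc n) x \<in> hits g (1 / real (Suc i)) n}) \<le>
        2 * (\<Sum>n. nu (indicator (hits g (1 / real (Suc i)) n)))" .
    have "(\<Sum>n. nu (indicator (hits g (1 / real (Suc i)) n))) \<noteq> \<infinity>"
      using fin by (subst suminf_nu_hits_eq_top_iff) (use g in auto)
    then have "2 * (\<Sum>n. nu (indicator (hits g (1 / real (Suc i)) n))) < top"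
      by (simp add: ennreal_mult_less_top less_top del: of_nat_Suc)
    with le have "(\<Sum>n. emeasure gauss_unif {x. cf_digit (Suc n) x \<in> hits g (1 / real (Suc i)) n}) < top"
      by (rule le_less_trans)
    then show "(\<Sum>n. emeasure gauss_unif {x. cf_digit (Suc n) x \<in> hits g (1 / real (Suc i)) n}) \<noteq> \<infinity>"
      by simp
  qed measurable
  then have "AE x in gauss_unif. \<forall>i. \<forall>\<^sub>F n in sequentially. cf_digit (Suc n) x \<notin> hits g (1 / real (Suc i)) n"
    by (subst AE_all_countable) simp
  with \<delta>(2) show ?thesis
  proof eventually_elim
    case (elim x)
    define q where "q = (\<lambda>n. g (real (prime_digit (Suc n) x)) / psum n x)"
    have pos: "\<forall>\<^sub>F n in sequentially. psum n x > 0"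
      using elim(1) eventually_gt_at_top[of 0]
    proof eventually_elim
      case (elim n)
      then have "bnorm n > 0" using bnorm_ge[of n] by linarith
      then have "\<delta> * bnorm n > 0" using \<delta>(1) by simp
      with elim show ?case by linarith
    qed
    have "q \<longlonglongrightarrow> 0"
    proof (rule tendstoI)
      fix e :: real assume e: "e > 0"
      then have "e * \<delta> > 0" using \<delta> by simp
      then obtain i where i: "inverse (real (Suc i)) < e * \<delta>" using reals_Archimedean by blast
      \<comment> \<open>A nonprime digit counts as 0 and yields the constant \<open>g 0\<close>,
        which \<open>hits\<close> does not cover but \<open>bnorm n\<close> outgrows.\<close>
      have nonprime: "\<forall>\<^sub>F n in sequentially. real (Suc i) * g 0 \<le> real n"
        using filterlim_real_sequentially unfolding filterlim_at_top by blast
      show "\<forall>\<^sub>F n in sequentially. dist (q n) 0 < e"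
        using elim(1) elim(2)[rule_format, of i] pos nonprime eventually_gt_at_top[of 0]
      proof eventually_elim
        case (elim n)
        let ?G = "g (real (prime_digit (Suc n) x))"
        have b: "bnorm n > 0" "real n \<le> bnorm n" using elim(5) bnorm_ge[of n] by linarith+
        have "?G \<le> bnorm n / real (Suc i)"
        proof (cases "prime (cf_digit (Suc n) x)")
          case True
          then show ?thesis using elim(2) by (simp add: hits_def prime_digit_def not_less)
        next
          case False
          have "real (Suc i) * g 0 \<le> bnorm n" using elim(4) b(2) by linarith
          then show ?thesis using False by (simp add: prime_digit_def field_simps del: of_nat_Suc)
        qed
        moreover have "?G > 0" using g[of "real (prime_digit (Suc n) x)"] by simp
        ultimately have "\<bar>q n\<bar> \<le> (bnorm n / real (Suc i)) / (\<delta> * bnorm n)"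
          unfolding q_def using elim(1) elim(3) b \<delta>(1)
          by (subst abs_of_nonneg, simp, intro frac_le) auto
        also have "\<dots> = inverse (real (Suc i)) / \<delta>" using b by (simp add: field_simps del: of_nat_Suc)
        also have "\<dots> < e" using i \<delta> by (simp add: divide_less_eq del: of_nat_Suc)
        finally show ?case by (simp add: dist_real_def)
      qed
    qed
    then have "(\<lambda>n. ereal (q n)) \<longlonglongrightarrow> 0" by (simp add: zero_ereal_def)
    then have "(\<lambda>n. pd_ratio (g (real (prime_digit (Suc n) x))) (Suc n) x) \<longlonglongrightarrow> 0"
    proof (rule Lim_transform_eventually)
      show "\<forall>\<^sub>F n in sequentially. ereal (q n) = pd_ratio (g (real (prime_digit (Suc n) x))) (Suc n) x"
        using pos by eventually_elim (simp add: pd_ratio_Suc q_def)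
    qed
    then show ?case by (rule LIMSEQ_imp_Suc)
  qed
qed

text \<open>Stopping at the first time the partial sum reaches 1 overshoots by at most one term, and
  terms are at most 2; hence the 3.\<close>

lemma suminf_divergent_block:
  fixes v :: "nat \<Rightarrow> ennreal"
  assumes v: "\<And>n. v n \<le> 2" and inf: "(\<Sum>n. v n) = \<infinity>"
  shows "\<exists>t\<ge>s. 1 \<le> sum v {s..<t} \<and> sum v {s..<t} \<le> 3"
proof -
  have "\<exists>t\<ge>s. 1 \<le> sum v {s..<t}"
  proof (rule ccontr)
    assume "\<not> ?thesis"
    then have lt: "sum v {s..<t} \<le> 1" if "t \<ge> s" for t using that by (meson linear)
    have "sum v {..<n} \<le> sum v {..<s} + 1" for n
    proof (cases "n \<le> s")
      case True
      then have "sum v {..<n} \<le> sum v {..<s}" by (intro sum_mono2) auto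
      also have "\<dots> \<le> sum v {..<s} + 1" by simp
      finally show ?thesis .
    next
      case False
      then have "sum v {..<n} = sum v {..<s} + sum v {s..<n}"
        by (simp add: lessThan_atLeast0 sum.atLeastLessThan_concat)
      then show ?thesis using lt[of n] False by (simp add: add_left_mono)
    qed
    then have "(\<Sum>n. v n) \<le> sum v {..<s} + 1" by (intro suminf_le_const summableI)
    also have "\<dots> \<le> (\<Sum>n<s. 2) + 1" using v by (intro add_right_mono sum_mono)
    also have "\<dots> < top" by (simp add: ennreal_mult_less_top of_nat_less_top)
    finally show False using inf by simp
  qed
  then obtain t0 where t0: "t0 \<ge> s \<and> 1 \<le> sum v {s..<t0}" by blast
  define t where "t = (LEAST t. t \<ge> s \<and> 1 \<le> sum v {s..<t})"
  have t: "t \<ge> s" "1 \<le> sum v {s..<t}" unfolding t_def using LeastI[of "\<lambda>t. t \<ge> s \<and> 1 \<le> sum v {s..<t}", OF t0] by auto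
  have "t \<noteq> s" using t by auto
  with t obtain t' where t': "t = Suc t'" "t' \<ge> s" by (cases t) auto
  have "\<not> (t' \<ge> s \<and> 1 \<le> sum v {s..<t'})" using not_less_Least[of t' "\<lambda>t. t \<ge> s \<and> 1 \<le> sum v {s..<t}"] t' by (simp add: t_def)
  then have "sum v {s..<t'} \<le> 1" using t' by simp
  then have "sum v {s..<t'} + v t' \<le> 1 + 2" using v by (rule add_mono)
  then show ?thesis using t t' by (intro exI[of _ t]) simp
qed

lemma suminf_over_blocks:
  fixes F :: "nat \<Rightarrow> ennreal"
  assumes "disjoint_family I" "\<And>k. finite (I k)" "\<And>n. n \<notin> (\<Union>k. I k) \<Longrightarrow> F n = 0"
  shows "(\<Sum>n. F n) = (\<Sum>k. \<Sum>n\<in>I k. F n)"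
proof -
  have "(\<Sum>n. F n) = (\<integral>\<^sup>+n\<in>(\<Union>k. I k). F n \<partial>count_space UNIV)"
    unfolding nn_integral_count_space_nat [symmetric]
    using assms(3) by (intro nn_integral_cong) (auto split: split_indicator)
  also have "\<dots> = (\<Sum>k. \<integral>\<^sup>+n\<in>I k. F n \<partial>count_space UNIV)"
    using assms(1) by (intro nn_integral_disjoint_family) auto
  finally show ?thesis using assms(2) by (simp add: nn_integral_indicator_finite)
qed

lemma suminf_1_ennreal: "(\<Sum>n::nat. 1 :: ennreal) = \<infinity>"
proof (rule ccontr)
  assume "(\<Sum>n::nat. 1 :: ennreal) \<noteq> \<infinity>"
  then have "summable (\<lambda>n::nat. 1 :: real)" by (intro summable_suminf_not_top) auto
  then show False by (simp add: summable_const_iff)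
qed

text \<open>Since the sum of the preceding digits exceeds \<open>M * bnorm n\<close> with small but not summable probability,
  the times \<open>n\<close> are restricted to disjoint blocks carrying total hitting mass between 1 and 3; on the
  \<open>k\<close>-th block the exceptional probability is at most \<open>2\<^sup>-\<^sup>k\<close>, which makes the exceptional hits summable.\<close>

lemma pd_ratio_frequently_large:
  assumes g: "\<And>t. t \<ge> 0 \<Longrightarrow> g t > 3" and inf: "lnln_prime_series g = \<infinity>"
  shows "AE x in gauss_unif. \<forall>i::nat. \<exists>\<^sub>F n in sequentially.
           ereal (real i) \<le> pd_ratio (g (real (prime_digit n x))) n x"
proof -
  have "\<forall>k::nat. \<exists>M N. M > 0 \<and> (\<forall>n\<ge>N. emeasure gauss_unif {x. psum n x > M * bnorm n} \<le> ennreal ((1 / 2) ^ k))"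
    using psum_upper_in_probability[of "(1 / 2) ^ k" for k :: nat] by (simp add: eventually_sequentially)
  then obtain M :: "nat \<Rightarrow> real" and N :: "nat \<Rightarrow> nat" where M: "\<And>k. M k > 0"
    and MN: "\<And>k n. n \<ge> N k \<Longrightarrow> emeasure gauss_unif {x. psum n x > M k * bnorm n} \<le> ennreal ((1 / 2) ^ k)"
    by metis
  \<comment> \<open>The threshold exceeds the typical size of the sum by the factor
    \<open>k + 1\<close>, so hits in later blocks give ever larger ratios.\<close>
  define K where "K = (\<lambda>k. (real k + 1) * M k)"
  have K: "K k > 0" for k using M[of k] by (simp add: K_def)
  define v where "v = (\<lambda>k n. nu (indicator (hits g (K k) n)))"
  have v2: "v k n \<le> 2" for k n unfolding v_def by (rule nu_le_2) (auto split: split_indicator)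
  have v_inf: "(\<Sum>n. v k n) = \<infinity>" for k
    using suminf_nu_hits_eq_top_iff[OF K g] inf by (simp add: v_def)
  have block: "\<exists>p. (N k \<le> fst p \<and> m \<le> fst p) \<and> fst p \<le> snd p \<and> 1 \<le> sum (v k) {fst p..<snd p} \<and> sum (v k) {fst p..<snd p} \<le> 3" for k m
  proof -
    obtain t where "t \<ge> max (N k) m" "1 \<le> sum (v k) {max (N k) m..<t}" "sum (v k) {max (N k) m..<t} \<le> 3"
      using suminf_divergent_block[of "v k" "max (N k) m"] v2 v_inf by blast
    then show ?thesis by (intro exI[of _ "(max (N k) m, t)"]) auto
  qed
  \<comment> \<open>Each block starts after the end of the previous one, for disjointness, and
    beyond \<open>N k\<close>, where the bound \<open>2\<^sup>-\<^sup>k\<close> on the exceptional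
    probability is valid.\<close>
  have "\<exists>p. \<forall>k. (N k \<le> fst (p k) \<and> fst (p k) \<le> snd (p k) \<and> 1 \<le> sum (v k) {fst (p k)..<snd (p k)} \<and> sum (v k) {fst (p k)..<snd (p k)} \<le> 3)
       \<and> snd (p k) \<le> fst (p (Suc k))"
  proof (rule dependent_nat_choice)
    show "\<exists>p. N 0 \<le> fst p \<and> fst p \<le> snd p \<and> 1 \<le> sum (v 0) {fst p..<snd p} \<and> sum (v 0) {fst p..<snd p} \<le> 3"
      using block[of 0 0] by blast
    show "\<exists>q. (N (Suc k) \<le> fst q \<and> fst q \<le> snd q \<and> 1 \<le> sum (v (Suc k)) {fst q..<snd q} \<and> sum (v (Suc k)) {fst q..<snd q} \<le> 3) \<and> snd p \<le> fst q" for p k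
      using block[of "Suc k" "snd p"] by blast
  qed
  then obtain p where p: "\<And>k. N k \<le> fst (p k)" "\<And>k. fst (p k) \<le> snd (p k)"
     "\<And>k. 1 \<le> sum (v k) {fst (p k)..<snd (p k)}" "\<And>k. sum (v k) {fst (p k)..<snd (p k)} \<le> 3"
     "\<And>k. snd (p k) \<le> fst (p (Suc k))"
    by blast
  define I where "I = (\<lambda>k. {fst (p k)..<snd (p k)})"
  have mono: "snd (p j) \<le> snd (p k)" if "j \<le> k" for j k
    using that by (rule lift_Suc_mono_le[rotated]) (meson p(2,5) order_trans)
  have order: "snd (p j) \<le> fst (p k)" if "j < k" for j k
  proof -
    obtain k' where k': "k = Suc k'" "j \<le> k'" using \<open>j < k\<close> by (cases k) auto
    then show ?thesis using mono[of j k'] p(5)[of k'] by simp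
  qed
  have uniq: "j = k" if "n \<in> I j" "n \<in> I k" for n j k
  proof (rule ccontr)
    assume "j \<noteq> k"
    then consider "j < k" | "k < j" by linarith
    then show False using that order[of j k] order[of k j] by cases (auto simp: I_def)
  qed
  have disj: "disjoint_family I" unfolding disjoint_family_on_def using uniq by blast
  define B where "B = (\<lambda>n. {a. \<exists>k. n \<in> I k \<and> a \<in> hits g (K k) n})"
  have B: "B n = hits g (K k) n" if "n \<in> I k" for n k
    using that uniq by (auto simp: B_def)
  define Bad where "Bad = (\<lambda>n. {x. (\<exists>k. n \<in> I k \<and> psum n x > M k * bnorm n) \<and> cf_digit (Suc n) x \<in> B n})"
  have "(\<Sum>n. nu (indicator (B n))) = (\<Sum>k. \<Sum>n\<in>I k. nu (indicator (B n)))"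
  proof (rule suminf_over_blocks[OF disj])
    fix n assume "n \<notin> (\<Union>k. I k)"
    then have "B n = {}" by (auto simp: B_def)
    then show "nu (indicator (B n)) = 0" by (simp add: nu_def)
  qed (simp add: I_def)
  also have "\<dots> = (\<Sum>k. sum (v k) (I k))"
    by (intro suminf_cong sum.cong) (auto simp: B v_def)
  also have "\<dots> \<ge> (\<Sum>k. 1)"
    using p(3) by (intro suminf_le summableI) (auto simp: I_def)
  finally have "(\<Sum>n. nu (indicator (B n))) = \<infinity>" by (simp add: suminf_1_ennreal top_unique)
  then have hit: "AE x in gauss_unif. \<exists>\<^sub>F n in sequentially. cf_digit (Suc n) x \<in> B n"
    by (rule borel_cantelli_digits)
  have "AE x in gauss_unif. \<forall>\<^sub>F n in sequentially. x \<notin> Bad n"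
  proof (rule borel_cantelli_gauss)
    show "Bad n \<in> sets borel" for n unfolding Bad_def by measurable
    have "(\<Sum>n. emeasure gauss_unif (Bad n)) = (\<Sum>k. \<Sum>n\<in>I k. emeasure gauss_unif (Bad n))"
    proof (rule suminf_over_blocks[OF disj])
      fix n assume "n \<notin> (\<Union>k. I k)"
      then have "Bad n = {}" by (auto simp: Bad_def)
      then show "emeasure gauss_unif (Bad n) = 0" by simp
    qed (simp add: I_def)
    also have "\<dots> \<le> (\<Sum>k. 6 * ennreal ((1 / 2) ^ k))"
    proof (intro suminf_le summableI)
      fix k
      \<comment> \<open>A large sum is an event of the first \<open>n\<close> digits, so the next
        digit's hit contributes the factor \<open>2 * v k n\<close> on top of its probability
        \<open>2\<^sup>-\<^sup>k\<close>.\<close>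
      have "(\<Sum>n\<in>I k. emeasure gauss_unif (Bad n)) \<le> (\<Sum>n\<in>I k. v k n * (2 * ennreal ((1 / 2) ^ k)))"
      proof (rule sum_mono)
        fix n assume n: "n \<in> I k"
        have "Bad n = {x. psum n x > M k * bnorm n \<and> cf_digit (Suc n) x \<in> hits g (K k) n}"
          using n uniq B[OF n] by (auto simp: Bad_def)
        also have "emeasure gauss_unif \<dots> \<le> 2 * nu (indicator (hits g (K k) n)) * emeasure gauss_unif {x. psum n x > M k * bnorm n}"
          by (rule emeasure_past_next_le[where R = "\<lambda>l. (\<Sum>a\<leftarrow>l. if prime a then real a else 0) > M k * bnorm n"])
             (simp add: psum_digits)
        also have "\<dots> \<le> 2 * nu (indicator (hits g (K k) n)) * ennreal ((1 / 2) ^ k)"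
          using n p(1)[of k] by (intro mult_left_mono MN) (auto simp: I_def)
        finally show "emeasure gauss_unif (Bad n) \<le> v k n * (2 * ennreal ((1 / 2) ^ k))"
          by (simp add: v_def mult_ac)
      qed
      also have "\<dots> = sum (v k) (I k) * (2 * ennreal ((1 / 2) ^ k))" by (simp add: sum_distrib_right)
      also have "\<dots> \<le> 3 * (2 * ennreal ((1 / 2) ^ k))"
        using p(4) by (intro mult_right_mono) (auto simp: I_def)
      also have "\<dots> = 6 * ennreal ((1 / 2) ^ k)" by (simp flip: mult.assoc)
      finally show "(\<Sum>n\<in>I k. emeasure gauss_unif (Bad n)) \<le> 6 * ennreal ((1 / 2) ^ k)" .
    qed
    also have "\<dots> = 6 * ennreal (\<Sum>k. (1 / 2) ^ k)"
      by (simp add: suminf_ennreal2 summable_geometric)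
    also have "\<dots> < top" by (simp add: ennreal_mult_less_top)
    finally show "(\<Sum>n. emeasure gauss_unif (Bad n)) \<noteq> \<infinity>" by simp
  qed
  with hit show ?thesis
  proof eventually_elim
    case (elim x)
    show ?case
    proof
      fix i :: nat
      have "\<forall>\<^sub>F n in sequentially. x \<notin> Bad n \<and> n \<ge> snd (p i)"
        using elim(2) eventually_ge_at_top by (rule eventually_conj)
      with elim(1) have "\<exists>\<^sub>F n in sequentially. cf_digit (Suc n) x \<in> B n \<and> x \<notin> Bad n \<and> n \<ge> snd (p i)"
        by (rule frequently_eventually_frequently)
      then have "\<exists>\<^sub>F n in sequentially. ereal (real i) \<le> pd_ratio (g (real (prime_digit (Suc n) x))) (Suc n) x"
      proof (rule frequently_elim1)
        fix n assume n: "cf_digit (Suc n) x \<in> B n \<and> x \<notin> Bad n \<and> n \<ge> snd (p i)"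
        then obtain k where k: "n \<in> I k" "cf_digit (Suc n) x \<in> hits g (K k) n" by (auto simp: B_def)
        \<comment> \<open>A time past the end of block \<open>i\<close> lies in a later block, so
          the factor \<open>k + 1\<close> is larger than \<open>i\<close>.\<close>
        have "i \<le> k" using n k mono[of k i] by (cases "k \<le> i") (auto simp: I_def)
        have le: "psum n x \<le> M k * bnorm n" using n k by (auto simp: Bad_def)
        have big: "K k * bnorm n < g (real (prime_digit (Suc n) x))"
          using k by (auto simp: hits_def prime_digit_def)
        have "real i * psum n x \<le> (real k + 1) * (M k * bnorm n)"
          using \<open>i \<le> k\<close> le psum_nonneg[of n x] by (intro mult_mono) auto
        also have "\<dots> \<le> g (real (prime_digit (Suc n) x))" using big by (simp add: K_def mult.assoc)
        \<comment> \<open>If the sum vanishes, the ratio is infinite by convention and the claim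
          holds as well.\<close>
        finally show "ereal (real i) \<le> pd_ratio (g (real (prime_digit (Suc n) x))) (Suc n) x"
          using psum_nonneg[of n x] by (auto simp: pd_ratio_Suc le_divide_eq)
      qed
      then show "\<exists>\<^sub>F n in sequentially. ereal (real i) \<le> pd_ratio (g (real (prime_digit n x))) n x"
        unfolding frequently_sequentially by (meson Suc_le_D Suc_le_lessD le_SucI order_refl le_trans less_imp_le_nat lessI)
    qed
  qed
qed

lemma limsup_eq_PInf:
  fixes f :: "nat \<Rightarrow> ereal"
  assumes "\<And>i::nat. \<exists>\<^sub>F n in sequentially. ereal (real i) \<le> f n"
  shows "limsup f = \<infinity>"
proof (rule ccontr)
  assume "limsup f \<noteq> \<infinity>"
  then obtain i where "limsup f < ereal (real i)" using less_PInf_Ex_of_nat by auto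
  then have "\<forall>\<^sub>F n in sequentially. f n < ereal (real i)" by (rule Limsup_lessD)
  then have "\<not> (\<exists>\<^sub>F n in sequentially. ereal (real i) \<le> f n)" by (simp add: frequently_def not_le)
  with assms show False by blast
qed

section \<open>From the prime series to the integral\<close>

text \<open>A point \<open>s\<close> of the \<open>j\<close>-th block satisfies
  \<open>s \<le> 16 ^ (j + 1) \<le> 16 s\<close>, so \<open>g s\<close> is comparable to the value
  at the right end, and \<open>lnln_quot\<close> preserves this.\<close>

lemma lnln_prime_series_vs_integral:
  assumes J: "J \<ge> 1" and C: "C \<ge> 1" and meas [measurable]: "g \<in> borel_measurable borel"
    and g: "\<And>t. t \<ge> 0 \<Longrightarrow> g t > 3"
    and comp: "\<And>s t. 16 ^ J \<le> t \<Longrightarrow> t \<le> s \<Longrightarrow> s \<le> 16 * t \<Longrightarrow> g s \<le> C * g t \<and> g t \<le> C * g s"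
  shows "lnln_prime_series g = \<infinity> \<longleftrightarrow>
    (\<integral>\<^sup>+y\<in>{16 ^ J<..}. ennreal (lnln_quot (g y) / (y\<^sup>2 * ln y)) \<partial>lborel) = \<infinity>"
proof -
  obtain K where K: "K \<ge> 1" "\<And>v w. v > 3 \<Longrightarrow> w > 3 \<Longrightarrow> v \<le> C * w \<Longrightarrow> w \<le> C * v \<Longrightarrow> lnln_quot v \<le> K * lnln_quot w"
    using lnln_quot_scale[OF C] by auto
  have [measurable]: "lnln_quot \<in> borel_measurable borel"
    unfolding lnln_quot_def[abs_def] by measurable
  have "lnln_prime_series g = \<infinity> \<longleftrightarrow> prime_series (\<lambda>y. lnln_quot (g y)) J = \<infinity>"
    unfolding lnln_prime_series_def prime_series_0_eq_top_iff ..
  also have "\<dots> \<longleftrightarrow> (\<integral>\<^sup>+y\<in>{16 ^ J<..}. ennreal (lnln_quot (g y) / (y\<^sup>2 * ln y)) \<partial>lborel) = \<infinity>"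
  proof (rule prime_series_vs_integral[OF J K(1)])
    fix j :: nat and s :: real assume s: "J \<le> j" "16 ^ j < s" "s \<le> 16 ^ Suc j"
    have "(16::real) ^ J \<le> 16 ^ j" using s by (intro power_increasing) auto
    then have sJ: "16 ^ J \<le> s" using s by linarith
    have pos: "g s > 3" "g (16 ^ Suc j) > 3" using s by (auto intro!: g intro: order_trans[of 0 "16 ^ j"] less_imp_le)
    have "g (16 ^ Suc j) \<le> C * g s \<and> g s \<le> C * g (16 ^ Suc j)"
      using s sJ by (intro comp) auto
    then show "0 \<le> lnln_quot (g s) \<and> lnln_quot (g s) \<le> K * lnln_quot (g (16 ^ Suc j)) \<and>
        lnln_quot (g (16 ^ Suc j)) \<le> K * lnln_quot (g s)"
      using pos K(2) lnln_quot_ge_1[of "g s"] by auto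
  qed measurable
  finally show ?thesis .
qed

text \<open>Prepares the first claim, where the shift by 4 lifts the identity above 3. The integrand
  is eventually at least half of \<open>1 / (y ln y ln (ln y))\<close>, whose primitive
  \<open>ln (ln (ln y))\<close> is unbounded.\<close>

lemma lnln_prime_series_shift: "lnln_prime_series (\<lambda>t. t + 4) = \<infinity>"
proof -
  let ?f = "\<lambda>y. ennreal (lnln_quot (y + 4) / (y\<^sup>2 * ln y))"
  let ?I = "\<integral>\<^sup>+y\<in>{16 ^ 1<..}. ?f y \<partial>lborel"
  have [measurable]: "lnln_quot \<in> borel_measurable borel"
    unfolding lnln_quot_def[abs_def] by measurable
  have "?I = \<infinity>"
  proof (rule ccontr)
    assume "?I \<noteq> \<infinity>"
    then obtain I where I: "?I = ennreal I" "I \<ge> 0" by (cases ?I) auto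
    have "\<forall>\<^sub>F y in at_top. (y + 4) / ln (ln (y + 4)) / (y\<^sup>2 * ln y) \<ge> 1 / (2 * y * ln y * ln (ln (y::real)))"
      by real_asymp
    then obtain Y where Y: "\<And>y::real. y \<ge> Y \<Longrightarrow> (y + 4) / ln (ln (y + 4)) / (y\<^sup>2 * ln y) \<ge> 1 / (2 * y * ln y * ln (ln y))"
      by (auto simp: eventually_at_top_linorder)
    define a where "a = max Y 27"
    have a: "a \<ge> Y" "a \<ge> 27" by (auto simp: a_def)
    have pos: "y > 0" "ln y > 0" "ln (ln y) > 0" if "y \<ge> a" for y
      using lnln_pos[of y] a that by auto
    have bound: "ln (ln (ln T)) \<le> 2 * I + ln (ln (ln a))" if T: "T \<ge> a" for T
    proof -
      have "ennreal (ln (ln (ln T)) / 2 - ln (ln (ln a)) / 2) =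
         (\<integral>\<^sup>+y. ennreal (1 / (2 * y * ln y * ln (ln y))) * indicator {a..T} y \<partial>lborel)"
      proof (rule nn_integral_FTC_Icc [symmetric])
        fix y assume "y \<in> {a..T}"
        with pos[of y] have "y > 0" "ln y > 0" "ln (ln y) > 0" by auto
        then show "((\<lambda>y. ln (ln (ln y)) / 2) has_real_derivative 1 / (2 * y * ln y * ln (ln y))) (at y)"
          "0 \<le> 1 / (2 * y * ln y * ln (ln y))"
          by (auto intro!: derivative_eq_intros simp: field_simps)
      qed (use T in auto)
      also have "\<dots> \<le> ?I"
      proof (rule nn_integral_mono)
        fix y :: real
        show "ennreal (1 / (2 * y * ln y * ln (ln y))) * indicator {a..T} y \<le> ?f y * indicator {16 ^ 1<..} y"
        proof (cases "y \<in> {a..T}")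
          case True
          then have "ennreal (1 / (2 * y * ln y * ln (ln y))) \<le> ?f y"
            using Y[of y] a by (intro ennreal_leI) (auto simp: lnln_quot_def)
          then show ?thesis using True a by simp
        qed simp
      qed
      finally have "ln (ln (ln T)) / 2 - ln (ln (ln a)) / 2 \<le> I" using I by (simp add: ennreal_le_iff)
      then show ?thesis by simp
    qed
    have "filterlim (\<lambda>T::real. ln (ln (ln T))) at_top at_top" by real_asymp
    then have "\<forall>\<^sub>F T in at_top. 2 * I + ln (ln (ln a)) < ln (ln (ln T))"
      unfolding filterlim_at_top_dense by blast
    then have "\<forall>\<^sub>F T::real in at_top. False" using eventually_ge_at_top[of a]
      by eventually_elim (use bound in force)
    then show False by simp
  qed
  then show ?thesis
    by (subst lnln_prime_series_vs_integral[of 1 16]) (auto simp: field_simps)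
qed

theorem theorem2p8:
  fixes g :: "real \<Rightarrow> real"
  assumes g_meas: "g \<in> borel_measurable borel"
    and g_range: "\<forall>t\<ge>0. g t > 3"
    and g_reg: "\<forall>\<eta> :: real \<Rightarrow> real. \<eta> \<sim>[at_top] (\<lambda>t. t) \<longrightarrow>
                   asymp_order (\<lambda>t. g (\<eta> t)) g"
  shows "(AE x in lborel. x \<in> {0<..1} \<longrightarrow>
            limsup (\<lambda>n. pd_ratio (real (prime_digit n x)) n x) = \<infinity>)
       \<and> (\<exists>c0>1. \<forall>c\<ge>c0.
            ((AE x in lborel. x \<in> {0<..1} \<longrightarrow>
                limsup (\<lambda>n. pd_ratio (g (real (prime_digit n x))) n x) = \<infinity>)
             \<longleftrightarrow>
             (\<integral>\<^sup>+ y\<in>{c..}. ennreal (g y / ln (ln (g y)) / (y\<^sup>2 * ln y)) \<partial>lborel) = \<infinity>)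
          \<and> ((\<integral>\<^sup>+ y\<in>{c..}. ennreal (g y / ln (ln (g y)) / (y\<^sup>2 * ln y)) \<partial>lborel) \<noteq> \<infinity>
             \<longrightarrow> (AE x in lborel. x \<in> {0<..1} \<longrightarrow>
                   (\<lambda>n. pd_ratio (g (real (prime_digit n x))) n x) \<longlonglongrightarrow> 0)))"
proof
  obtain \<delta> where \<delta>: "\<delta> > 0" "AE x in gauss_unif. \<forall>\<^sub>F n in sequentially. \<delta> * bnorm n \<le> psum n x"
    using psum_lower by auto
  have "AE x in gauss_unif. \<forall>i::nat. \<exists>\<^sub>F n in sequentially. ereal (real i) \<le> pd_ratio (real (prime_digit n x) + 4) n x"
    using pd_ratio_frequently_large[of "\<lambda>t. t + 4"] lnln_prime_series_shift by simp
  with \<delta>(2) have "AE x in gauss_unif. limsup (\<lambda>n. pd_ratio (real (prime_digit n x)) n x) = \<infinity>"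
  proof eventually_elim
    case (elim x)
    have "\<forall>\<^sub>F n in sequentially. psum n x \<ge> 1"
    proof -
      have "\<forall>\<^sub>F n in sequentially. 1 / \<delta> \<le> real n"
        using filterlim_real_sequentially unfolding filterlim_at_top by blast
      with elim(1) show ?thesis
      proof eventually_elim
        case (elim n)
        have "1 \<le> \<delta> * real n" using elim(2) \<delta>(1) by (simp add: field_simps)
        also have "\<dots> \<le> \<delta> * bnorm n" using bnorm_ge[of n] \<delta>(1) by simp
        finally show ?case using elim(1) by linarith
      qed
    qed
    then have "\<forall>\<^sub>F n in sequentially. psum (n - 1) x \<ge> 1"
      by (subst eventually_sequentially_Suc [symmetric]) simp
    then have ev: "\<forall>\<^sub>F n in sequentially. psum (n - 1) x \<ge> 1 \<and> n \<ge> 1"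
      using eventually_ge_at_top by (rule eventually_conj)
    show ?case
    proof (rule limsup_eq_PInf)
      fix i :: nat
      \<comment> \<open>Asking for \<open>i + 4\<close> undoes the shift: the sum is eventually at
        least 1, so the additional 4 in the numerator raises the ratio by at most 4.\<close>
      have "\<exists>\<^sub>F n in sequentially. ereal (real (i + 4)) \<le> pd_ratio (real (prime_digit n x) + 4) n x \<and> psum (n - 1) x \<ge> 1 \<and> n \<ge> 1"
        using elim(2)[rule_format, of "i + 4"] ev by (rule frequently_eventually_frequently)
      then show "\<exists>\<^sub>F n in sequentially. ereal (real i) \<le> pd_ratio (real (prime_digit n x)) n x"
      proof (rule frequently_elim1)
        fix n assume n: "ereal (real (i + 4)) \<le> pd_ratio (real (prime_digit n x) + 4) n x \<and> psum (n - 1) x \<ge> 1 \<and> n \<ge> 1"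
        then obtain m where m: "n = Suc m" by (cases n) auto
        then have S: "psum m x \<ge> 1" using n by simp
        then have "(real i + 4) * psum m x \<le> real (prime_digit n x) + 4"
          using n unfolding m pd_ratio_Suc by (simp add: le_divide_eq)
        then have "real i * psum m x \<le> real (prime_digit n x)"
          using S by (simp add: distrib_right)
        then show "ereal (real i) \<le> pd_ratio (real (prime_digit n x)) n x"
          unfolding m pd_ratio_Suc using S by (simp add: le_divide_eq)
      qed
    qed
  qed
  then show "AE x in lborel. x \<in> {0<..1} \<longrightarrow> limsup (\<lambda>n. pd_ratio (real (prime_digit n x)) n x) = \<infinity>"
    unfolding AE_gauss_density_0 .
next
  have g: "g t > 3" if "t \<ge> 0" for t using g_range that by blast
  then have g_pos: "g t > 0" if "t \<ge> 0" for t using that by (meson less_trans zero_less_numeral)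
  let ?f = "\<lambda>y. ennreal (g y / ln (ln (g y)) / (y\<^sup>2 * ln y))"
  obtain C T where C: "C \<ge> 1" "T > 0"
    and comp: "\<And>s t. t \<ge> T \<Longrightarrow> t \<le> s \<Longrightarrow> s \<le> 16 * t \<Longrightarrow> g s \<le> C * g t \<and> g t \<le> C * g s"
    using regular_imp_scale_bound[OF g_pos g_reg, of 16] by blast
  have series: "lnln_prime_series g = \<infinity> \<longleftrightarrow> (\<integral>\<^sup>+ y\<in>{16 ^ J<..}. ?f y \<partial>lborel) = \<infinity>"
    if J: "J \<ge> 1" "16 ^ J \<ge> T" for J
    using lnln_prime_series_vs_integral[OF J(1) C(1) g_meas g comp] J(2)
    by (simp add: lnln_quot_def)
  obtain J0 where "T < 16 ^ J0" using real_arch_pow[of 16 T] by auto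
  moreover have "(16::real) ^ J0 \<le> 16 ^ Suc J0" by simp
  ultimately obtain J where J: "J \<ge> 1" "16 ^ J \<ge> T" by (metis Suc_eq_plus1_left le_add1 less_imp_le order_trans)
  show "\<exists>c0>1. \<forall>c\<ge>c0.
            ((AE x in lborel. x \<in> {0<..1} \<longrightarrow>
                limsup (\<lambda>n. pd_ratio (g (real (prime_digit n x))) n x) = \<infinity>)
             \<longleftrightarrow> (\<integral>\<^sup>+ y\<in>{c..}. ?f y \<partial>lborel) = \<infinity>)
          \<and> ((\<integral>\<^sup>+ y\<in>{c..}. ?f y \<partial>lborel) \<noteq> \<infinity>
             \<longrightarrow> (AE x in lborel. x \<in> {0<..1} \<longrightarrow>
                   (\<lambda>n. pd_ratio (g (real (prime_digit n x))) n x) \<longlonglongrightarrow> 0))"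
  proof (intro exI conjI allI impI)
    show "1 < 1 + (16::real) ^ J" by simp
    fix c :: real assume c: "1 + 16 ^ J \<le> c"
    \<comment> \<open>The range \<open>{c..}\<close> is enclosed between two tails that start at
      powers of 16; both integrals diverge exactly when the prime series does, so the choice of
      \<open>c\<close> is immaterial.\<close>
    obtain L where L: "c < 16 ^ L" using real_arch_pow[of 16 c] by auto
    have "J \<le> L"
    proof (rule ccontr)
      assume "\<not> J \<le> L"
      then have "(16::real) ^ L \<le> 16 ^ J" by (intro power_increasing) auto
      with L c show False by linarith
    qed
    then have "(16::real) ^ J \<le> 16 ^ L" by (intro power_increasing) auto
    then have LT: "L \<ge> 1" "16 ^ L \<ge> T" using J \<open>J \<le> L\<close> by linarith+
    have "(\<integral>\<^sup>+ y\<in>{16 ^ L<..}. ?f y \<partial>lborel) \<le> (\<integral>\<^sup>+ y\<in>{c..}. ?f y \<partial>lborel)"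
      "(\<integral>\<^sup>+ y\<in>{c..}. ?f y \<partial>lborel) \<le> (\<integral>\<^sup>+ y\<in>{16 ^ J<..}. ?f y \<partial>lborel)"
      using L c by (intro nn_integral_mono; auto split: split_indicator)+
    then have iff: "(\<integral>\<^sup>+ y\<in>{c..}. ?f y \<partial>lborel) = \<infinity> \<longleftrightarrow> lnln_prime_series g = \<infinity>"
      using series[OF J] series[OF LT] by (auto simp: top_unique)
    have conv: "AE x in gauss_unif. (\<lambda>n. pd_ratio (g (real (prime_digit n x))) n x) \<longlonglongrightarrow> 0"
      if "(\<integral>\<^sup>+ y\<in>{c..}. ?f y \<partial>lborel) \<noteq> \<infinity>"
      using that iff by (intro pd_ratio_tendsto_0 g) auto
    then show "AE x in lborel. x \<in> {0<..1} \<longrightarrow> (\<lambda>n. pd_ratio (g (real (prime_digit n x))) n x) \<longlonglongrightarrow> 0"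
      if "(\<integral>\<^sup>+ y\<in>{c..}. ?f y \<partial>lborel) \<noteq> \<infinity>"
      using that unfolding AE_gauss_density_0 by blast
    show "(AE x in lborel. x \<in> {0<..1} \<longrightarrow> limsup (\<lambda>n. pd_ratio (g (real (prime_digit n x))) n x) = \<infinity>)
       \<longleftrightarrow> (\<integral>\<^sup>+ y\<in>{c..}. ?f y \<partial>lborel) = \<infinity>"
      unfolding AE_gauss_density_0 [symmetric]
    proof
      assume "(\<integral>\<^sup>+ y\<in>{c..}. ?f y \<partial>lborel) = \<infinity>"
      then have "AE x in gauss_unif. \<forall>i::nat. \<exists>\<^sub>F n in sequentially. ereal (real i) \<le> pd_ratio (g (real (prime_digit n x))) n x"
        using iff by (intro pd_ratio_frequently_large g) auto
      then show "AE x in gauss_unif. limsup (\<lambda>n. pd_ratio (g (real (prime_digit n x))) n x) = \<infinity>"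
        by eventually_elim (rule limsup_eq_PInf, blast)
    next
      assume *: "AE x in gauss_unif. limsup (\<lambda>n. pd_ratio (g (real (prime_digit n x))) n x) = \<infinity>"
      show "(\<integral>\<^sup>+ y\<in>{c..}. ?f y \<partial>lborel) = \<infinity>"
      proof (rule ccontr)
        assume "(\<integral>\<^sup>+ y\<in>{c..}. ?f y \<partial>lborel) \<noteq> \<infinity>"
        \<comment> \<open>The limit 0 and the infinite limsup exclude each other at every point, so
          the whole space would be null, although it has mass 1.\<close>
        from conv[OF this] * have "AE x in gauss_unif. x \<notin> UNIV"
        proof eventually_elim
          case (elim x)
          from lim_imp_Limsup[OF _ elim(1)] elim(2) show ?case by simp
        qed
        then have "UNIV \<in> null_sets gauss_unif" by (subst AE_iff_null_sets) auto
        then show False using emeasure_gauss_density_UNIV[of 0] by (simp add: null_sets_def)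
      qed
    qed
  qed
qed

end
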